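(* Let $\mathbf{P}$ be an operad with $\mathbf{P}(0)=(0)$ and all $\mathbf{P}(n)$ finite-dimensional, and let $V$ be a finite-dimensional vector space. For $y\in M^D_{\mathbf{P}}(V)$ let $\phi_y:\overline{F_{\mathbf{P}}(V)}\to\overline{F_{\mathbf{P}}(V)}$, $\phi_y(x)=x\vartriangleleft y$. 1. The map $\phi:y\mapsto\phi_y$ is an anti-isomorphism of monoids from $(M^D_{\mathbf{P}}(V),\lozenge)$ to the monoid $\mathcal{M}_{\mathbf{P}}(V)$ of continuous $\mathbf{P}$-algebra endomorphisms of $\overline{F_{\mathbf{P}}(V)}$. 2. Its restriction to $G^B_{\mathbf{P}}(V)$ is an anti-isomorphism from $G^B_{\mathbf{P}}(V)$ to $\mathcal{G}^{(1)}_{\mathbf{P}}(V)$, the group of continuous $\mathbf{P}$-algebra automorphisms of $\overline{F_{\mathbf{P}}(V)}$ which are tangent to the identity.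
   Context: $K$ is a field of characteristic zero. $F_{\mathbf{P}}(V)=\bigoplus_{n\ge1}\mathbf{P}(n)\otimes_{\mathfrak{S}_n}V^{\otimes n}$ is the free $\mathbf{P}$-algebra ($p^\sigma\otimes x_1\cdots x_n$ identified with $p\otimes x_{\sigma^{-1}(1)}\cdots x_{\sigma^{-1}(n)}$; class of $p\otimes x_1\cdots x_n$ denoted $p.(x_1\cdots x_n)$), $\overline{F_{\mathbf{P}}(V)}=\prod_{n\ge1}\mathbf{P}(n)\otimes_{\mathfrak{S}_n}V^{\otimes n}$ its completion, with the distance $d(x,y)=2^{-val(x-y)}$, $val$ being the valuation for this grading. $\overline{F_{\mathbf{P}}(V)}_2=\prod_{n\ge2}\mathbf{P}(n)\otimes_{\mathfrak{S}_n}V^{\otimes n}$. Any $\phi\in\mathcal{M}_{\mathbf{P}}(V)$ preserves $\overline{F_{\mathbf{P}}(V)}_2$; it is tangent to the identity if $\phi(v)-v\in\overline{F_{\mathbf{P}}(V)}_2$ for all $v\in V$ (here $v$ is identified with $I.v$). $\mathbf{C}_V$ is the operad $\mathbf{C}_V(n)=\mathrm{End}_K(V,V^{\otimes n})$ (linear maps $V\to V^{\otimes n}$), $f\circ_ig=(\mathrm{Id}^{\otimes(i-1)}\otimes g\otimes\mathrm{Id}^{\otimes(m-i)})\circ f$ for $f\in\mathbf{C}_V(m)$, $f^\sigma(x)=x_{\sigma(1)}\cdots x_{\sigma(n)}$ if $f(x)=x_1\cdots x_n$. Put $\mathbf{Q}=\mathbf{P}\otimes\mathbf{C}_V$, with unit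 $I_{\mathbf{Q}}=I\otimes\mathrm{Id}_V$. $M^D_{\mathbf{P}}(V)=\prod_{n\ge1}\mathrm{coinv}\,\mathbf{Q}(n)$ ($\mathfrak{S}_n$-coinvariants) with the monoid product $x\lozenge y=\sum_{n\ge1}x_n\circ(y,\ldots,y)$ (induced by the composition of $\mathbf{Q}$, $x_n$ the arity $n$ component of $x$). $G^B_{\mathbf{P}}(V)=\prod_{n\ge2}\mathrm{coinv}\,\mathbf{Q}(n)$ with the group product $x\lozenge y=y+\sum_nx_n\circ(I_{\mathbf{Q}}+y,\ldots,I_{\mathbf{Q}}+y)$, identified with a submonoid of $M^D_{\mathbf{P}}(V)$ through $x\mapsto I_{\mathbf{Q}}+x$. The right action $\vartriangleleft$ of $(M^D_{\mathbf{P}}(V),\lozenge)$ on $\overline{F_{\mathbf{P}}(V)}$: let $\leftarrowtail$ be the action $p.(x_1\cdots x_k)\leftarrowtail\overline{q\otimes f}=\sum_{i=1}^k(p\circ_iq).(x_1\cdots f(x_i)\cdots x_k)$ of the pre-Lie algebra $\mathrm{coinv}\,\mathbf{Q}$ (product induced by $p\bullet q=\sum_ip\circ_iq$), extended to $S(\mathrm{coinv}\,\mathbf{Q})$ by $m\leftarrowtail1=m$ and $m\leftarrowtail x_1\cdots x_k=(m\leftarrowtail x_1\cdots x_{k-1})\leftarrowtail x_k-\sum_{i<k}m\leftarrowtail(x_1\cdots(x_i\bullet x_k)\cdots x_{k-1})$. Then $x\vartriangleleft y=x\leftarrowtail e^{y-I_{\mathbf{Q}}}$ (extended to completions). Explicitly,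 writing $y(v)=\sum q.f(v)\in\overline{F_{\mathbf{P}}(V)}$ for $v\in V$ and $y=\sum\overline{q\otimes f}$, one has $p.(x_1\cdots x_n)\vartriangleleft y=p.(y(x_1),\ldots,y(x_n))$. *)

theory Defs
  imports
    "HOL-Analysis.Abstract_Metric_Spaces"
    "HOL-Algebra.Group"
    "HOL-Combinatorics.Permutations"
    "HOL-Library.Poly_Mapping"
    "HOL-Library.Groups_Big_Fun"
    "HOL-Library.Function_Algebras"
begin

section \<open>Free vector spaces and quotients\<close>

text \<open>The type of finitely supported functions from \<open>'a\<close> to \<open>'k\<close> is the free vector space on
  \<open>'a\<close>, with basis the elements \<open>gen a\<close>. All tensor products and spaces of coinvariants below are
  presented by generators and relations inside such spaces.\<close>

definition fscale :: "'k::field \<Rightarrow> ('a \<Rightarrow>\<^sub>0 'k) \<Rightarrow> ('a \<Rightarrow>\<^sub>0 'k)" where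
  "fscale c f = Poly_Mapping.map ((*) c) f"

lemma lookup_fscale [simp]: "Poly_Mapping.lookup (fscale c f) a = c * Poly_Mapping.lookup f a"
  by (simp add: fscale_def Poly_Mapping.map.rep_eq when_def)

interpretation free: vector_space "fscale :: 'k::field \<Rightarrow> ('a \<Rightarrow>\<^sub>0 'k) \<Rightarrow> ('a \<Rightarrow>\<^sub>0 'k)"
  by unfold_locales (auto intro!: poly_mapping_eqI simp: lookup_add algebra_simps)

abbreviation gen :: "'a \<Rightarrow> ('a \<Rightarrow>\<^sub>0 'k::field)" where
  "gen a \<equiv> Poly_Mapping.single a 1"

text \<open>Linear extension of a map defined on generators, and multilinear extension of a map defined
  on lists of generators.\<close>

definition lext :: "('a \<Rightarrow> ('b \<Rightarrow>\<^sub>0 'k)) \<Rightarrow> ('a \<Rightarrow>\<^sub>0 'k::field) \<Rightarrow> ('b \<Rightarrow>\<^sub>0 'k)" where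
  "lext g f = (\<Sum>a\<in>Poly_Mapping.keys f. fscale (Poly_Mapping.lookup f a) (g a))"

fun mlext :: "('a list \<Rightarrow> ('b \<Rightarrow>\<^sub>0 'k)) \<Rightarrow> ('a \<Rightarrow>\<^sub>0 'k::field) list \<Rightarrow> ('b \<Rightarrow>\<^sub>0 'k)" where
  "mlext g [] = g []"
| "mlext g (u # us) = lext (\<lambda>a. mlext (\<lambda>as. g (a # as)) us) u"

text \<open>The quotient by a subspace \<open>W\<close> is realised on a linear complement of \<open>W\<close>: \<open>quot W\<close> is a
  (fixed) linear idempotent with kernel \<open>W\<close>, and its image plays the role of the quotient space,
  \<open>quot W\<close> itself being the canonical surjection. In this way a class is itself an element of the
  original space (one of its own representatives), so a map that vanishes on \<open>W\<close> induces a map on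
  the quotient simply by restriction.\<close>

definition quot :: "('a \<Rightarrow>\<^sub>0 'k::field) set \<Rightarrow> ('a \<Rightarrow>\<^sub>0 'k) \<Rightarrow> ('a \<Rightarrow>\<^sub>0 'k)" where
  "quot W = (SOME q. Vector_Spaces.linear fscale fscale q \<and> (\<forall>x. q (q x) = q x) \<and>
                     (\<forall>x. q x = 0 \<longleftrightarrow> x \<in> W))"

lemma quot_exists:
  assumes "free.subspace (W :: ('a \<Rightarrow>\<^sub>0 'k::field) set)"
  shows "\<exists>q. Vector_Spaces.linear fscale fscale q \<and> (\<forall>x. q (q x) = q x) \<and> (\<forall>x. q x = 0 \<longleftrightarrow> x \<in> W)"
proof -
  interpret vp: vector_space_pair "fscale :: 'k \<Rightarrow> ('a \<Rightarrow>\<^sub>0 'k) \<Rightarrow> _" "fscale :: 'k \<Rightarrow> ('a \<Rightarrow>\<^sub>0 'k) \<Rightarrow> _" ..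
  have "\<exists>g. g ` UNIV \<subseteq> W \<and> Vector_Spaces.linear fscale fscale g \<and> (\<forall>v\<in>W. g ((\<lambda>x. x) v) = v)"
    using vp.linear_exists_left_inverse_on[of "\<lambda>x. x" W] assms free.linear_id by (simp add: id_def)
  then obtain g where g: "range g \<subseteq> W" "Vector_Spaces.linear fscale fscale g" "\<And>v. v \<in> W \<Longrightarrow> g v = v"
    by auto
  interpret g: Vector_Spaces.linear "fscale :: 'k \<Rightarrow> ('a \<Rightarrow>\<^sub>0 'k) \<Rightarrow> _" "fscale :: 'k \<Rightarrow> ('a \<Rightarrow>\<^sub>0 'k) \<Rightarrow> _" g
    by (fact g(2))
  have gg: "g (g x) = g x" for x using g(1,3) by blast
  have "Vector_Spaces.linear fscale fscale (\<lambda>x. x - g x)"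
    by unfold_locales (auto simp: g.add g.scale free.scale_right_diff_distrib)
  moreover have "x - g x = 0 \<longleftrightarrow> x \<in> W" for x
    using g(1,3) by (metis eq_iff_diff_eq_0 rangeI subsetD)
  ultimately show ?thesis
    by (intro exI[of _ "\<lambda>x. x - g x"]) (auto simp: g.diff gg)
qed

lemma
  assumes "free.subspace (W :: ('a \<Rightarrow>\<^sub>0 'k::field) set)"
  shows linear_quot: "Vector_Spaces.linear fscale fscale (quot W)"
    and quot_quot: "quot W (quot W x) = quot W x"
    and quot_eq_0_iff: "quot W x = 0 \<longleftrightarrow> x \<in> W"
  using someI_ex[OF quot_exists[OF assms]] unfolding quot_def by auto

definition fin_dim :: "('k::field \<Rightarrow> 'a::ab_group_add \<Rightarrow> 'a) \<Rightarrow> 'a set \<Rightarrow> bool" where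
  "fin_dim s A \<longleftrightarrow> (\<exists>B. finite B \<and> A \<subseteq> Modules.module.span s B)"

section \<open>Tensor products\<close>

text \<open>The tensor product of the subspaces \<open>A\<close> and \<open>B\<close> (of ambient spaces with scalar
  multiplications \<open>s\<close> and \<open>s'\<close>).\<close>

definition tensor_rel ::
  "('k::field \<Rightarrow> 'a::ab_group_add \<Rightarrow> 'a) \<Rightarrow> ('k \<Rightarrow> 'b::ab_group_add \<Rightarrow> 'b) \<Rightarrow> 'a set \<Rightarrow> 'b set \<Rightarrow>
    (('a \<times> 'b) \<Rightarrow>\<^sub>0 'k) set" where
  "tensor_rel s s' A B = free.span (
      {gen (a + a', b) - gen (a, b) - gen (a', b) |a a' b. a \<in> A \<and> a' \<in> A \<and> b \<in> B} \<union>
      {gen (a, b + b') - gen (a, b) - gen (a, b') |a b b'. a \<in> A \<and> b \<in> B \<and> b' \<in> B} \<union>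
      {gen (s c a, b) - fscale c (gen (a, b)) |c a b. a \<in> A \<and> b \<in> B} \<union>
      {gen (a, s' c b) - fscale c (gen (a, b)) |c a b. a \<in> A \<and> b \<in> B})"

definition pure_tensor where
  "pure_tensor s s' A B a b = quot (tensor_rel s s' A B) (gen (a, b))"

definition tensor where
  "tensor s s' A B = free.span {pure_tensor s s' A B a b |a b. a \<in> A \<and> b \<in> B}"

text \<open>Tensor powers of \<open>V\<close>, the whole type \<open>'v\<close> with scalar multiplication \<open>sV\<close>; \<open>word sV [x1, \<dots>, xn]\<close>
  is the decomposable tensor with factors \<open>x1, \<dots>, xn\<close>.\<close>

definition word_rel ::
  "('k::field \<Rightarrow> 'v::ab_group_add \<Rightarrow> 'v) \<Rightarrow> nat \<Rightarrow> ('v list \<Rightarrow>\<^sub>0 'k) set" where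
  "word_rel sV n = free.span (
      {gen (xs @ [u + v] @ ys) - gen (xs @ [u] @ ys) - gen (xs @ [v] @ ys) |xs u v ys.
         length xs + 1 + length ys = n} \<union>
      {gen (xs @ [sV c u] @ ys) - fscale c (gen (xs @ [u] @ ys)) |xs c u ys.
         length xs + 1 + length ys = n})"

definition word :: "('k::field \<Rightarrow> 'v::ab_group_add \<Rightarrow> 'v) \<Rightarrow> 'v list \<Rightarrow> ('v list \<Rightarrow>\<^sub>0 'k)" where
  "word sV xs = quot (word_rel sV (length xs)) (gen xs)"

definition tpow :: "('k::field \<Rightarrow> 'v::ab_group_add \<Rightarrow> 'v) \<Rightarrow> nat \<Rightarrow> ('v list \<Rightarrow>\<^sub>0 'k) set" where
  "tpow sV n = free.span {word sV xs |xs. length xs = n}"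

text \<open>Concatenation of tensors, the right action of permutations, \<open>x1 \<dots> xn \<mapsto> x(\<sigma> 1) \<dots> x(\<sigma> n)\<close>, and
  the map \<open>Id \<otimes> g \<otimes> Id\<close> applying \<open>g : V \<rightarrow> V\<^sup>\<otimes>\<^sup>n\<close> to the \<open>i\<close>-th factor. Here and everywhere below,
  positions are numbered from \<open>0\<close>.\<close>

definition tmul where
  "tmul sV s t = lext (\<lambda>xs. lext (\<lambda>ys. word sV (xs @ ys)) t) s"

definition tprod where
  "tprod sV ts = foldr (tmul sV) ts (word sV [])"

definition tperm where
  "tperm sV \<sigma> t = lext (\<lambda>xs. word sV (permute_list \<sigma> xs)) t"

definition tapply where
  "tapply sV i g t =
     lext (\<lambda>xs. tprod sV [word sV (take i xs), g (xs ! i), word sV (drop (Suc i) xs)]) t"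

section \<open>Operads\<close>

text \<open>\<open>circ P m n i p q\<close> is the partial composition of \<open>p\<close> (of arity \<open>m\<close>) and \<open>q\<close> (of arity \<open>n\<close>) at
  position \<open>i < m\<close>. The spaces \<open>ar P n\<close> are subspaces of a common ambient space and may overlap, which
  is why the arities are explicit. \<open>act P n p \<sigma>\<close> is the right action of the symmetric group, whose
  elements are the permutations of \<open>{..<n}\<close>.\<close>

record ('k, 'p) operad_data =
  ar :: "nat \<Rightarrow> 'p set"
  scl :: "'k \<Rightarrow> 'p \<Rightarrow> 'p"
  circ :: "nat \<Rightarrow> nat \<Rightarrow> nat \<Rightarrow> 'p \<Rightarrow> 'p \<Rightarrow> 'p"
  opunit :: 'p
  act :: "nat \<Rightarrow> 'p \<Rightarrow> (nat \<Rightarrow> nat) \<Rightarrow> 'p"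

text \<open>The permutation of \<open>{..<m + n - 1}\<close> obtained from \<open>\<sigma>\<close> (in degree \<open>m\<close>) by replacing position
  \<open>i\<close> in the source and position \<open>\<sigma> i\<close> in the target by a block of \<open>n\<close> positions, which is permuted
  by \<open>\<tau>\<close>.\<close>

definition perm_circ :: "nat \<Rightarrow> nat \<Rightarrow> nat \<Rightarrow> (nat \<Rightarrow> nat) \<Rightarrow> (nat \<Rightarrow> nat) \<Rightarrow> nat \<Rightarrow> nat" where
  "perm_circ m n i \<sigma> \<tau> k =
     (let outer = (\<lambda>a. if a < \<sigma> i then a else a + n - 1) in
      if k < i then outer (\<sigma> k)
      else if k < i + n then \<sigma> i + \<tau> (k - i)
      else if k < m + n - 1 then outer (\<sigma> (k + 1 - n))
      else k)"

locale operad = vector_space "scl P"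
  for P :: "('k::field, 'p::ab_group_add) operad_data" +
  assumes ar_subspace: "subspace (ar P n)"
    and unit_ar: "opunit P \<in> ar P 1"
    and circ_ar: "\<lbrakk>i < m; p \<in> ar P m; q \<in> ar P n\<rbrakk> \<Longrightarrow> circ P m n i p q \<in> ar P (m + n - 1)"
    and circ_add_left: "\<lbrakk>i < m; p \<in> ar P m; p' \<in> ar P m; q \<in> ar P n\<rbrakk> \<Longrightarrow>
          circ P m n i (p + p') q = circ P m n i p q + circ P m n i p' q"
    and circ_add_right: "\<lbrakk>i < m; p \<in> ar P m; q \<in> ar P n; q' \<in> ar P n\<rbrakk> \<Longrightarrow>
          circ P m n i p (q + q') = circ P m n i p q + circ P m n i p q'"
    and circ_scale_left: "\<lbrakk>i < m; p \<in> ar P m; q \<in> ar P n\<rbrakk> \<Longrightarrow>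
          circ P m n i (scl P c p) q = scl P c (circ P m n i p q)"
    and circ_scale_right: "\<lbrakk>i < m; p \<in> ar P m; q \<in> ar P n\<rbrakk> \<Longrightarrow>
          circ P m n i p (scl P c q) = scl P c (circ P m n i p q)"
    and circ_sequential: "\<lbrakk>i < l; j < m; p \<in> ar P l; q \<in> ar P m; r \<in> ar P n\<rbrakk> \<Longrightarrow>
          circ P (l + m - 1) n (i + j) (circ P l m i p q) r =
          circ P l (m + n - 1) i p (circ P m n j q r)"
    and circ_parallel: "\<lbrakk>i < k; k < l; p \<in> ar P l; q \<in> ar P m; r \<in> ar P n\<rbrakk> \<Longrightarrow>
          circ P (l + m - 1) n (k + m - 1) (circ P l m i p q) r =
          circ P (l + n - 1) m i (circ P l n k p r) q"
    and circ_unit_left: "p \<in> ar P n \<Longrightarrow> circ P 1 n 0 (opunit P) p = p"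
    and circ_unit_right: "\<lbrakk>i < n; p \<in> ar P n\<rbrakk> \<Longrightarrow> circ P n 1 i p (opunit P) = p"
    and act_ar: "\<lbrakk>\<sigma> permutes {..<n}; p \<in> ar P n\<rbrakk> \<Longrightarrow> act P n p \<sigma> \<in> ar P n"
    and act_add: "\<lbrakk>\<sigma> permutes {..<n}; p \<in> ar P n; q \<in> ar P n\<rbrakk> \<Longrightarrow>
          act P n (p + q) \<sigma> = act P n p \<sigma> + act P n q \<sigma>"
    and act_scale: "\<lbrakk>\<sigma> permutes {..<n}; p \<in> ar P n\<rbrakk> \<Longrightarrow>
          act P n (scl P c p) \<sigma> = scl P c (act P n p \<sigma>)"
    and act_id: "p \<in> ar P n \<Longrightarrow> act P n p id = p"
    and act_act: "\<lbrakk>\<sigma> permutes {..<n}; \<tau> permutes {..<n}; p \<in> ar P n\<rbrakk> \<Longrightarrow>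
          act P n (act P n p \<sigma>) \<tau> = act P n p (\<sigma> \<circ> \<tau>)"
    and circ_act: "\<lbrakk>i < m; \<sigma> permutes {..<m}; \<tau> permutes {..<n}; p \<in> ar P m; q \<in> ar P n\<rbrakk> \<Longrightarrow>
          circ P m n i (act P m p \<sigma>) (act P n q \<tau>) =
          act P (m + n - 1) (circ P m n (\<sigma> i) p q) (perm_circ m n i \<sigma> \<tau>)"

text \<open>The full composition \<open>p \<circ> (q1, \<dots>, qm)\<close> of \<open>p\<close> of arity \<open>m\<close> and \<open>qj\<close> of arity \<open>nj\<close>, where
  \<open>ns = [n1, \<dots>, nm]\<close> and \<open>qs = [q1, \<dots>, qm]\<close>. The auxiliary function inserts the \<open>qj\<close> from left to right; \<open>a\<close> is
  the current arity and \<open>i\<close> the position of the next original input of \<open>p\<close>.\<close>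

fun fcomp_from where
  "fcomp_from P a i p (n # ns) (q # qs) = fcomp_from P (a + n - 1) (i + n) (circ P a n i p q) ns qs"
| "fcomp_from P a i p _ _ = p"

definition fcomp where
  "fcomp P p ns qs = fcomp_from P (length ns) 0 p ns qs"

text \<open>\<open>C_V\<close>: linear maps from \<open>V\<close> to its tensor powers.\<close>

definition coend_operad ::
  "('k::field \<Rightarrow> 'v::ab_group_add \<Rightarrow> 'v) \<Rightarrow> ('k, 'v \<Rightarrow> ('v list \<Rightarrow>\<^sub>0 'k)) operad_data" where
  "coend_operad sV = \<lparr>
     ar = (\<lambda>n. {f. Vector_Spaces.linear sV fscale f \<and> range f \<subseteq> tpow sV n}),
     scl = (\<lambda>c f v. fscale c (f v)),
     circ = (\<lambda>m n i f g v. tapply sV i g (f v)),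
     opunit = (\<lambda>v. word sV [v]),
     act = (\<lambda>n f \<sigma> v. tperm sV \<sigma> (f v))\<rparr>"

definition pure_op where
  "pure_op A B n a b = pure_tensor (scl A) (scl B) (ar A n) (ar B n) a b"

definition tensor_operad ::
  "('k::field, 'a::ab_group_add) operad_data \<Rightarrow> ('k, 'b::ab_group_add) operad_data \<Rightarrow>
    ('k, ('a \<times> 'b) \<Rightarrow>\<^sub>0 'k) operad_data" where
  "tensor_operad A B = \<lparr>
     ar = (\<lambda>n. tensor (scl A) (scl B) (ar A n) (ar B n)),
     scl = fscale,
     circ = (\<lambda>m n i s t. lext (\<lambda>(a, b). lext (\<lambda>(a', b').
              pure_op A B (m + n - 1) (circ A m n i a a') (circ B m n i b b')) t) s),
     opunit = pure_op A B 1 (opunit A) (opunit B),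
     act = (\<lambda>n s \<sigma>. lext (\<lambda>(a, b). pure_op A B n (act A n a \<sigma>) (act B n b \<sigma>)) s)\<rparr>"

abbreviation Q_operad where
  "Q_operad P sV \<equiv> tensor_operad P (coend_operad sV)"

section \<open>The completed coinvariants of an operad\<close>

text \<open>These constructions are stated for an operad \<open>Q\<close> whose components are subspaces of a free
  vector space. \<open>coinv_map Q n\<close> is the projection onto coinvariants. Elements of products over arities
  are sequences, those of \<open>\<Prod>n\<ge>1\<close> having zero as component of index \<open>0\<close>.\<close>

definition coinv_map :: "('k::field, 'a \<Rightarrow>\<^sub>0 'k) operad_data \<Rightarrow> nat \<Rightarrow> ('a \<Rightarrow>\<^sub>0 'k) \<Rightarrow> ('a \<Rightarrow>\<^sub>0 'k)" where
  "coinv_map Q n = quot (free.span {act Q n q \<sigma> - q |q \<sigma>. q \<in> ar Q n \<and> \<sigma> permutes {..<n}})"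

definition coinv :: "('k::field, 'a \<Rightarrow>\<^sub>0 'k) operad_data \<Rightarrow> nat \<Rightarrow> ('a \<Rightarrow>\<^sub>0 'k) set" where
  "coinv Q n = coinv_map Q n ` ar Q n"

definition coinv_unit :: "('k::field, 'a \<Rightarrow>\<^sub>0 'k) operad_data \<Rightarrow> nat \<Rightarrow> ('a \<Rightarrow>\<^sub>0 'k)" where
  "coinv_unit Q = (\<lambda>n. if n = 1 then coinv_map Q 1 (opunit Q) else 0)"

text \<open>The arity \<open>N\<close> component of \<open>x \<diamond> y\<close> is the sum, over all lists \<open>[n1, \<dots>, nr]\<close> of positive
  integers of sum \<open>N\<close>, of the classes of the composites of \<open>x r\<close> with \<open>y n1, \<dots>, y nr\<close>.\<close>

definition loz ::
  "('k::field, 'a \<Rightarrow>\<^sub>0 'k) operad_data \<Rightarrow> (nat \<Rightarrow> ('a \<Rightarrow>\<^sub>0 'k)) \<Rightarrow> (nat \<Rightarrow> ('a \<Rightarrow>\<^sub>0 'k)) \<Rightarrow> nat \<Rightarrow> ('a \<Rightarrow>\<^sub>0 'k)" where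
  "loz Q x y = (\<lambda>N. \<Sum>ns | sum_list ns = N \<and> 0 \<notin> set ns.
                     coinv_map Q N (fcomp Q (x (length ns)) ns (map y ns)))"

lemma finite_compositions: "finite {ns. sum_list ns = N \<and> (0::nat) \<notin> set ns}"
proof (rule finite_subset)
  show "finite {ns. set ns \<subseteq> {..N} \<and> length ns \<le> N}"
    by (rule finite_lists_length_le) simp
  have "length ns \<le> sum_list ns" if "(0::nat) \<notin> set ns" for ns
    using that by (induction ns) auto
  then show "{ns. sum_list ns = N \<and> (0::nat) \<notin> set ns} \<subseteq> {ns. set ns \<subseteq> {..N} \<and> length ns \<le> N}"
    using member_le_sum_list by fastforce
qed

text \<open>An element \<open>x\<close> of \<open>GB Q\<close> stands for the element \<open>coinv_unit Q + x\<close> of \<open>MD Q\<close>.\<close>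

definition MD :: "('k::field, 'a \<Rightarrow>\<^sub>0 'k) operad_data \<Rightarrow> (nat \<Rightarrow> ('a \<Rightarrow>\<^sub>0 'k)) monoid" where
  "MD Q = \<lparr>carrier = {x. x 0 = 0 \<and> (\<forall>n\<ge>1. x n \<in> coinv Q n)},
           monoid.mult = loz Q,
           one = coinv_unit Q\<rparr>"

definition GB :: "('k::field, 'a \<Rightarrow>\<^sub>0 'k) operad_data \<Rightarrow> (nat \<Rightarrow> ('a \<Rightarrow>\<^sub>0 'k)) monoid" where
  "GB Q = \<lparr>carrier = {x. x 0 = 0 \<and> x 1 = 0 \<and> (\<forall>n\<ge>2. x n \<in> coinv Q n)},
           monoid.mult = (\<lambda>x y. y + loz Q x (coinv_unit Q + y)),
           one = 0\<rparr>"

text \<open>\<open>p \<bullet> q = \<Sum>i. p \<circ>i q\<close>, extended to sequences: in arity \<open>N\<close>, the arities of the factors satisfy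
  \<open>m + n - 1 = N\<close>.\<close>

definition prelie where
  "prelie Q x y = (\<lambda>N. \<Sum>m\<in>{1..N}. let n = N + 1 - m in
                       coinv_map Q N (\<Sum>i<m. circ Q m n i (x m) (y n)))"

section \<open>The completed free algebra\<close>

text \<open>\<open>dot P sV n p t\<close> is the class \<open>p.t\<close> of the tensor of \<open>p \<in> P(n)\<close> and \<open>t \<in> V\<^sup>\<otimes>\<^sup>n\<close>, and \<open>F_deg P sV n\<close>
  is the quotient of their tensor product by the action of the symmetric group.\<close>

definition pure_F where
  "pure_F P sV n p t = pure_tensor (scl P) fscale (ar P n) (tpow sV n) p t"

definition F_map where
  "F_map P sV n = quot (free.span
     {pure_F P sV n (act P n p \<sigma>) t - pure_F P sV n p (tperm sV (inv_into UNIV \<sigma>) t) |p t \<sigma>.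
        p \<in> ar P n \<and> t \<in> tpow sV n \<and> \<sigma> permutes {..<n}})"

definition dot where
  "dot P sV n p t = F_map P sV n (pure_F P sV n p t)"

definition F_deg where
  "F_deg P sV n = F_map P sV n ` tensor (scl P) fscale (ar P n) (tpow sV n)"

definition Fbar ::
  "('k::field, 'p::ab_group_add) operad_data \<Rightarrow> ('k \<Rightarrow> 'v::ab_group_add \<Rightarrow> 'v) \<Rightarrow>
    (nat \<Rightarrow> ('p \<times> ('v list \<Rightarrow>\<^sub>0 'k) \<Rightarrow>\<^sub>0 'k)) set" where
  "Fbar P sV = {x. x 0 = 0 \<and> (\<forall>n\<ge>1. x n \<in> F_deg P sV n)}"

definition Fbar2 where
  "Fbar2 P sV = {x \<in> Fbar P sV. x 1 = 0}"

definition emb :: "('k::field, 'p::ab_group_add) operad_data \<Rightarrow> ('k \<Rightarrow> 'v::ab_group_add \<Rightarrow> 'v) \<Rightarrow>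
    'v \<Rightarrow> nat \<Rightarrow> ('p \<times> ('v list \<Rightarrow>\<^sub>0 'k) \<Rightarrow>\<^sub>0 'k)" where
  "emb P sV v = (\<lambda>n. if n = 1 then dot P sV 1 (opunit P) (word sV [v]) else 0)"

definition val :: "(nat \<Rightarrow> 'a::zero) \<Rightarrow> nat" where
  "val x = (LEAST n. x n \<noteq> 0)"

definition vdist :: "(nat \<Rightarrow> 'a::ab_group_add) \<Rightarrow> (nat \<Rightarrow> 'a) \<Rightarrow> real" where
  "vdist x y = (if x = y then 0 else 1 / 2 ^ val (x - y))"

lemma Metric_space_vdist: "Metric_space A (vdist :: (nat \<Rightarrow> 'a::ab_group_add) \<Rightarrow> _)"
proof
  fix x y z :: "nat \<Rightarrow> 'a"
  show "0 \<le> vdist x y" "vdist x y = 0 \<longleftrightarrow> x = y" by (auto simp: vdist_def)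
  have "(x - y) n \<noteq> 0 \<longleftrightarrow> (y - x) n \<noteq> 0" for n by force
  then show "vdist x y = vdist y x" unfolding vdist_def val_def by auto
  show "vdist x z \<le> vdist x y + vdist y z"
  proof (cases "x = y \<or> y = z \<or> x = z")
    case True
    then show ?thesis by (auto simp: vdist_def)
  next
    case False
    have ne: "\<exists>n. (x - z) n \<noteq> 0" using False by (force simp: fun_eq_iff)
    have "(x - z) (val (x - z)) \<noteq> 0"
      unfolding val_def by (rule LeastI_ex[OF ne])
    then have "(x - y) (val (x - z)) \<noteq> 0 \<or> (y - z) (val (x - z)) \<noteq> 0" by auto
    then have "val (x - y) \<le> val (x - z) \<or> val (y - z) \<le> val (x - z)"
      unfolding val_def[of "x - y"] val_def[of "y - z"] by (auto intro: Least_le)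
    then have "(1::real) / 2 ^ val (x - z) \<le> 1 / 2 ^ val (x - y) \<or>
               (1::real) / 2 ^ val (x - z) \<le> 1 / 2 ^ val (y - z)"
      by (auto intro!: divide_left_mono power_increasing)
    moreover have "(0::real) \<le> 1 / 2 ^ val (x - y)" "(0::real) \<le> 1 / 2 ^ val (y - z)" by auto
    ultimately show ?thesis using False by (auto simp: vdist_def intro: add_increasing add_increasing2)
  qed
qed

abbreviation Ftop where
  "Ftop P sV \<equiv> Metric_space.mtopology (Fbar P sV) vdist"

text \<open>The \<open>P\<close>-algebra structure: on homogeneous elements
  \<open>p.(q1.t1, \<dots>, qm.tm) = (p \<circ> (q1, \<dots>, qm)).(t1 \<dots> tm)\<close>, extended multilinearly (\<open>F_op\<close>), then to sequences.\<close>

definition F_op where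
  "F_op P sV p ns us = mlext (\<lambda>l. dot P sV (sum_list ns) (fcomp P p ns (map fst l)) (tprod sV (map snd l))) us"

definition Fbar_op where
  "Fbar_op P sV p xs = (\<lambda>N. \<Sum>ns | length ns = length xs \<and> sum_list ns = N \<and> 0 \<notin> set ns.
                          F_op P sV p ns (map2 (\<lambda>x n. x n) xs ns))"

definition alg_endo where
  "alg_endo P sV f \<longleftrightarrow> f \<in> Fbar P sV \<rightarrow>\<^sub>E Fbar P sV \<and>
     (\<forall>x\<in>Fbar P sV. \<forall>y\<in>Fbar P sV. f (x + y) = f x + f y) \<and>
     (\<forall>c. \<forall>x\<in>Fbar P sV. f (\<lambda>n. fscale c (x n)) = (\<lambda>n. fscale c (f x n))) \<and>
     (\<forall>m. \<forall>p\<in>ar P m. \<forall>xs. length xs = m \<and> set xs \<subseteq> Fbar P sV \<longrightarrow>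
        f (Fbar_op P sV p xs) = Fbar_op P sV p (map f xs))"

definition tangent_to_id where
  "tangent_to_id P sV f \<longleftrightarrow> (\<forall>v. f (emb P sV v) - emb P sV v \<in> Fbar2 P sV)"

definition cont_endos where
  "cont_endos P sV = \<lparr>carrier = {f. alg_endo P sV f \<and> continuous_map (Ftop P sV) (Ftop P sV) f},
                      monoid.mult = compose (Fbar P sV),
                      one = (\<lambda>x\<in>Fbar P sV. x)\<rparr>"

definition tangent_autos where
  "tangent_autos P sV = \<lparr>carrier = {f \<in> carrier (cont_endos P sV).
                            bij_betw f (Fbar P sV) (Fbar P sV) \<and> tangent_to_id P sV f},
                         monoid.mult = compose (Fbar P sV),
                         one = (\<lambda>x\<in>Fbar P sV. x)\<rparr>"

section \<open>The action of \<open>M^D\<close> on the completed free algebra\<close>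

text \<open>\<open>insert_F\<close> is the action of \<open>coinv Q\<close> on \<open>F\<close>, bilinear, given on generators by
  \<open>(p.t, q \<otimes> f) \<mapsto> \<Sum>i. (p \<circ>i q).((Id \<otimes> f \<otimes> Id) t)\<close>, for \<open>p\<close> of arity \<open>m\<close> and \<open>q\<close> of arity \<open>n\<close>;
  \<open>insert_Fbar\<close> is its extension to completions.\<close>

definition insert_F where
  "insert_F P sV m n z y = lext (\<lambda>(p, t). lext (\<lambda>(q, f).
     \<Sum>i<m. dot P sV (m + n - 1) (circ P m n i p q) (tapply sV i f t)) y) z"

definition insert_Fbar where
  "insert_Fbar P sV z y = (\<lambda>N. \<Sum>m\<in>{1..N}. let n = N + 1 - m in insert_F P sV m n (z m) (y n))"

text \<open>Action of the monomials of the symmetric algebra. The monomial \<open>x1 \<dots> xk\<close> is represented by the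
  list \<open>[xk, \<dots>, x1]\<close>, so that the distinguished last factor is the head of the list.\<close>

function sym_act where
  "sym_act P sV z [] = z"
| "sym_act P sV z (x # xs) = insert_Fbar P sV (sym_act P sV z xs) x
     - (\<Sum>i<length xs. sym_act P sV z (xs[i := prelie (Q_operad P sV) (xs ! i) x]))"
  by pat_completeness auto
termination
  by (relation "measure (\<lambda>(P, sV, z, xs). length xs)") auto

text \<open>The action of \<open>exp (y - I)\<close>: in each degree the exponential series has finitely many
  non-zero terms.\<close>

definition md_act ::
  "('k::field_char_0, 'p::ab_group_add) operad_data \<Rightarrow> ('k \<Rightarrow> 'v::ab_group_add \<Rightarrow> 'v) \<Rightarrow>
    (nat \<Rightarrow> ('p \<times> ('v list \<Rightarrow>\<^sub>0 'k) \<Rightarrow>\<^sub>0 'k)) \<Rightarrow>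
    (nat \<Rightarrow> ('p \<times> ('v \<Rightarrow> ('v list \<Rightarrow>\<^sub>0 'k)) \<Rightarrow>\<^sub>0 'k)) \<Rightarrow>
    nat \<Rightarrow> ('p \<times> ('v list \<Rightarrow>\<^sub>0 'k) \<Rightarrow>\<^sub>0 'k)" where
  "md_act P sV x y = (\<lambda>N. Sum_any (\<lambda>k. fscale (inverse (fact k))
     (sym_act P sV x (replicate k (y - coinv_unit (Q_operad P sV))) N)))"

definition phi where
  "phi P sV y = (\<lambda>x\<in>Fbar P sV. md_act P sV x y)"

section \<open>Anti-isomorphisms\<close>

definition anti_iso :: "('a, 'm) monoid_scheme \<Rightarrow> ('b, 'n) monoid_scheme \<Rightarrow> ('a \<Rightarrow> 'b) set" where
  "anti_iso G H = {h. bij_betw h (carrier G) (carrier H) \<and>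
     (\<forall>x\<in>carrier G. \<forall>y\<in>carrier G. h (x \<otimes>\<^bsub>G\<^esub> y) = h y \<otimes>\<^bsub>H\<^esub> h x) \<and>
     h \<one>\<^bsub>G\<^esub> = \<one>\<^bsub>H\<^esub>}"

end

theory Submission
  imports Defs
begin

text \<open>Everything is reduced to generators. The algebra \<open>F\<close> is topologically spanned by the
  monomials \<open>q.(x1 \<dots> xn)\<close>, each of which is \<open>q\<close> applied to elements of \<open>V\<close>, so two continuous
  multiadditive expressions agree as soon as they agree on monomials. In this way one proves that \<open>F\<close> is
  a \<open>P\<close>-algebra and that the infinitesimal action of \<open>x\<close> is the derivation of \<open>F\<close> extending
  \<open>v \<mapsto> x(v)\<close>; hence the action of a monomial \<open>x1 \<dots> xk\<close> on \<open>p.(v1 \<dots> vm)\<close> puts the \<open>xi\<close> at distinct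
  positions in all possible ways, and the exponential series sends \<open>p.(v1 \<dots> vm)\<close> to
  \<open>p.(y(v1), \<dots>, y(vm))\<close>. So \<open>\<phi>\<^sub>y\<close> is the continuous endomorphism extending \<open>v \<mapsto> y(v)\<close>. Since \<open>V\<close> is
  finite-dimensional, coinvariants of arity \<open>n\<close> are the same as linear maps from \<open>V\<close> to the degree \<open>n\<close>
  part of \<open>F\<close>, so every continuous endomorphism is some \<open>\<phi>\<^sub>y\<close> for a unique \<open>y\<close>; the monoid and group
  axioms for \<open>\<diamond>\<close> are inherited from composition of maps. An endomorphism \<open>f\<close> tangent to the identity is
  invertible because \<open>f - id\<close> raises the valuation.\<close>

section \<open>Linear extension and quotients\<close>

text \<open>Two features of the encoding shape the work. A class is one particular finitely
  supported function, about which nothing is known beyond its class, and maps out of quotients are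
  linear extensions \<open>lext\<close> of formulas on generators. Such a formula makes sense only
  on legal generators, for instance on pairs from P(n) and the n-th tensor power. So every quotient
  needs two facts: representatives are supported on legal generators, and a formula that respects
  the relations does not see the choice. Moreover the axioms speak of partial compositions, while
  the algebra structure and \<diamond> use full ones; equivariance and associativity of the latter
  have to be extracted slot by slot.

  The product \<diamond> is computed through its effect on V. The intermediate stages put different
  series into different slots, which is not invariant under permutations, so they live in Q(n) and
  only the outcome is read on classes. Characteristic zero serves the exponential: k equal factors
  occupy k given positions in k! orders, and 1/k! cancels this. The pre-Lie corrections remove the
  terms where two factors meet on one generator.\<close>

lemma lin_add: "Vector_Spaces.linear s t f \<Longrightarrow> f (x + y) = f x + f y"
  by (simp add: Vector_Spaces.linear_def module_hom_iff)

lemma lin_scale: "Vector_Spaces.linear s t f \<Longrightarrow> f (s c x) = t c (f x)"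
  by (simp add: Vector_Spaces.linear_def module_hom_iff)

lemma lin_0: "Vector_Spaces.linear s t f \<Longrightarrow> f 0 = 0"
  using lin_add[of s t f 0 0] by simp

lemma lin_diff: "Vector_Spaces.linear s t f \<Longrightarrow> f (x - y) = f x - f y"
  using lin_add[of s t f "x - y" y] by (simp add: algebra_simps)

lemma lin_sum: "Vector_Spaces.linear s t f \<Longrightarrow> f (sum g A) = (\<Sum>a\<in>A. f (g a))"
  by (induction A rule: infinite_finite_induct) (simp_all add: lin_0 lin_add)

lemma linI:
  assumes "vector_space s" "vector_space t"
    and "\<And>x y. f (x + y) = f x + f y" "\<And>c x. f (s c x) = t c (f x)"
  shows "Vector_Spaces.linear s t f"
  using assms by (simp add: Vector_Spaces.linear_def module_hom_iff module_iff_vector_space)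

lemma vector_space_fscale: "vector_space (fscale :: 'k::field \<Rightarrow> ('a \<Rightarrow>\<^sub>0 'k) \<Rightarrow> _)"
  by (fact free.vector_space_axioms)

section \<open>The calculus of linear extension\<close>

lemma lext_superset:
  assumes "finite S" "Poly_Mapping.keys f \<subseteq> S"
  shows "lext g f = (\<Sum>a\<in>S. fscale (Poly_Mapping.lookup f a) (g a))"
  unfolding lext_def by (rule sum.mono_neutral_left[OF assms]) (simp add: in_keys_iff)

lemma lext_add: "lext g (u + v) = lext g u + lext g v"
proof -
  \<comment> \<open>Cancellation can make the support of \<open>u + v\<close> smaller, so all three
    sums are taken over the union of the supports.\<close>
  let ?S = "Poly_Mapping.keys u \<union> Poly_Mapping.keys v"
  have S: "finite ?S" by simp
  show ?thesis
    using Poly_Mapping.keys_add[of u v]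
    by (simp add: lext_superset[OF S] lookup_add free.scale_left_distrib sum.distrib)
qed

lemma lext_scale: "lext g (fscale c u) = fscale c (lext g u)"
proof -
  have "Poly_Mapping.keys (fscale c u) \<subseteq> Poly_Mapping.keys u"
    by (auto simp: in_keys_iff)
  then have "lext g (fscale c u) = (\<Sum>a\<in>Poly_Mapping.keys u. fscale (c * Poly_Mapping.lookup u a) (g a))"
    by (simp add: lext_superset[of "Poly_Mapping.keys u"])
  also have "\<dots> = fscale c (lext g u)"
    by (simp add: lext_def free.scale_sum_right)
  finally show ?thesis .
qed

lemma linear_lext: "Vector_Spaces.linear fscale fscale (lext g)"
  by (rule linI) (simp_all add: vector_space_fscale lext_add lext_scale)

lemmas lext_0 = lin_0[OF linear_lext]
  and lext_diff = lin_diff[OF linear_lext]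
  and lext_sum = lin_sum[OF linear_lext]

lemma lext_gen [simp]: "lext g (gen a) = g a"
  by (simp add: lext_def)

lemma lext_cong: "(\<And>a. a \<in> Poly_Mapping.keys u \<Longrightarrow> g a = h a) \<Longrightarrow> lext g u = lext h u"
  by (simp add: lext_def)

lemma lext_fun_add: "lext (\<lambda>a. g a + h a) u = lext g u + lext h u"
  by (simp add: lext_def free.scale_right_distrib sum.distrib)

lemma lext_fun_scale: "lext (\<lambda>a. fscale c (g a)) u = fscale c (lext g u)"
  unfolding lext_def free.scale_sum_right by (simp add: mult.commute)

lemma lext_fun_0: "lext (\<lambda>a. 0) u = 0"
  by (simp add: lext_def)

lemma lext_fun_sum: "lext (\<lambda>a. \<Sum>i\<in>I. g i a) u = (\<Sum>i\<in>I. lext (g i) u)"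
  by (induction I rule: infinite_finite_induct) (simp_all add: lext_fun_0 lext_fun_add)

lemma lin_lext:
  assumes "Vector_Spaces.linear fscale fscale L"
  shows "L (lext g u) = lext (\<lambda>a. L (g a)) u"
  by (simp add: lext_def lin_sum[OF assms] lin_scale[OF assms])

lemma lext_lext: "lext h (lext g u) = lext (\<lambda>a. lext h (g a)) u"
  by (rule lin_lext[OF linear_lext])

lemma lext_swap: "lext (\<lambda>a. lext (\<lambda>b. g a b) v) u = lext (\<lambda>b. lext (\<lambda>a. g a b) u) v"
  unfolding lext_def free.scale_sum_right
  by (subst sum.swap) (simp add: mult.commute)

lemma lext_gen_id: "lext gen u = u"
proof (rule poly_mapping_eqI)
  fix k
  have "Poly_Mapping.lookup (lext gen u) k
      = (\<Sum>a\<in>Poly_Mapping.keys u. Poly_Mapping.lookup u a * (1 when a = k))"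
    unfolding lext_def lookup_sum by (simp add: lookup_single)
  also have "\<dots> = (\<Sum>a\<in>Poly_Mapping.keys u. Poly_Mapping.lookup u a when a = k)"
    by (rule sum.cong) (auto simp: when_def)
  also have "\<dots> = Poly_Mapping.lookup u k"
    by (cases "k \<in> Poly_Mapping.keys u") (auto simp: when_def in_keys_iff sum.delta)
  finally show "Poly_Mapping.lookup (lext gen u) k = Poly_Mapping.lookup u k" .
qed

lemma lin_eq_lext:
  assumes "Vector_Spaces.linear fscale fscale L"
  shows "L u = lext (\<lambda>a. L (gen a)) u"
  using lin_lext[OF assms, of gen u] by (simp add: lext_gen_id)

lemma lext_in_subspace:
  assumes "free.subspace S" "\<And>a. a \<in> Poly_Mapping.keys u \<Longrightarrow> g a \<in> S"
  shows "lext g u \<in> S"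
  unfolding lext_def using assms by (intro free.subspace_sum free.subspace_scale) auto

section \<open>Supports of representatives, and maps out of a quotient\<close>

lemma subspace_keys: "free.subspace {u :: 'a \<Rightarrow>\<^sub>0 'k::field. Poly_Mapping.keys u \<subseteq> G}"
proof (rule free.subspaceI)
  fix u v :: "'a \<Rightarrow>\<^sub>0 'k" and c
  assume u: "u \<in> {u. Poly_Mapping.keys u \<subseteq> G}"
  then show "fscale c u \<in> {u. Poly_Mapping.keys u \<subseteq> G}"
    by (auto simp: in_keys_iff)
  assume "v \<in> {u. Poly_Mapping.keys u \<subseteq> G}"
  with u Poly_Mapping.keys_add[of u v] show "u + v \<in> {u. Poly_Mapping.keys u \<subseteq> G}"
    by blast
qed simp

lemma keys_gen_subset: "a \<in> G \<Longrightarrow> Poly_Mapping.keys (gen a :: 'a \<Rightarrow>\<^sub>0 'k::field) \<subseteq> G"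
  by simp

lemma keys_fscale_subset: "Poly_Mapping.keys u \<subseteq> G \<Longrightarrow> Poly_Mapping.keys (fscale c u) \<subseteq> G"
  using free.subspace_scale[OF subspace_keys, of u G c] by simp

lemma keys_diff_subset: "Poly_Mapping.keys u \<subseteq> G \<Longrightarrow> Poly_Mapping.keys v \<subseteq> G \<Longrightarrow>
    Poly_Mapping.keys (u - v :: 'a \<Rightarrow>\<^sub>0 'k::field) \<subseteq> G"
  using free.subspace_diff[OF subspace_keys, of u G v] by simp

lemma keys_span_subset:
  assumes "\<And>u. u \<in> R \<Longrightarrow> Poly_Mapping.keys u \<subseteq> G" "x \<in> free.span R"
  shows "Poly_Mapping.keys x \<subseteq> G"
  using free.span_minimal[of R "{u. Poly_Mapping.keys u \<subseteq> G}"] subspace_keys[of G] assms by auto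

lemma lext_span_0:
  assumes "\<And>r. r \<in> R \<Longrightarrow> lext g r = 0" "x \<in> free.span R"
  shows "lext g x = 0"
proof -
  have "free.subspace {x. lext g x = 0}"
    by (rule free.subspaceI) (simp_all add: lext_0 lext_add lext_scale)
  from free.span_minimal[OF _ this, of R] show ?thesis using assms by auto
qed

lemma linear_quot_span: "Vector_Spaces.linear fscale fscale (quot (free.span R))"
  by (rule linear_quot) simp

lemma quot_span_idem: "quot (free.span R) (quot (free.span R) x) = quot (free.span R) x"
  by (rule quot_quot) simp

lemma diff_quot_in_span: "x - quot (free.span R) x \<in> free.span R"
proof -
  have "quot (free.span R) (x - quot (free.span R) x) = 0"
    by (simp add: lin_diff[OF linear_quot_span] quot_span_idem)
  then show ?thesis by (simp add: quot_eq_0_iff)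
qed

lemma quot_span_eqI: "x - y \<in> free.span R \<Longrightarrow> quot (free.span R) x = quot (free.span R) y"
  using lin_diff[OF linear_quot_span, of R x y] quot_eq_0_iff[of "free.span R" "x - y"] by simp

text \<open>\<open>x\<close> and its representative differ by an element of the span, which
  \<open>lext g\<close> kills as soon as it kills the generating relations. This is the universal
  property of the quotient.\<close>

lemma lext_quot:
  assumes "\<And>r. r \<in> R \<Longrightarrow> lext g r = 0"
  shows "lext g (quot (free.span R) x) = lext g x"
proof -
  have "lext g (x - quot (free.span R) x) = 0"
    using assms diff_quot_in_span by (rule lext_span_0)
  then show ?thesis by (simp add: lext_diff)
qed

text \<open>The choice behind \<open>quot\<close> gives no direct access to the representative, but
  it differs from \<open>x\<close> by a combination of relations. A support condition met by
  \<open>x\<close> and by all relations is therefore inherited.\<close>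

lemma keys_quot_subset:
  assumes "\<And>r. r \<in> R \<Longrightarrow> Poly_Mapping.keys r \<subseteq> G" "Poly_Mapping.keys x \<subseteq> G"
  shows "Poly_Mapping.keys (quot (free.span R) x) \<subseteq> G"
proof -
  have "Poly_Mapping.keys (x - quot (free.span R) x) \<subseteq> G"
    using assms(1) diff_quot_in_span by (rule keys_span_subset)
  from keys_diff_subset[OF assms(2) this] show ?thesis by simp
qed

section \<open>Tensor products and tensor powers\<close>

text \<open>The conditions are confined to \<open>A\<close> and \<open>B\<close> because the
  components of an operad are subspaces of one ambient type, and its operations are controlled only
  there.\<close>

definition bilin_on ::
  "('k::field \<Rightarrow> 'a::ab_group_add \<Rightarrow> 'a) \<Rightarrow> ('k \<Rightarrow> 'b::ab_group_add \<Rightarrow> 'b) \<Rightarrow> 'a set \<Rightarrow> 'b set \<Rightarrow>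
    ('a \<Rightarrow> 'b \<Rightarrow> ('c \<Rightarrow>\<^sub>0 'k)) \<Rightarrow> bool" where
  "bilin_on s s' A B g \<longleftrightarrow>
     (\<forall>a\<in>A. \<forall>a'\<in>A. \<forall>b\<in>B. g (a + a') b = g a b + g a' b) \<and>
     (\<forall>a\<in>A. \<forall>b\<in>B. \<forall>b'\<in>B. g a (b + b') = g a b + g a b') \<and>
     (\<forall>c. \<forall>a\<in>A. \<forall>b\<in>B. g (s c a) b = fscale c (g a b)) \<and>
     (\<forall>c. \<forall>a\<in>A. \<forall>b\<in>B. g a (s' c b) = fscale c (g a b))"

lemma bilin_onI:
  assumes "\<And>a a' b. a \<in> A \<Longrightarrow> a' \<in> A \<Longrightarrow> b \<in> B \<Longrightarrow> g (a + a') b = g a b + g a' b"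
    and "\<And>a b b'. a \<in> A \<Longrightarrow> b \<in> B \<Longrightarrow> b' \<in> B \<Longrightarrow> g a (b + b') = g a b + g a b'"
    and "\<And>c a b. a \<in> A \<Longrightarrow> b \<in> B \<Longrightarrow> g (s c a) b = fscale c (g a b)"
    and "\<And>c a b. a \<in> A \<Longrightarrow> b \<in> B \<Longrightarrow> g a (s' c b) = fscale c (g a b)"
  shows "bilin_on s s' A B g"
  using assms by (auto simp: bilin_on_def)

lemma lext_pure_tensor:
  assumes "bilin_on s s' A B g" "a \<in> A" "b \<in> B"
  shows "lext (case_prod g) (pure_tensor s s' A B a b) = g a b"
  unfolding pure_tensor_def tensor_rel_def
  using assms
  by (subst lext_quot) (auto simp: lext_diff lext_scale bilin_on_def)

lemma bilin_on_pure_tensor: "bilin_on s s' A B (pure_tensor s s' A B)"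
proof -
  let ?R = "tensor_rel s s' A B"
  have sub: "free.subspace ?R" unfolding tensor_rel_def by simp
  note l = lin_diff[OF linear_quot[OF sub]] lin_scale[OF linear_quot[OF sub]]
  have *: "quot ?R x = 0" if "x \<in> ?R" for x using that by (simp add: quot_eq_0_iff[OF sub])
  have base: "x \<in> ?R" if "x \<in> {gen (a + a', b) - gen (a, b) - gen (a', b) |a a' b. a \<in> A \<and> a' \<in> A \<and> b \<in> B} \<union>
      {gen (a, b + b') - gen (a, b) - gen (a, b') |a b b'. a \<in> A \<and> b \<in> B \<and> b' \<in> B} \<union>
      {gen (s c a, b) - fscale c (gen (a, b)) |c a b. a \<in> A \<and> b \<in> B} \<union>
      {gen (a, s' c b) - fscale c (gen (a, b)) |c a b. a \<in> A \<and> b \<in> B}" for x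
    unfolding tensor_rel_def using that by (rule free.span_base)
  show ?thesis
  proof (rule bilin_onI)
    fix a a' b assume "a \<in> A" "a' \<in> A" "b \<in> B"
    then have "gen (a + a', b) - gen (a, b) - gen (a', b) \<in> ?R" by (intro base) blast
    from *[OF this, unfolded l] show "pure_tensor s s' A B (a + a') b = pure_tensor s s' A B a b + pure_tensor s s' A B a' b"
      by (simp add: pure_tensor_def algebra_simps)
  next
    fix a b b' assume "a \<in> A" "b \<in> B" "b' \<in> B"
    then have "gen (a, b + b') - gen (a, b) - gen (a, b') \<in> ?R" by (intro base) blast
    from *[OF this, unfolded l] show "pure_tensor s s' A B a (b + b') = pure_tensor s s' A B a b + pure_tensor s s' A B a b'"
      by (simp add: pure_tensor_def algebra_simps)
  next
    fix c a b assume "a \<in> A" "b \<in> B"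
    then have "gen (s c a, b) - fscale c (gen (a, b)) \<in> ?R" by (intro base) blast
    from *[OF this, unfolded l] show "pure_tensor s s' A B (s c a) b = fscale c (pure_tensor s s' A B a b)"
      by (simp add: pure_tensor_def)
  next
    fix c a b assume "a \<in> A" "b \<in> B"
    then have "gen (a, s' c b) - fscale c (gen (a, b)) \<in> ?R" by (intro base) blast
    from *[OF this, unfolded l] show "pure_tensor s s' A B a (s' c b) = fscale c (pure_tensor s s' A B a b)"
      by (simp add: pure_tensor_def)
  qed
qed

lemma keys_pure_tensor:
  assumes "vector_space s" "vector_space s'" "module.subspace s A" "module.subspace s' B" "a \<in> A" "b \<in> B"
  shows "Poly_Mapping.keys (pure_tensor s s' A B a b) \<subseteq> A \<times> B"
proof -
  have m: "module s" "module s'" using assms(1,2) by (simp_all add: module_iff_vector_space)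
  note c = module.subspace_add[OF m(1) assms(3)] module.subspace_scale[OF m(1) assms(3)]
    module.subspace_add[OF m(2) assms(4)] module.subspace_scale[OF m(2) assms(4)]
  show ?thesis
    unfolding pure_tensor_def tensor_rel_def
    by (rule keys_quot_subset)
      (elim UnE CollectE exE conjE; hypsubst;
        intro keys_diff_subset keys_fscale_subset keys_gen_subset SigmaI c; assumption |
       intro keys_gen_subset SigmaI assms(5,6))+
qed

text \<open>The projection fixes the elements of the tensor product and sends each generator of the
  support to its pure tensor. So an element is the combination of pure tensors given by its own
  coefficients.\<close>

lemma tensor_expand:
  assumes "x \<in> tensor s s' A B"
  shows "lext (case_prod (pure_tensor s s' A B)) x = x"
proof -
  let ?R = "tensor_rel s s' A B"
  have sub: "free.subspace ?R" unfolding tensor_rel_def by simp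
  have "lext (case_prod (pure_tensor s s' A B)) x = quot ?R x"
    unfolding lin_eq_lext[OF linear_quot[OF sub], of x]
    by (rule lext_cong) (auto simp: pure_tensor_def)
  moreover have "free.subspace {x. quot ?R x = x}"
    using linear_quot[OF sub] by (intro free.subspaceI) (auto simp: lin_0 lin_add lin_scale)
  then have "tensor s s' A B \<subseteq> {x. quot ?R x = x}"
    unfolding tensor_def
    by (rule free.span_minimal[rotated]) (auto simp: pure_tensor_def quot_quot[OF sub])
  ultimately show ?thesis using assms by auto
qed

lemma keys_tensor:
  assumes "vector_space s" "vector_space s'" "module.subspace s A" "module.subspace s' B"
    and "x \<in> tensor s s' A B"
  shows "Poly_Mapping.keys x \<subseteq> A \<times> B"
  using assms(5) unfolding tensor_def
  by (rule keys_span_subset[rotated]) (elim CollectE exE conjE, hypsubst, rule keys_pure_tensor[OF assms(1-4)])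

lemma subspace_tensor: "free.subspace (tensor s s' A B)"
  by (simp add: tensor_def)

lemma pure_tensor_in_tensor: "a \<in> A \<Longrightarrow> b \<in> B \<Longrightarrow> pure_tensor s s' A B a b \<in> tensor s s' A B"
  unfolding tensor_def by (intro free.span_base) blast

text \<open>Multilinearity is expressed with list updates, which are easier to move through
  permutations and concatenations than a decomposition of the list.\<close>

definition mlin_on ::
  "('k::field \<Rightarrow> 'v::ab_group_add \<Rightarrow> 'v) \<Rightarrow> nat \<Rightarrow> ('v list \<Rightarrow> ('b \<Rightarrow>\<^sub>0 'k)) \<Rightarrow> bool" where
  "mlin_on sV n g \<longleftrightarrow> (\<forall>xs k. length xs = n \<longrightarrow> k < n \<longrightarrow>
     (\<forall>u v. g (xs[k := u + v]) = g (xs[k := u]) + g (xs[k := v])) \<and>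
     (\<forall>c u. g (xs[k := sV c u]) = fscale c (g (xs[k := u]))))"

lemma mlin_onI:
  assumes "\<And>xs k u v. length xs = n \<Longrightarrow> k < n \<Longrightarrow> g (xs[k := u + v]) = g (xs[k := u]) + g (xs[k := v])"
    and "\<And>xs k c u. length xs = n \<Longrightarrow> k < n \<Longrightarrow> g (xs[k := sV c u]) = fscale c (g (xs[k := u]))"
  shows "mlin_on sV n g"
  using assms by (simp add: mlin_on_def)

lemma
  assumes "mlin_on sV n g" "length xs = n" "k < n"
  shows mlin_on_add: "g (xs[k := u + v]) = g (xs[k := u]) + g (xs[k := v])"
    and mlin_on_scale: "g (xs[k := sV c u]) = fscale c (g (xs[k := u]))"
  using assms by (simp_all add: mlin_on_def)

lemma
  assumes "mlin_on sV n g" "length xs + 1 + length ys = n"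
  shows mlin_on_add_mid: "g (xs @ [u + v] @ ys) = g (xs @ [u] @ ys) + g (xs @ [v] @ ys)"
    and mlin_on_scale_mid: "g (xs @ [sV c u] @ ys) = fscale c (g (xs @ [u] @ ys))"
  using mlin_on_add[OF assms(1), of "xs @ [u] @ ys" "length xs" u v]
    mlin_on_scale[OF assms(1), of "xs @ [u] @ ys" "length xs" c u] assms(2) by simp_all

lemma lext_word:
  assumes "mlin_on sV n g" "length xs = n"
  shows "lext g (word sV xs) = g xs"
  unfolding word_def word_rel_def assms(2)
  using mlin_on_add_mid[OF assms(1)] mlin_on_scale_mid[OF assms(1)]
  by (subst lext_quot) (auto simp: lext_diff lext_scale)

lemma mlin_on_word:
  fixes sV :: "'k::field \<Rightarrow> 'v::ab_group_add \<Rightarrow> 'v"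
  shows "mlin_on sV n (word sV)"
proof -
  let ?R = "word_rel sV n"
  have sub: "free.subspace ?R" unfolding word_rel_def by simp
  note l = lin_diff[OF linear_quot[OF sub]] lin_scale[OF linear_quot[OF sub]]
  have *: "quot ?R x = 0" if "x \<in> ?R" for x using that by (simp add: quot_eq_0_iff[OF sub])
  have base: "x \<in> ?R" if "x \<in> {gen (xs @ [u + v] @ ys) - gen (xs @ [u] @ ys) - gen (xs @ [v] @ ys) |xs u v ys.
         length xs + 1 + length ys = n} \<union>
      {gen (xs @ [sV c u] @ ys) - fscale c (gen (xs @ [u] @ ys)) |xs c u ys.
         length xs + 1 + length ys = n}" for x
    unfolding word_rel_def using that by (rule free.span_base)
  show ?thesis
  proof (rule mlin_onI)
    fix xs :: "'v list" and k u v assume k: "length xs = n" "k < n"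
    then have len: "length (take k xs) + 1 + length (drop (Suc k) xs) = n" by simp
    have "gen (take k xs @ [u + v] @ drop (Suc k) xs) - gen (take k xs @ [u] @ drop (Suc k) xs)
        - gen (take k xs @ [v] @ drop (Suc k) xs) \<in> ?R"
      using len by (intro base) blast
    from *[OF this, unfolded l] show "word sV (xs[k := u + v]) = word sV (xs[k := u]) + word sV (xs[k := v])"
      using k by (simp add: word_def upd_conv_take_nth_drop algebra_simps)
  next
    fix xs :: "'v list" and k c u assume k: "length xs = n" "k < n"
    then have len: "length (take k xs) + 1 + length (drop (Suc k) xs) = n" by simp
    have "gen (take k xs @ [sV c u] @ drop (Suc k) xs) - fscale c (gen (take k xs @ [u] @ drop (Suc k) xs)) \<in> ?R"
      using len by (intro base) blast
    from *[OF this, unfolded l] show "word sV (xs[k := sV c u]) = fscale c (word sV (xs[k := u]))"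
      using k by (simp add: word_def upd_conv_take_nth_drop)
  qed
qed

lemma word_add: "k < length xs \<Longrightarrow> word sV (xs[k := u + v]) = word sV (xs[k := u]) + word sV (xs[k := v])"
  by (rule mlin_on_add[OF mlin_on_word refl])

lemma word_scale: "k < length xs \<Longrightarrow> word sV (xs[k := sV c u]) = fscale c (word sV (xs[k := u]))"
  by (rule mlin_on_scale[OF mlin_on_word refl])

lemma word_in_tpow: "word sV xs \<in> tpow sV (length xs)"
  unfolding tpow_def by (rule free.span_base) blast

lemma subspace_tpow: "free.subspace (tpow sV n)"
  by (simp add: tpow_def)

lemma keys_tpow:
  assumes "t \<in> tpow sV n" shows "Poly_Mapping.keys t \<subseteq> {xs. length xs = n}"
  using assms unfolding tpow_def
proof (rule keys_span_subset[rotated])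
  fix u assume "u \<in> {word sV xs |xs. length xs = n}"
  then obtain xs where xs: "u = word sV xs" "length xs = n" by blast
  show "Poly_Mapping.keys u \<subseteq> {xs. length xs = n}"
    unfolding xs(1) word_def word_rel_def
    by (rule keys_quot_subset; (elim UnE CollectE exE conjE; hypsubst)?;
        intro keys_diff_subset keys_fscale_subset keys_gen_subset; simp add: xs(2))
qed

lemma tpow_expand:
  assumes "t \<in> tpow sV n" shows "lext (word sV) t = t"
proof -
  let ?R = "word_rel sV n"
  have sub: "free.subspace ?R" unfolding word_rel_def by simp
  have "lext (word sV) t = quot ?R t"
    unfolding lin_eq_lext[OF linear_quot[OF sub], of t]
    using keys_tpow[OF assms] by (intro lext_cong) (auto simp: word_def)
  moreover have "free.subspace {x. quot ?R x = x}"
    using linear_quot[OF sub] by (intro free.subspaceI) (auto simp: lin_0 lin_add lin_scale)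
  then have "tpow sV n \<subseteq> {x. quot ?R x = x}"
    unfolding tpow_def
    by (rule free.span_minimal[rotated]) (use quot_quot[OF sub] in \<open>fastforce simp: word_def\<close>)
  ultimately show ?thesis using assms by auto
qed

lemma tpow_eqI:
  assumes "t \<in> tpow sV n"
    and "Vector_Spaces.linear fscale fscale L" "Vector_Spaces.linear fscale fscale L'"
    and "\<And>xs. length xs = n \<Longrightarrow> L (word sV xs) = L' (word sV xs)"
  shows "L t = L' t"
proof -
  have "L (lext (word sV) t) = L' (lext (word sV) t)"
    unfolding lin_lext[OF assms(2)] lin_lext[OF assms(3)]
    using keys_tpow[OF assms(1)] by (intro lext_cong assms(4)) auto
  then show ?thesis by (simp add: tpow_expand[OF assms(1)])
qed

section \<open>Concatenation, permutation and insertion of tensors\<close>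

lemma linear_tmul_left: "Vector_Spaces.linear fscale fscale (\<lambda>s. tmul sV s t)"
  unfolding tmul_def by (rule linear_lext)

lemma linear_tmul_right: "Vector_Spaces.linear fscale fscale (tmul sV s)"
  unfolding tmul_def
  by (rule linI) (simp_all add: vector_space_fscale lext_add lext_scale lext_fun_add lext_fun_scale)

lemma mlin_on_append_left:
  assumes "mlin_on sV (n + length ys) g" shows "mlin_on sV n (\<lambda>xs. g (xs @ ys))"
proof (rule mlin_onI)
  fix xs :: "'b list" and k u v c assume "length xs = n" "k < n"
  then show "g (xs[k := u + v] @ ys) = g (xs[k := u] @ ys) + g (xs[k := v] @ ys)"
    "g (xs[k := sV c u] @ ys) = fscale c (g (xs[k := u] @ ys))"
    using mlin_on_add[OF assms, of "xs @ ys" k u v] mlin_on_scale[OF assms, of "xs @ ys" k c u]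
    by (simp_all add: list_update_append)
qed

lemma mlin_on_append_right:
  assumes "mlin_on sV (length xs + n) g" shows "mlin_on sV n (\<lambda>ys. g (xs @ ys))"
proof (rule mlin_onI)
  fix ys :: "'b list" and k u v c assume "length ys = n" "k < n"
  then show "g (xs @ ys[k := u + v]) = g (xs @ ys[k := u]) + g (xs @ ys[k := v])"
    "g (xs @ ys[k := sV c u]) = fscale c (g (xs @ ys[k := u]))"
    using mlin_on_add[OF assms, of "xs @ ys" "length xs + k" u v]
      mlin_on_scale[OF assms, of "xs @ ys" "length xs + k" c u]
    by (simp_all add: list_update_append)
qed

lemma tmul_word [simp]: "tmul sV (word sV xs) (word sV ys) = word sV (xs @ ys)"
proof -
  have "lext (\<lambda>ys. word sV (xs @ ys)) (word sV ys) = word sV (xs @ ys)" for xs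
    by (rule lext_word[OF mlin_on_append_right[OF mlin_on_word] refl])
  then show ?thesis
    unfolding tmul_def by (simp add: lext_word[OF mlin_on_append_left[OF mlin_on_word] refl])
qed

lemma tmul_in_tpow:
  assumes "s \<in> tpow sV m" "t \<in> tpow sV n" shows "tmul sV s t \<in> tpow sV (m + n)"
  unfolding tmul_def
proof (intro lext_in_subspace subspace_tpow)
  fix xs ys assume "xs \<in> Poly_Mapping.keys s" "ys \<in> Poly_Mapping.keys t"
  then show "word sV (xs @ ys) \<in> tpow sV (m + n)"
    using assms[THEN keys_tpow] word_in_tpow[of sV "xs @ ys"] by force
qed

lemma tmul_word_Nil_right:
  assumes "s \<in> tpow sV m" shows "tmul sV s (word sV []) = s"
  by (rule tpow_eqI[OF assms linear_tmul_left free.linear_ident]) simp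

lemma tmul_word_Nil_left:
  assumes "s \<in> tpow sV m" shows "tmul sV (word sV []) s = s"
  by (rule tpow_eqI[OF assms linear_tmul_right free.linear_ident]) simp

lemma linear_compose:
  "Vector_Spaces.linear s t f \<Longrightarrow> Vector_Spaces.linear t u g \<Longrightarrow> Vector_Spaces.linear s u (\<lambda>x. g (f x))"
  by (auto simp: Vector_Spaces.linear_def module_hom_iff)

lemma tmul_assoc:
  assumes "s \<in> tpow sV l" "t \<in> tpow sV m" "u \<in> tpow sV n"
  shows "tmul sV (tmul sV s t) u = tmul sV s (tmul sV t u)"
proof -
  have 1: "tmul sV (tmul sV (word sV xs) (word sV ys)) u = tmul sV (word sV xs) (tmul sV (word sV ys) u)" for xs ys
    by (rule tpow_eqI[OF assms(3)]) (auto intro!: linear_tmul_right linear_compose[OF linear_tmul_right linear_tmul_right])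
  have 2: "tmul sV (tmul sV (word sV xs) t) u = tmul sV (word sV xs) (tmul sV t u)" for xs
    by (rule tpow_eqI[OF assms(2) linear_compose[OF linear_tmul_right linear_tmul_left]
          linear_compose[OF linear_tmul_left linear_tmul_right] 1])
  show ?thesis
    by (rule tpow_eqI[OF assms(1) linear_compose[OF linear_tmul_left linear_tmul_left]
          linear_tmul_left 2])
qed

lemma tprod_simps [simp]:
  "tprod sV [] = word sV []" "tprod sV (t # ts) = tmul sV t (tprod sV ts)"
  by (simp_all add: tprod_def)

lemma tprod_words: "tprod sV (map (word sV) xss) = word sV (concat xss)"
  by (induction xss) simp_all

lemma tprod_in_tpow:
  "list_all2 (\<lambda>t n. t \<in> tpow sV n) ts ns \<Longrightarrow> tprod sV ts \<in> tpow sV (sum_list ns)"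
proof (induction rule: list_all2_induct)
  case Nil
  show ?case using word_in_tpow[of sV "[]"] by simp
next
  case (Cons t ts n ns)
  then show ?case by (simp add: tmul_in_tpow)
qed

lemma tprod_append:
  assumes "list_all2 (\<lambda>t n. t \<in> tpow sV n) ts ns" "list_all2 (\<lambda>t n. t \<in> tpow sV n) ts' ns'"
  shows "tprod sV (ts @ ts') = tmul sV (tprod sV ts) (tprod sV ts')"
  using assms(1)
proof (induction rule: list_all2_induct)
  case Nil
  show ?case using tprod_in_tpow[OF assms(2)] by (simp add: tmul_word_Nil_left)
next
  case (Cons t ts n ns)
  then show ?case
    by (simp add: tmul_assoc[OF _ tprod_in_tpow tprod_in_tpow[OF assms(2)]])
qed

lemma linear_tperm: "Vector_Spaces.linear fscale fscale (tperm sV \<sigma>)"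
  unfolding tperm_def by (rule linear_lext)

text \<open>Entry \<open>i\<close> of \<open>permute_list \<sigma> xs\<close> is
  \<open>xs ! \<sigma> i\<close>, so the entry numbered \<open>k\<close> becomes visible at the
  position that \<sigma> sends to \<open>k\<close>.\<close>

lemma permute_list_update:
  assumes "\<sigma> permutes {..<length xs}" "k < length xs"
  shows "permute_list \<sigma> (xs[k := u]) = (permute_list \<sigma> xs)[inv_into UNIV \<sigma> k := u]"
proof (rule nth_equalityI)
  fix i assume "i < length (permute_list \<sigma> (xs[k := u]))"
  then have i: "i < length xs" by simp
  have "\<sigma> i < length xs" using permutes_in_image[OF assms(1), of i] i by simp
  moreover have "\<sigma> i = k \<longleftrightarrow> i = inv_into UNIV \<sigma> k" using permutes_inverses[OF assms(1)] by metis
  ultimately show "permute_list \<sigma> (xs[k := u]) ! i = (permute_list \<sigma> xs)[inv_into UNIV \<sigma> k := u] ! i"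
    using assms i by (auto simp: permute_list_nth nth_list_update)
qed simp

lemma tperm_word:
  fixes sV :: "'k::field \<Rightarrow> 'v::ab_group_add \<Rightarrow> 'v"
  assumes "\<sigma> permutes {..<length xs}"
  shows "tperm sV \<sigma> (word sV xs) = word sV (permute_list \<sigma> xs)"
  unfolding tperm_def
proof (rule lext_word[OF mlin_onI refl])
  fix ys :: "'v list" and k u v c assume k: "length ys = length xs" "k < length xs"
  have "inv_into UNIV \<sigma> k < length xs" using permutes_in_image[OF permutes_inv[OF assms], of k] k by simp
  then show "word sV (permute_list \<sigma> (ys[k := u + v])) =
       word sV (permute_list \<sigma> (ys[k := u])) + word sV (permute_list \<sigma> (ys[k := v]))"
    "word sV (permute_list \<sigma> (ys[k := sV c u])) = fscale c (word sV (permute_list \<sigma> (ys[k := u])))"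
    using assms k by (simp_all add: permute_list_update word_add word_scale)
qed

lemma tperm_in_tpow:
  assumes "t \<in> tpow sV n" shows "tperm sV \<sigma> t \<in> tpow sV n"
  unfolding tperm_def
proof (intro lext_in_subspace subspace_tpow)
  fix xs assume "xs \<in> Poly_Mapping.keys t"
  then show "word sV (permute_list \<sigma> xs) \<in> tpow sV n"
    using keys_tpow[OF assms] word_in_tpow[of sV "permute_list \<sigma> xs"] by auto
qed

lemma tperm_inv_tperm:
  fixes sV :: "'k::field \<Rightarrow> 'v::ab_group_add \<Rightarrow> 'v"
  assumes "\<sigma> permutes {..<n}" "t \<in> tpow sV n"
  shows "tperm sV (inv_into UNIV \<sigma>) (tperm sV \<sigma> t) = t" "tperm sV \<sigma> (tperm sV (inv_into UNIV \<sigma>) t) = t"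
proof -
  have pl: "permute_list (inv_into UNIV \<sigma>) (permute_list \<sigma> xs) = xs"
    "permute_list \<sigma> (permute_list (inv_into UNIV \<sigma>) xs) = xs" if "length xs = n" for xs :: "'v list"
    using that assms(1) permutes_inv[OF assms(1)]
    by (simp_all flip: permute_list_compose add: permutes_inv_o)
  note eqI = tpow_eqI[OF assms(2) linear_compose[OF linear_tperm linear_tperm] free.linear_ident]
  show "tperm sV (inv_into UNIV \<sigma>) (tperm sV \<sigma> t) = t"
    by (rule eqI) (simp add: tperm_word assms(1) permutes_inv[OF assms(1)] pl)
  show "tperm sV \<sigma> (tperm sV (inv_into UNIV \<sigma>) t) = t"
    by (rule eqI) (simp add: tperm_word assms(1) permutes_inv[OF assms(1)] pl)
qed

lemma linear_tapply: "Vector_Spaces.linear fscale fscale (tapply sV i g)"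
  unfolding tapply_def by (rule linear_lext)

lemma tapply_in_tpow:
  assumes "i < m" "range g \<subseteq> tpow sV n" "t \<in> tpow sV m"
  shows "tapply sV i g t \<in> tpow sV (m + n - 1)"
  unfolding tapply_def
proof (intro lext_in_subspace subspace_tpow)
  fix xs assume "xs \<in> Poly_Mapping.keys t"
  then have "length xs = m" using keys_tpow[OF assms(3)] by auto
  then show "tprod sV [word sV (take i xs), g (xs ! i), word sV (drop (Suc i) xs)] \<in> tpow sV (m + n - 1)"
    using tprod_in_tpow[of sV "[word sV (take i xs), g (xs ! i), word sV (drop (Suc i) xs)]"
        "[i, n, m - Suc i]"] word_in_tpow[of sV "take i xs"] word_in_tpow[of sV "drop (Suc i) xs"] assms
    by (auto simp: add.commute)
qed

lemma tapply_word:
  fixes sV :: "'k::field \<Rightarrow> 'v::ab_group_add \<Rightarrow> 'v"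
  assumes "Vector_Spaces.linear sV fscale g" "i < length xs"
  shows "tapply sV i g (word sV xs) =
    tprod sV [word sV (take i xs), g (xs ! i), word sV (drop (Suc i) xs)]"
  unfolding tapply_def
proof (rule lext_word[OF mlin_onI refl])
  fix ys :: "'v list" and k u v c assume k: "length ys = length xs" "k < length xs"
  note l = lin_add[OF linear_tmul_left] lin_add[OF linear_tmul_right] lin_scale[OF linear_tmul_left]
    lin_scale[OF linear_tmul_right] lin_add[OF assms(1)] lin_scale[OF assms(1)]
    word_add word_scale
  have "tprod sV [word sV (take i (ys[k := u + v])), g (ys[k := u + v] ! i), word sV (drop (Suc i) (ys[k := u + v]))] =
      tprod sV [word sV (take i (ys[k := u])), g (ys[k := u] ! i), word sV (drop (Suc i) (ys[k := u]))] +
      tprod sV [word sV (take i (ys[k := v])), g (ys[k := v] ! i), word sV (drop (Suc i) (ys[k := v]))] \<and>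
      tprod sV [word sV (take i (ys[k := sV c u])), g (ys[k := sV c u] ! i), word sV (drop (Suc i) (ys[k := sV c u]))] =
      fscale c (tprod sV [word sV (take i (ys[k := u])), g (ys[k := u] ! i), word sV (drop (Suc i) (ys[k := u]))])"
  \<comment> \<open>The updated entry lies in the left word, is the argument of \<open>g\<close>, or
    lies in the right word. In each case exactly one factor of the product changes, and it does so
    linearly.\<close>
  proof (cases "k < i")
    case True
    then show ?thesis using k assms(2) by (simp add: take_update_swap l)
  next
    case False
    then show ?thesis using k assms(2) by (cases "k = i") (simp_all add: drop_update_swap l)
  qed
  then show "tprod sV [word sV (take i (ys[k := u + v])), g (ys[k := u + v] ! i), word sV (drop (Suc i) (ys[k := u + v]))] =
      tprod sV [word sV (take i (ys[k := u])), g (ys[k := u] ! i), word sV (drop (Suc i) (ys[k := u]))] +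
      tprod sV [word sV (take i (ys[k := v])), g (ys[k := v] ! i), word sV (drop (Suc i) (ys[k := v]))]"
    "tprod sV [word sV (take i (ys[k := sV c u])), g (ys[k := sV c u] ! i), word sV (drop (Suc i) (ys[k := sV c u]))] =
      fscale c (tprod sV [word sV (take i (ys[k := u])), g (ys[k := u] ! i), word sV (drop (Suc i) (ys[k := u]))])"
    by auto
qed

section \<open>Composition in an operad\<close>

context operad
begin

text \<open>Positive arities keep the truncated subtractions in \<open>a + n - 1\<close>
  faithful.\<close>

abbreviation fam :: "nat list \<Rightarrow> 'p list \<Rightarrow> bool" where
  "fam \<equiv> list_all2 (\<lambda>n q. 0 < n \<and> q \<in> ar P n)"

lemma fam_length_le: "fam ns qs \<Longrightarrow> length ns \<le> sum_list ns"
  by (induction rule: list_all2_induct) auto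

lemma fcomp_from_append:
  assumes "fam ns qs"
  shows "fcomp_from P a i p (ns @ ms) (qs @ rs) =
    fcomp_from P (a + sum_list ns - length ns) (i + sum_list ns) (fcomp_from P a i p ns qs) ms rs"
  using assms
proof (induction arbitrary: a i p rule: list_all2_induct)
  case (Cons n ns q qs)
  have "a + n - 1 + sum_list ns - length ns = a + (n + sum_list ns) - Suc (length ns)"
    using Cons.hyps by simp
  then show ?case using Cons by (simp add: add.assoc)
qed simp

lemma fcomp_from_closed:
  assumes "fam ns qs" "p \<in> ar P a" "i + length ns \<le> a"
  shows "fcomp_from P a i p ns qs \<in> ar P (a + sum_list ns - length ns)"
  using assms
proof (induction arbitrary: a i p rule: list_all2_induct)
  case (Cons n ns q qs)
  have "circ P a n i p q \<in> ar P (a + n - 1)"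
    using Cons by (intro circ_ar) auto
  from Cons.IH[OF this, of "i + n"] show ?case using Cons by (simp add: algebra_simps)
qed simp

text \<open>The parallel axiom, one slot at a time. Here \<open>r\<close> lies to the right of the
  slots being filled, so every insertion of arity n pushes its position by n - 1.\<close>

lemma fcomp_from_circ_before:
  assumes "fam ns qs" "p \<in> ar P l" "r \<in> ar P m" "0 < m" "i + length ns \<le> k" "k < l"
  shows "fcomp_from P (l + m - 1) i (circ P l m k p r) ns qs =
    circ P (l + sum_list ns - length ns) m (k + sum_list ns - length ns) (fcomp_from P l i p ns qs) r"
  using assms
proof (induction arbitrary: l i k p rule: list_all2_induct)
  case (Cons n ns q qs)
  have n: "0 < n" "q \<in> ar P n" and le: "length ns \<le> sum_list ns"
    using Cons.hyps fam_length_le by auto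
  have "fcomp_from P (l + m - 1) i (circ P l m k p r) (n # ns) (q # qs) =
      fcomp_from P ((l + n - 1) + m - 1) (i + n) (circ P (l + n - 1) m (k + n - 1) (circ P l n i p q) r) ns qs"
    using Cons.prems n circ_parallel[of i k l p q n r m] by (simp add: algebra_simps)
  also have "\<dots> = circ P (l + n - 1 + sum_list ns - length ns) m (k + n - 1 + sum_list ns - length ns)
      (fcomp_from P (l + n - 1) (i + n) (circ P l n i p q) ns qs) r"
    using Cons.prems n by (intro Cons.IH circ_ar) auto
  finally show ?case using n le by (simp add: add.assoc)
qed simp

text \<open>Here \<open>r\<close> lies to the left of the slots being filled: its own position stays
  \<open>k\<close>, while the slots start \<open>m - 1\<close> places later.\<close>

lemma fcomp_from_circ_after:
  assumes "fam ns qs" "p \<in> ar P l" "r \<in> ar P m" "0 < m" "k < i" "i + length ns \<le> l"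
  shows "fcomp_from P (l + m - 1) (i + m - 1) (circ P l m k p r) ns qs =
    circ P (l + sum_list ns - length ns) m k (fcomp_from P l i p ns qs) r"
  using assms
proof (induction arbitrary: l i p rule: list_all2_induct)
  case (Cons n ns q qs)
  have n: "0 < n" "q \<in> ar P n" and le: "length ns \<le> sum_list ns"
    using Cons.hyps fam_length_le by auto
  have "fcomp_from P (l + m - 1) (i + m - 1) (circ P l m k p r) (n # ns) (q # qs) =
      fcomp_from P ((l + n - 1) + m - 1) ((i + n) + m - 1) (circ P (l + n - 1) m k (circ P l n i p q) r) ns qs"
    using Cons.prems n circ_parallel[of k i l p r m q n] by (simp add: algebra_simps)
  also have "\<dots> = circ P (l + n - 1 + sum_list ns - length ns) m k
      (fcomp_from P (l + n - 1) (i + n) (circ P l n i p q) ns qs) r"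
    using Cons.prems n by (intro Cons.IH circ_ar) auto
  finally show ?case using n le by (simp add: add.assoc)
qed simp

text \<open>The sequential axiom, one slot at a time: the slots being filled are inputs of
  \<open>r\<close>, counted from \<open>j\<close>, and they are seen at \<open>i + j\<close> once
  \<open>r\<close> sits at \<open>i\<close>.\<close>

lemma fcomp_from_circ_inside:
  assumes "fam ns qs" "p \<in> ar P l" "r \<in> ar P m" "i < l" "j + length ns \<le> m" "0 < m"
  shows "fcomp_from P (l + m - 1) (i + j) (circ P l m i p r) ns qs =
    circ P l (m + sum_list ns - length ns) i p (fcomp_from P m j r ns qs)"
  using assms
proof (induction arbitrary: m j r rule: list_all2_induct)
  case (Cons n ns q qs)
  have n: "0 < n" "q \<in> ar P n" and le: "length ns \<le> sum_list ns"
    using Cons.hyps fam_length_le by auto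
  have "fcomp_from P (l + m - 1) (i + j) (circ P l m i p r) (n # ns) (q # qs) =
      fcomp_from P (l + (m + n - 1) - 1) (i + (j + n)) (circ P l (m + n - 1) i p (circ P m n j r q)) ns qs"
    using Cons.prems n circ_sequential[of i l j m p r q n] by (simp add: algebra_simps)
  also have "\<dots> = circ P l (m + n - 1 + sum_list ns - length ns) i p
      (fcomp_from P (m + n - 1) (j + n) (circ P m n j r q) ns qs)"
    using Cons.prems n by (intro Cons.IH circ_ar) auto
  finally show ?case using n le by (simp add: add.assoc)
qed simp

lemma fcomp_closed:
  assumes "fam ns qs" "p \<in> ar P (length ns)"
  shows "fcomp P p ns qs \<in> ar P (sum_list ns)"
  using fcomp_from_closed[OF assms, of 0] by (simp add: fcomp_def)

text \<open>The factors \<open>as\<close> lie to the left of \<open>q\<close> and pass it by the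
  parallel axiom; the factors \<open>bs\<close> fall into the inputs of \<open>q\<close> and are
  absorbed by the sequential axiom; the factors \<open>cs\<close> are then inserted in the same way
  on both sides.\<close>

lemma fcomp_circ:
  assumes as: "fam nas as" and bs: "fam nbs bs" and cs: "fam ncs cs"
    and p: "p \<in> ar P (length nas + 1 + length ncs)" and q: "q \<in> ar P (length nbs)" "nbs \<noteq> []"
  shows "fcomp P (circ P (length nas + 1 + length ncs) (length nbs) (length nas) p q) (nas @ nbs @ ncs) (as @ bs @ cs) =
    fcomp P p (nas @ sum_list nbs # ncs) (as @ fcomp P q nbs bs # cs)"
proof -
  let ?l = "length nas + 1 + length ncs" and ?m = "length nbs"
  let ?p = "fcomp_from P ?l 0 p nas as"
  have m: "0 < ?m" using q by simp
  note le = fam_length_le[OF as] fam_length_le[OF bs]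
  have p': "?p \<in> ar P (?l + sum_list nas - length nas)"
    by (rule fcomp_from_closed[OF as p]) simp
  have "fcomp P (circ P ?l ?m (length nas) p q) (nas @ nbs @ ncs) (as @ bs @ cs) =
    fcomp_from P (?l + ?m - 1 + sum_list nas - length nas + sum_list nbs - length nbs) (sum_list nas + sum_list nbs)
     (fcomp_from P (?l + ?m - 1 + sum_list nas - length nas) (sum_list nas)
       (fcomp_from P (?l + ?m - 1) 0 (circ P ?l ?m (length nas) p q) nas as) nbs bs) ncs cs"
    using m by (simp add: fcomp_def fcomp_from_append[OF as] fcomp_from_append[OF bs] algebra_simps)
  also have "fcomp_from P (?l + ?m - 1) 0 (circ P ?l ?m (length nas) p q) nas as =
      circ P (?l + sum_list nas - length nas) ?m (sum_list nas) ?p q"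
    using fcomp_from_circ_before[OF as p q(1) m, of 0 "length nas"] by simp
  also have "fcomp_from P (?l + ?m - 1 + sum_list nas - length nas) (sum_list nas) \<dots> nbs bs =
      circ P (?l + sum_list nas - length nas) (sum_list nbs) (sum_list nas) ?p (fcomp P q nbs bs)"
    using fcomp_from_circ_inside[OF bs p' q(1) _ _ m, of "sum_list nas" 0] m by (simp add: fcomp_def add_ac)
  finally show ?thesis
    using m le by (simp add: fcomp_def fcomp_from_append[OF as] add_ac)
qed

text \<open>Inserting one factor last reduces the multilinearity and equivariance of a full composition in
  that factor to those of a single partial composition.\<close>

lemma fcomp_slot:
  assumes as: "fam nas as" and cs: "fam ncs cs" and p: "p \<in> ar P (length nas + 1 + length ncs)"
  obtains r where "r \<in> ar P (sum_list nas + 1 + sum_list ncs)"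
    and "\<And>n q. 0 < n \<Longrightarrow> q \<in> ar P n \<Longrightarrow> fcomp P p (nas @ n # ncs) (as @ q # cs) =
      circ P (sum_list nas + 1 + sum_list ncs) n (sum_list nas) r q"
proof -
  let ?l = "length nas + 1 + length ncs"
  let ?p = "fcomp_from P ?l 0 p nas as"
  \<comment> \<open>All slots of \<open>p\<close> are filled except one, now at position
    \<open>sum_list nas\<close>; this open slot is the summand 1 in the arity.\<close>
  let ?r = "fcomp_from P (sum_list nas + 1 + length ncs) (sum_list nas + 1) ?p ncs cs"
  note le = fam_length_le[OF as] fam_length_le[OF cs]
  have p': "?p \<in> ar P (sum_list nas + 1 + length ncs)"
    using fcomp_from_closed[OF as p, of 0] by (simp add: algebra_simps)
  have "?r \<in> ar P (sum_list nas + 1 + sum_list ncs)"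
    using fcomp_from_closed[OF cs p', of "sum_list nas + 1"] by (simp add: algebra_simps)
  moreover have "fcomp P p (nas @ n # ncs) (as @ q # cs) =
      circ P (sum_list nas + 1 + sum_list ncs) n (sum_list nas) ?r q" if "0 < n" "q \<in> ar P n" for n q
    using fcomp_from_circ_after[OF cs p' that(2,1), of "sum_list nas" "sum_list nas + 1"]
    by (simp add: fcomp_def fcomp_from_append[OF as] algebra_simps)
  ultimately show thesis by (rule that)
qed

lemma fcomp_from_units:
  "p \<in> ar P a \<Longrightarrow> i + k \<le> a \<Longrightarrow> fcomp_from P a i p (replicate k 1) (replicate k (opunit P)) = p"
proof (induction k arbitrary: i)
  case (Suc k)
  then show ?case using circ_unit_right[of i a p] Suc.IH[of "Suc i"] by simp
qed simp

lemma fcomp_units: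
  "p \<in> ar P k \<Longrightarrow> fcomp P p (replicate k 1) (replicate k (opunit P)) = p"
  using fcomp_from_units[of p k 0 k] by (simp add: fcomp_def)

end

section \<open>Block permutations\<close>

text \<open>The inverse of a block permutation is the block permutation of the inverses, with the
  block now at \<open>\<sigma> i\<close>. The ranges to compare are the positions before, in and
  after the block, and those beyond the total arity.\<close>

lemma perm_circ_inverse:
  assumes "\<sigma> permutes {..<m}" "\<tau> permutes {..<n}" "i < m"
  shows "perm_circ m n (\<sigma> i) (inv_into UNIV \<sigma>) (inv_into UNIV \<tau>) (perm_circ m n i \<sigma> \<tau> k) = k"
proof -
  note [simp] = permutes_inverses[OF assms(1)] permutes_inverses[OF assms(2)]
  have si: "\<sigma> i < m" using permutes_in_image[OF assms(1), of i] assms(3) by simp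
  have ne: "\<sigma> a \<noteq> \<sigma> i" if "a \<noteq> i" for a
    using that permutes_inj[OF assms(1)] by (auto dest: injD)
  consider "k < i" | "i \<le> k" "k < i + n" | "i + n \<le> k" "k < m + n - 1" | "i + n \<le> k" "m + n - 1 \<le> k"
    by linarith
  then show ?thesis
  proof cases
    case 1
    have "\<sigma> k < m" using permutes_in_image[OF assms(1), of k] assms(3) 1 by simp
    then show ?thesis using 1 ne[of k] si by (auto simp: perm_circ_def Let_def)
  next
    case 2
    then have "\<tau> (k - i) < n" using permutes_in_image[OF assms(2), of "k - i"] by auto
    then show ?thesis using 2 by (auto simp: perm_circ_def Let_def)
  next
    case 3
    let ?k = "k + 1 - n"
    have k: "i < ?k" "?k < m" using 3 by auto
    have m: "\<sigma> ?k < m" using permutes_in_image[OF assms(1), of ?k] k by simp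
    have *: "perm_circ m n i \<sigma> \<tau> k = (if \<sigma> ?k < \<sigma> i then \<sigma> ?k else \<sigma> ?k + n - 1)"
      using 3 by (simp add: perm_circ_def Let_def)
    show ?thesis
    proof (cases "\<sigma> ?k < \<sigma> i")
      case True
      then show ?thesis unfolding * using k 3 by (simp add: perm_circ_def Let_def)
    next
      case False
      \<comment> \<open>Since \<open>\<sigma> ?k\<close> also differs from
        \<open>\<sigma> i\<close>, it exceeds it, and the shift by \<open>n - 1\<close> lands behind
        the target block.\<close>
      then have "\<sigma> i + n \<le> \<sigma> ?k + n - 1" "\<sigma> ?k + n - 1 < m + n - 1" "\<sigma> ?k + n - 1 + 1 - n = \<sigma> ?k"
        using ne[of ?k] k m by linarith+
      with False show ?thesis unfolding * perm_circ_def Let_def using k 3 by simp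
    qed
  next
    case 4
    then show ?thesis using si assms(3) by (auto simp: perm_circ_def Let_def)
  qed
qed

lemma perm_circ_permutes:
  assumes "\<sigma> permutes {..<m}" "\<tau> permutes {..<n}" "i < m"
  shows "perm_circ m n i \<sigma> \<tau> permutes {..<m + n - 1}"
proof -
  have si: "\<sigma> i < m" using permutes_in_image[OF assms(1), of i] assms(3) by simp
  let ?f = "perm_circ m n i \<sigma> \<tau>"
    and ?g = "perm_circ m n (\<sigma> i) (inv_into UNIV \<sigma>) (inv_into UNIV \<tau>)"
  have "?g (?f k) = k" "?f (?g k) = k" for k
    using perm_circ_inverse[OF assms, of k]
      perm_circ_inverse[OF permutes_inv[OF assms(1)] permutes_inv[OF assms(2)] si, of k]
    by (simp_all add: permutes_inverses[OF assms(1)] permutes_inv_inv[OF assms(1)] permutes_inv_inv[OF assms(2)])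
  then have "bij ?f" by (intro o_bij[of ?g]) auto
  moreover have "?f k = k" if "k \<notin> {..<m + n - 1}" for k
    using that assms(3) by (auto simp: perm_circ_def Let_def)
  ultimately show ?thesis unfolding permutes_def bij_iff by blast
qed

text \<open>Outside the block, entries travel by \<sigma>, inside it by \<tau>. This matches the
  equivariance axiom of an operad with the action on tensors: it is applied with \<sigma> the
  identity to concatenations and with \<tau> the identity to insertions.\<close>

lemma permute_list_perm_circ:
  assumes "\<sigma> permutes {..<m}" "\<tau> permutes {..<n}" "i < m" "length xs = m" "length ys = n"
  shows "permute_list (perm_circ m n i \<sigma> \<tau>) (take (\<sigma> i) xs @ ys @ drop (Suc (\<sigma> i)) xs) =
    take i (permute_list \<sigma> xs) @ permute_list \<tau> ys @ drop (Suc i) (permute_list \<sigma> xs)"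
proof (rule nth_equalityI)
  have si: "\<sigma> i < m" using permutes_in_image[OF assms(1), of i] assms(3) by simp
  let ?zs = "take (\<sigma> i) xs @ ys @ drop (Suc (\<sigma> i)) xs"
  let ?rhs = "take i (permute_list \<sigma> xs) @ permute_list \<tau> ys @ drop (Suc i) (permute_list \<sigma> xs)"
  let ?\<rho> = "perm_circ m n i \<sigma> \<tau>"
  have len: "length ?zs = m + n - 1" using si assms by simp
  show "length (permute_list ?\<rho> ?zs) = length ?rhs" using si assms by simp
  have ne: "\<sigma> a \<noteq> \<sigma> i" if "a \<noteq> i" for a
    using that permutes_inj[OF assms(1)] by (auto dest: injD)
  have outer: "?zs ! (if \<sigma> a < \<sigma> i then \<sigma> a else \<sigma> a + n - 1) = xs ! \<sigma> a" if "a \<noteq> i" "a < m" for a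
  proof -
    have "\<sigma> a < m" using permutes_in_image[OF assms(1), of a] that by simp
    then show ?thesis using ne[OF that(1)] si assms by (auto simp: nth_append)
  qed
  fix k assume "k < length (permute_list ?\<rho> ?zs)"
  then have k: "k < m + n - 1" using len by simp
  have "permute_list ?\<rho> ?zs ! k = ?zs ! ?\<rho> k"
    using perm_circ_permutes[OF assms(1-3)] k len by (intro permute_list_nth) simp_all
  also consider "k < i" | "i \<le> k" "k < i + n" | "i + n \<le> k" by linarith
  then have "?zs ! ?\<rho> k = ?rhs ! k"
  proof cases
    case 1
    then show ?thesis using outer[of k] assms
      by (simp add: perm_circ_def Let_def nth_append permute_list_nth)
  next
    case 2
    then have "\<tau> (k - i) < n" using permutes_in_image[OF assms(2), of "k - i"] by auto
    moreover have "k - i < n" using 2 by linarith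
    ultimately show ?thesis using 2 assms si
      by (simp add: perm_circ_def Let_def nth_append permute_list_nth)
  next
    case 3
    let ?k = "k + 1 - n"
    have kk: "?k < m" "?k \<noteq> i" "Suc (i + (k - i - n)) = ?k" "k - n - i = k - i - n"
      "\<not> k - i < n" using 3 k by auto
    have "?\<rho> k = (if \<sigma> ?k < \<sigma> i then \<sigma> ?k else \<sigma> ?k + n - 1)"
      using 3 k by (simp add: perm_circ_def Let_def)
    then have "?zs ! ?\<rho> k = xs ! \<sigma> ?k" using outer[of ?k] kk by simp
    also have "\<dots> = permute_list \<sigma> xs ! ?k"
      using kk assms by (simp add: permute_list_nth)
    also have "\<dots> = ?rhs ! k"
      using 3 k kk assms by (simp add: nth_append)
    finally show ?thesis .
  qed
  finally show "permute_list ?\<rho> ?zs ! k = ?rhs ! k" .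
qed

lemma tmul_tperm_tmul:
  assumes s: "s \<in> tpow sV k" and t: "t \<in> tpow sV n" and u: "u \<in> tpow sV l" and \<tau>: "\<tau> permutes {..<n}"
  shows "tmul sV s (tmul sV (tperm sV \<tau> t) u) =
    tperm sV (perm_circ (k + 1 + l) n k id \<tau>) (tmul sV s (tmul sV t u))"
proof -
  let ?\<rho> = "perm_circ (k + 1 + l) n k id \<tau>"
  have \<rho>: "?\<rho> permutes {..<k + n + l}"
    using perm_circ_permutes[of id "k + 1 + l" \<tau> n k] \<tau> by (simp add: permutes_id algebra_simps)
  have 0: "tmul sV (word sV xs) (tmul sV (tperm sV \<tau> (word sV ys)) (word sV zs)) =
      tperm sV ?\<rho> (tmul sV (word sV xs) (tmul sV (word sV ys) (word sV zs)))"
    if "length xs = k" "length ys = n" "length zs = l" for xs ys zs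
  proof -
    \<comment> \<open>The list of outer entries needs something at position \<open>k\<close>, where
      the block goes; the placeholder \<open>undefined\<close> is dropped by \<open>take\<close> and
      \<open>drop\<close>.\<close>
    have "permute_list ?\<rho> (xs @ ys @ zs) = xs @ permute_list \<tau> ys @ zs"
      using permute_list_perm_circ[of id "k + 1 + l" \<tau> n k "xs @ undefined # zs" ys] \<tau> that
      by (simp add: permutes_id)
    then show ?thesis using \<tau> \<rho> that by (simp add: tperm_word add.assoc)
  qed
  have 1: "tmul sV (word sV xs) (tmul sV (tperm sV \<tau> (word sV ys)) u) =
      tperm sV ?\<rho> (tmul sV (word sV xs) (tmul sV (word sV ys) u))"
    if "length xs = k" "length ys = n" for xs ys
    by (rule tpow_eqI[OF u linear_compose[OF linear_tmul_right linear_tmul_right]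
          linear_compose[OF linear_compose[OF linear_tmul_right linear_tmul_right] linear_tperm] 0[OF that]])
  have 2: "tmul sV (word sV xs) (tmul sV (tperm sV \<tau> t) u) =
      tperm sV ?\<rho> (tmul sV (word sV xs) (tmul sV t u))"
    if "length xs = k" for xs
    by (rule tpow_eqI[OF t linear_compose[OF linear_compose[OF linear_tperm linear_tmul_left] linear_tmul_right]
          linear_compose[OF linear_compose[OF linear_tmul_left linear_tmul_right] linear_tperm] 1[OF that]])
  show ?thesis
    by (rule tpow_eqI[OF s linear_tmul_left linear_compose[OF linear_tmul_left linear_tperm] 2])
qed

text \<open>Inserting at \<open>i\<close> after permuting replaces the letter that stood at
  \<open>\<sigma> i\<close>. On words this is a block permutation with unpermuted block, once the
  value of \<open>f\<close> is itself expanded into words.\<close>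

lemma tapply_tperm:
  fixes sV :: "'k::field \<Rightarrow> 'v::ab_group_add \<Rightarrow> 'v"
  assumes f: "Vector_Spaces.linear sV fscale f" "range f \<subseteq> tpow sV n"
    and \<sigma>: "\<sigma> permutes {..<m}" and i: "i < m" and t: "t \<in> tpow sV m"
  shows "tapply sV i f (tperm sV \<sigma> t) = tperm sV (perm_circ m n i \<sigma> id) (tapply sV (\<sigma> i) f t)"
proof (rule tpow_eqI[OF t linear_compose[OF linear_tperm linear_tapply] linear_compose[OF linear_tapply linear_tperm]])
  fix xs :: "'v list" assume xs: "length xs = m"
  have si: "\<sigma> i < m" using permutes_in_image[OF \<sigma>, of i] i by simp
  let ?\<rho> = "perm_circ m n i \<sigma> id"
  have \<rho>: "?\<rho> permutes {..<m + n - 1}"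
    by (rule perm_circ_permutes[OF \<sigma> permutes_id i])
  let ?y = "permute_list \<sigma> xs"
  have fx: "f (xs ! \<sigma> i) \<in> tpow sV n" using f by blast
  have *: "tmul sV (word sV (take i ?y)) (tmul sV (word sV ys) (word sV (drop (Suc i) ?y))) =
      tperm sV ?\<rho> (tmul sV (word sV (take (\<sigma> i) xs)) (tmul sV (word sV ys) (word sV (drop (Suc (\<sigma> i)) xs))))"
    if "length ys = n" for ys
  proof -
    have "length (take (\<sigma> i) xs @ ys @ drop (Suc (\<sigma> i)) xs) = m + n - 1"
      using xs si that by simp
    then show ?thesis
      using permute_list_perm_circ[OF \<sigma> permutes_id i xs that] \<rho>
        tperm_word[of ?\<rho> "take (\<sigma> i) xs @ ys @ drop (Suc (\<sigma> i)) xs" sV] by simp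
  qed
  have "tmul sV (word sV (take i ?y)) (tmul sV (f (xs ! \<sigma> i)) (word sV (drop (Suc i) ?y))) =
      tperm sV ?\<rho> (tmul sV (word sV (take (\<sigma> i) xs)) (tmul sV (f (xs ! \<sigma> i)) (word sV (drop (Suc (\<sigma> i)) xs))))"
    by (rule tpow_eqI[OF fx linear_compose[OF linear_tmul_left linear_tmul_right]
          linear_compose[OF linear_compose[OF linear_tmul_left linear_tmul_right] linear_tperm] *])
  moreover have "tmul sV (word sV ys) (word sV []) = word sV ys" for ys by simp
  ultimately show "tapply sV i f (tperm sV \<sigma> (word sV xs)) = tperm sV ?\<rho> (tapply sV (\<sigma> i) f (word sV xs))"
    using \<sigma> xs i si by (simp add: tperm_word tapply_word[OF f(1)] permute_list_nth tmul_word_Nil_right[OF word_in_tpow])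
qed

section \<open>Multilinear extension and graded sequences\<close>

lemma bilin_on_linear:
  assumes "Vector_Spaces.linear fscale fscale L" "bilin_on s s' A B g"
  shows "bilin_on s s' A B (\<lambda>a b. L (g a b))"
  using assms(2) unfolding bilin_on_def by (simp add: lin_add[OF assms(1)] lin_scale[OF assms(1)])

lemma
  assumes "bilin_on s s' A B g"
  shows bilin_on_add_left: "a \<in> A \<Longrightarrow> a' \<in> A \<Longrightarrow> b \<in> B \<Longrightarrow> g (a + a') b = g a b + g a' b"
    and bilin_on_add_right: "a \<in> A \<Longrightarrow> b \<in> B \<Longrightarrow> b' \<in> B \<Longrightarrow> g a (b + b') = g a b + g a b'"
    and bilin_on_scale_left: "a \<in> A \<Longrightarrow> b \<in> B \<Longrightarrow> g (s c a) b = fscale c (g a b)"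
    and bilin_on_scale_right: "a \<in> A \<Longrightarrow> b \<in> B \<Longrightarrow> g a (s' c b) = fscale c (g a b)"
  using assms by (auto simp: bilin_on_def)

lemma bilin_on_sum_right:
  assumes g: "bilin_on s s' A B g" and s': "vector_space s'" and B: "module.subspace s' B"
    and a: "a \<in> A" and f: "\<And>i. i \<in> I \<Longrightarrow> f i \<in> B"
  shows "g a (\<Sum>i\<in>I. f i) = (\<Sum>i\<in>I. g a (f i))"
proof -
  interpret B: vector_space s' by (fact s')
  have "g a (s' 0 0) = fscale 0 (g a 0)"
    using g a B.subspace_0[OF B] by (rule bilin_on_scale_right)
  then have 0: "g a 0 = 0" by simp
  show ?thesis
    using f
  proof (induction I rule: infinite_finite_induct)
    case (insert i I)
    then have "(\<Sum>i\<in>I. f i) \<in> B" by (intro B.subspace_sum[OF B]) auto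
    then show ?case using insert by (simp add: bilin_on_add_right[OF g a])
  qed (simp_all add: 0)
qed

lemma mlext_update_add:
  "k < length us \<Longrightarrow> mlext g (us[k := u + v]) = mlext g (us[k := u]) + mlext g (us[k := v])"
  by (induction us arbitrary: k g) (auto simp: lext_add lext_fun_add split: nat.split)

lemma mlext_update_scale:
  "k < length us \<Longrightarrow> mlext g (us[k := fscale c u]) = fscale c (mlext g (us[k := u]))"
  by (induction us arbitrary: k g) (auto simp: lext_scale lext_fun_scale split: nat.split)

lemma mlext_zero: "0 \<in> set us \<Longrightarrow> mlext g us = 0"
  by (induction us arbitrary: g) (auto simp: lext_0 lext_fun_0)

lemma mlext_in_subspace:
  assumes "free.subspace S" "\<And>l. list_all2 (\<lambda>a u. a \<in> Poly_Mapping.keys u) l us \<Longrightarrow> g l \<in> S"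
  shows "mlext g us \<in> S"
  using assms(2)
  by (induction us arbitrary: g) (auto intro!: lext_in_subspace[OF assms(1)])

lemma map2_update:
  assumes "length xs = length ns" "k < length xs"
  shows "map2 f (xs[k := a]) ns = (map2 f xs ns)[k := f a (ns ! k)]"
  using assms by (intro nth_equalityI) (auto simp: nth_list_update)

definition hom_deg :: "nat \<Rightarrow> 'a::zero \<Rightarrow> nat \<Rightarrow> 'a" where
  "hom_deg n u = (\<lambda>m. if m = n then u else 0)"

lemma hom_deg_0 [simp]: "hom_deg n 0 = 0"
  by (auto simp: hom_deg_def)

lemma hom_deg_add: "hom_deg n (u + v) = hom_deg n u + hom_deg n (v :: 'a::monoid_add)"
  by (auto simp: hom_deg_def)

text \<open>This says that the valuation exceeds \<open>N\<close>, degree \<open>N\<close> included,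
  and it covers the zero sequence without a separate case.\<close>

definition vanishes :: "nat \<Rightarrow> (nat \<Rightarrow> 'a::zero) \<Rightarrow> bool" where
  "vanishes N x \<longleftrightarrow> (\<forall>m\<le>N. x m = 0)"

section \<open>The completed free algebra\<close>

locale free_algebra = operad P + V: vector_space sV
  for P :: "('k::field, 'p::ab_group_add) operad_data"
    and sV :: "'k \<Rightarrow> 'v::ab_group_add \<Rightarrow> 'v" +
  assumes ar_0: "ar P 0 = {0}"
begin

abbreviation F where "F \<equiv> Fbar P sV"
abbreviation aop where "aop \<equiv> Fbar_op P sV"

text \<open>The relation defining F moves a permutation from the operadic factor to the tensor with
  an inverse. Replacing the tensor by a permuted one turns it into invariance under the simultaneous
  action on both factors, where no inverse appears.\<close>

definition balanced :: "nat \<Rightarrow> ('p \<Rightarrow> ('v list \<Rightarrow>\<^sub>0 'k) \<Rightarrow> ('c \<Rightarrow>\<^sub>0 'k)) \<Rightarrow> bool" where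
  "balanced n g \<longleftrightarrow> bilin_on (scl P) fscale (ar P n) (tpow sV n) g \<and>
     (\<forall>p\<in>ar P n. \<forall>t\<in>tpow sV n. \<forall>\<sigma>. \<sigma> permutes {..<n} \<longrightarrow>
        g (act P n p \<sigma>) (tperm sV \<sigma> t) = g p t)"

lemma lext_dot:
  assumes g: "balanced n g" and pt: "p \<in> ar P n" "t \<in> tpow sV n"
  shows "lext (case_prod g) (dot P sV n p t) = g p t"
proof -
  have b: "bilin_on (scl P) fscale (ar P n) (tpow sV n) g" using g by (simp add: balanced_def)
  note l = lext_pure_tensor[OF b]
  have "lext (case_prod g) (pure_F P sV n (act P n p \<sigma>) t - pure_F P sV n p (tperm sV (inv_into UNIV \<sigma>) t)) = 0"
    if "p \<in> ar P n" "t \<in> tpow sV n" "\<sigma> permutes {..<n}" for p t \<sigma>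
  proof -
    have t': "tperm sV (inv_into UNIV \<sigma>) t \<in> tpow sV n" by (rule tperm_in_tpow[OF that(2)])
    with g that have "g (act P n p \<sigma>) (tperm sV \<sigma> (tperm sV (inv_into UNIV \<sigma>) t)) =
        g p (tperm sV (inv_into UNIV \<sigma>) t)"
      by (simp add: balanced_def)
    then show ?thesis
      using that t' by (simp add: pure_F_def lext_diff l act_ar tperm_inv_tperm)
  qed
  then show ?thesis
    unfolding dot_def F_map_def
    by (subst lext_quot) (auto simp: pure_F_def l pt)
qed

lemma linear_F_map: "Vector_Spaces.linear fscale fscale (F_map P sV n)"
  unfolding F_map_def by (rule linear_quot_span)

lemma bilin_dot: "bilin_on (scl P) fscale (ar P n) (tpow sV n) (dot P sV n)"
  unfolding dot_def[abs_def] pure_F_def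
  by (rule bilin_on_linear[OF linear_F_map bilin_on_pure_tensor])

lemmas dot_add_left = bilin_on_add_left[OF bilin_dot]
  and dot_add_right = bilin_on_add_right[OF bilin_dot]
  and dot_scale_left = bilin_on_scale_left[OF bilin_dot]
  and dot_scale_right = bilin_on_scale_right[OF bilin_dot]

lemma dot_act:
  assumes "p \<in> ar P n" "t \<in> tpow sV n" "\<sigma> permutes {..<n}"
  shows "dot P sV n (act P n p \<sigma>) (tperm sV \<sigma> t) = dot P sV n p t"
proof -
  have "pure_F P sV n (act P n p \<sigma>) (tperm sV \<sigma> t) - pure_F P sV n p (tperm sV (inv_into UNIV \<sigma>) (tperm sV \<sigma> t))
      \<in> {pure_F P sV n (act P n p \<sigma>) t - pure_F P sV n p (tperm sV (inv_into UNIV \<sigma>) t) |p t \<sigma>.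
        p \<in> ar P n \<and> t \<in> tpow sV n \<and> \<sigma> permutes {..<n}}"
    using assms tperm_in_tpow by blast
  from free.span_base[OF this] show ?thesis
    unfolding dot_def F_map_def using assms by (intro quot_span_eqI) (simp add: tperm_inv_tperm)
qed

text \<open>The projection onto coinvariants acts on the whole free space. As its relations lie in
  the tensor product, it moves an element of the tensor product only within it.\<close>

lemma F_deg_in_tensor: "u \<in> F_deg P sV n \<Longrightarrow> u \<in> tensor (scl P) fscale (ar P n) (tpow sV n)"
proof -
  let ?T = "tensor (scl P) fscale (ar P n) (tpow sV n)"
  let ?R = "{pure_F P sV n (act P n p \<sigma>) t - pure_F P sV n p (tperm sV (inv_into UNIV \<sigma>) t) |p t \<sigma>.
        p \<in> ar P n \<and> t \<in> tpow sV n \<and> \<sigma> permutes {..<n}}"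
  assume "u \<in> F_deg P sV n"
  then obtain x where x: "x \<in> ?T" "u = F_map P sV n x" by (auto simp: F_deg_def)
  have "?R \<subseteq> ?T"
  proof
    fix r assume "r \<in> ?R"
    then obtain p t \<sigma> where r: "r = pure_F P sV n (act P n p \<sigma>) t - pure_F P sV n p (tperm sV (inv_into UNIV \<sigma>) t)"
      "p \<in> ar P n" "t \<in> tpow sV n" "\<sigma> permutes {..<n}" by blast
    show "r \<in> ?T" unfolding r(1) pure_F_def
      using r(2-4) by (intro free.subspace_diff[OF subspace_tensor] pure_tensor_in_tensor act_ar tperm_in_tpow)
  qed
  then have "free.span ?R \<subseteq> ?T" by (rule free.span_minimal) (rule subspace_tensor)
  then have "x - u \<in> ?T" unfolding x(2) F_map_def using diff_quot_in_span by blast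
  from free.subspace_diff[OF subspace_tensor x(1) this] show ?thesis by simp
qed

lemma keys_F_deg:
  assumes "u \<in> F_deg P sV n" shows "Poly_Mapping.keys u \<subseteq> ar P n \<times> tpow sV n"
  by (rule keys_tensor[OF vector_space_axioms vector_space_fscale ar_subspace subspace_tpow F_deg_in_tensor[OF assms]])

lemma F_deg_expand:
  assumes "u \<in> F_deg P sV n" shows "lext (case_prod (dot P sV n)) u = u"
proof -
  have "F_map P sV n u = u" using assms by (auto simp: F_deg_def F_map_def quot_span_idem)
  moreover have "F_map P sV n (lext (case_prod (pure_tensor (scl P) fscale (ar P n) (tpow sV n))) u) =
      lext (case_prod (dot P sV n)) u"
    unfolding lin_lext[OF linear_F_map] by (rule lext_cong) (auto simp: dot_def pure_F_def)
  ultimately show ?thesis by (simp add: tensor_expand[OF F_deg_in_tensor[OF assms]])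
qed

lemma dot_in_F_deg: "p \<in> ar P n \<Longrightarrow> t \<in> tpow sV n \<Longrightarrow> dot P sV n p t \<in> F_deg P sV n"
  unfolding dot_def F_deg_def pure_F_def by (intro imageI pure_tensor_in_tensor)

lemma subspace_F_deg: "free.subspace (F_deg P sV n)"
proof -
  interpret l: Vector_Spaces.linear fscale fscale "F_map P sV n" by (rule linear_F_map)
  show ?thesis unfolding F_deg_def by (rule l.subspace_image[OF subspace_tensor])
qed

text \<open>There is no case for scalars: they are absorbed into the operadic coefficient, so sums
  of monomials exhaust the degree. For this reason additivity is enough in the density
  arguments.\<close>

lemma F_deg_induct [consumes 1, case_names zero dot add]:
  assumes u: "u \<in> F_deg P sV n"
    and zero: "Q 0"
    and dot: "\<And>q xs. q \<in> ar P n \<Longrightarrow> length xs = n \<Longrightarrow> Q (dot P sV n q (word sV xs))"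
    and add: "\<And>u v. u \<in> F_deg P sV n \<Longrightarrow> v \<in> F_deg P sV n \<Longrightarrow> Q u \<Longrightarrow> Q v \<Longrightarrow> Q (u + v)"
  shows "Q u"
proof -
  have sum: "Q (sum f A) \<and> sum f A \<in> F_deg P sV n"
    if "\<And>a. a \<in> A \<Longrightarrow> Q (f a) \<and> f a \<in> F_deg P sV n"
    for A :: "'z set" and f :: "'z \<Rightarrow> _"
    using that
    by (induction A rule: infinite_finite_induct)
      (auto intro!: zero add free.subspace_0[OF subspace_F_deg] free.subspace_add[OF subspace_F_deg])
  have 1: "Q (dot P sV n q t)" if q: "q \<in> ar P n" and t: "t \<in> tpow sV n" for q t
  proof -
    have k: "length xs = n" if "xs \<in> Poly_Mapping.keys t" for xs using keys_tpow[OF t] that by blast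
    have w: "word sV xs \<in> tpow sV n" if "xs \<in> Poly_Mapping.keys t" for xs
      using word_in_tpow[of sV xs] k[OF that] by simp
    have "dot P sV n q t = dot P sV n q (lext (word sV) t)" by (simp add: tpow_expand[OF t])
    also have "\<dots> = (\<Sum>xs\<in>Poly_Mapping.keys t. dot P sV n q (fscale (Poly_Mapping.lookup t xs) (word sV xs)))"
      unfolding lext_def
      by (rule bilin_on_sum_right[OF bilin_dot vector_space_fscale subspace_tpow q]) (intro free.subspace_scale[OF subspace_tpow] w)
    also have "\<dots> = (\<Sum>xs\<in>Poly_Mapping.keys t. dot P sV n (scl P (Poly_Mapping.lookup t xs) q) (word sV xs))"
      by (rule sum.cong) (simp_all add: dot_scale_left dot_scale_right q w)
    finally show ?thesis
      using sum[of "Poly_Mapping.keys t" "\<lambda>xs. dot P sV n (scl P (Poly_Mapping.lookup t xs) q) (word sV xs)"]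
        dot dot_in_F_deg q w k subspace_scale[OF ar_subspace] by simp
  qed
  have k: "fst a \<in> ar P n" "snd a \<in> tpow sV n" if "a \<in> Poly_Mapping.keys u" for a
    using keys_F_deg[OF u] that by auto
  have "u = lext (case_prod (dot P sV n)) u" by (rule F_deg_expand[OF u, symmetric])
  also have "\<dots> = (\<Sum>a\<in>Poly_Mapping.keys u. dot P sV n (scl P (Poly_Mapping.lookup u a) (fst a)) (snd a))"
    unfolding lext_def by (rule sum.cong) (simp_all add: case_prod_beta dot_scale_left k)
  also have "Q \<dots>"
    using sum[of "Poly_Mapping.keys u" "\<lambda>a. dot P sV n (scl P (Poly_Mapping.lookup u a) (fst a)) (snd a)"]
      1 dot_in_F_deg k subspace_scale[OF ar_subspace] by simp
  finally show ?thesis .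
qed

section \<open>The completion and the density of monomials\<close>

lemma Fbar_deg: "x \<in> F \<Longrightarrow> 0 < n \<Longrightarrow> x n \<in> F_deg P sV n"
  by (simp add: Fbar_def)

lemma Fbar_at_0: "x \<in> F \<Longrightarrow> x 0 = 0"
  by (simp add: Fbar_def)

lemma FbarI: "x 0 = 0 \<Longrightarrow> (\<And>n. 0 < n \<Longrightarrow> x n \<in> F_deg P sV n) \<Longrightarrow> x \<in> F"
  by (simp add: Fbar_def)

lemma Fbar_zero: "0 \<in> F"
  by (rule FbarI) (simp_all add: free.subspace_0[OF subspace_F_deg])

lemma Fbar_add: "x \<in> F \<Longrightarrow> y \<in> F \<Longrightarrow> x + y \<in> F"
  by (rule FbarI) (simp_all add: Fbar_at_0 Fbar_deg free.subspace_add[OF subspace_F_deg])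

lemma Fbar_diff: "x \<in> F \<Longrightarrow> y \<in> F \<Longrightarrow> x - y \<in> F"
  by (rule FbarI) (simp_all add: Fbar_at_0 Fbar_deg free.subspace_diff[OF subspace_F_deg])

lemma Fbar_scale: "x \<in> F \<Longrightarrow> (\<lambda>n. fscale c (x n)) \<in> F"
  by (rule FbarI) (simp_all add: Fbar_at_0 Fbar_deg free.subspace_scale[OF subspace_F_deg])

lemma Fbar_sum: "(\<And>a. a \<in> A \<Longrightarrow> f a \<in> F) \<Longrightarrow> sum f A \<in> F"
  by (induction A rule: infinite_finite_induct) (auto intro: Fbar_zero Fbar_add)

lemma Fbar_hom_deg: "u \<in> F_deg P sV n \<Longrightarrow> 0 < n \<Longrightarrow> hom_deg n u \<in> F"
  by (rule FbarI) (simp_all add: hom_deg_def free.subspace_0[OF subspace_F_deg])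

definition hmon :: "'p \<Rightarrow> 'v list \<Rightarrow> nat \<Rightarrow> ('p \<times> ('v list \<Rightarrow>\<^sub>0 'k) \<Rightarrow>\<^sub>0 'k)" where
  "hmon q xs = hom_deg (length xs) (dot P sV (length xs) q (word sV xs))"

lemma hmon_in_Fbar: "q \<in> ar P (length xs) \<Longrightarrow> xs \<noteq> [] \<Longrightarrow> hmon q xs \<in> F"
  unfolding hmon_def by (intro Fbar_hom_deg dot_in_F_deg word_in_tpow) auto

lemma emb_eq_hmon: "emb P sV v = hmon (opunit P) [v]"
  by (auto simp: emb_def hmon_def hom_deg_def)

lemma emb_in_Fbar: "emb P sV v \<in> F"
  unfolding emb_eq_hmon using unit_ar by (intro hmon_in_Fbar) simp_all

text \<open>Additivity is included, so that it suffices to require continuity at zero.\<close>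

definition contin :: "((nat \<Rightarrow> ('p \<times> ('v list \<Rightarrow>\<^sub>0 'k) \<Rightarrow>\<^sub>0 'k)) \<Rightarrow> nat \<Rightarrow> 'c::ab_group_add) \<Rightarrow> bool" where
  "contin f \<longleftrightarrow> (\<forall>x\<in>F. \<forall>y\<in>F. f (x + y) = f x + f y) \<and>
     (\<forall>N. \<exists>M. \<forall>x\<in>F. vanishes M x \<longrightarrow> vanishes N (f x))"

lemma continI:
  assumes "\<And>x y. x \<in> F \<Longrightarrow> y \<in> F \<Longrightarrow> f (x + y) = f x + f y"
    and "\<And>N x. x \<in> F \<Longrightarrow> vanishes N x \<Longrightarrow> vanishes N (f x)"
  shows "contin f"
  using assms unfolding contin_def by blast

lemma contin_diff: 
  assumes "contin f" "contin g" shows "contin (\<lambda>x. f x - g x)"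
  unfolding contin_def
proof (intro conjI ballI allI)
  fix x y assume "x \<in> F" "y \<in> F"
  then show "f (x + y) - g (x + y) = f x - g x + (f y - g y)"
    using assms by (simp add: contin_def)
next
  fix N
  obtain M M' where M: "\<And>x. x \<in> F \<Longrightarrow> vanishes M x \<Longrightarrow> vanishes N (f x)"
    "\<And>x. x \<in> F \<Longrightarrow> vanishes M' x \<Longrightarrow> vanishes N (g x)"
    using assms unfolding contin_def by meson
  show "\<exists>M. \<forall>x\<in>F. vanishes M x \<longrightarrow> vanishes N (f x - g x)"
    using M by (intro exI[of _ "max M M'"]) (auto simp: vanishes_def)
qed

lemma contin_compose:
  assumes "contin f" "contin g" "\<And>x. x \<in> F \<Longrightarrow> g x \<in> F"
  shows "contin (\<lambda>x. f (g x))"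
  unfolding contin_def
proof (intro conjI ballI allI)
  fix x y assume "x \<in> F" "y \<in> F"
  then show "f (g (x + y)) = f (g x) + f (g y)"
    using assms by (simp add: contin_def)
next
  fix N
  obtain M where M: "\<And>x. x \<in> F \<Longrightarrow> vanishes M x \<Longrightarrow> vanishes N (f x)"
    using assms(1) unfolding contin_def by meson
  obtain M' where "\<And>x. x \<in> F \<Longrightarrow> vanishes M' x \<Longrightarrow> vanishes M (g x)"
    using assms(2) unfolding contin_def by meson
  then show "\<exists>M. \<forall>x\<in>F. vanishes M x \<longrightarrow> vanishes N (f (g x))"
    using M assms(3) by blast
qed

text \<open>To test degree \<open>N\<close> of the value, cut \<open>x\<close> at the degree
  \<open>M\<close> that continuity provides for \<open>N\<close>. The tail contributes nothing to
  this degree, and the truncation is a finite sum of monomials.\<close>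

lemma contin_eq_0:
  assumes f: "contin f" and mono: "\<And>q xs. q \<in> ar P (length xs) \<Longrightarrow> xs \<noteq> [] \<Longrightarrow> f (hmon q xs) = 0"
    and x: "x \<in> F"
  shows "f x = 0"
proof
  fix N
  have f_add: "f (x + y) = f x + f y" if "x \<in> F" "y \<in> F" for x y using f that by (simp add: contin_def)
  have f0: "f 0 = 0" using f_add[OF Fbar_zero Fbar_zero] by simp
  have hom: "f (hom_deg n u) = 0" if "u \<in> F_deg P sV n" "0 < n" for n u
    using that(1)
  proof (induction rule: F_deg_induct)
    case zero
    show ?case unfolding hom_deg_0 by (rule f0)
  next
    case (dot q xs)
    then show ?case using mono[of q xs] \<open>0 < n\<close> by (auto simp: hmon_def)
  next
    case (add u v)
    have "f (hom_deg n u + hom_deg n v) = f (hom_deg n u) + f (hom_deg n v)"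
      using add \<open>0 < n\<close> by (intro f_add Fbar_hom_deg)
    then show ?case unfolding hom_deg_add add.IH by (simp only: add_0_left)
  qed
  have f_sum: "f (sum h A) = (\<Sum>a\<in>A. f (h a))" if "\<And>a. a \<in> A \<Longrightarrow> h a \<in> F" for h and A :: "nat set"
    using that by (induction A rule: infinite_finite_induct) (simp_all add: f0 f_add Fbar_sum)
  obtain M where "\<And>x. x \<in> F \<Longrightarrow> vanishes M x \<Longrightarrow> vanishes N (f x)"
    using f unfolding contin_def by meson
  then have M: "\<And>x. x \<in> F \<Longrightarrow> vanishes M x \<Longrightarrow> f x N = 0"
    unfolding vanishes_def by blast
  let ?t = "\<Sum>n\<in>{1..M}. hom_deg n (x n)"
  have t: "?t \<in> F" by (intro Fbar_sum Fbar_hom_deg Fbar_deg[OF x]) auto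
  have sum_apply: "(\<Sum>n\<in>A. h n) m = (\<Sum>n\<in>A. h n m)" for A :: "nat set" and h :: "nat \<Rightarrow> nat \<Rightarrow> 'p \<times> ('v list \<Rightarrow>\<^sub>0 'k) \<Rightarrow>\<^sub>0 'k" and m
    by (induction A rule: infinite_finite_induct) auto
  have "(x - ?t) m = 0" if "m \<le> M" for m
    using that Fbar_at_0[OF x] by (cases "m = 0") (auto simp: sum_apply hom_deg_def sum.delta)
  then have "f (x - ?t) N = 0" using x t by (intro M Fbar_diff) (auto simp: vanishes_def)
  moreover have "f ?t = (\<Sum>n\<in>{1..M}. f (hom_deg n (x n)))"
    by (intro f_sum Fbar_hom_deg Fbar_deg[OF x]) auto
  then have "f ?t = 0"
    by (simp only:, intro sum.neutral ballI hom Fbar_deg[OF x]) auto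
  moreover have "f x = f (x - ?t) + f ?t" using f_add[OF Fbar_diff[OF x t] t] by simp
  ultimately show "f x N = 0 N" by simp
qed

text \<open>Arguments are traded for monomials one at a time. In a list with arbitrary entries
  \<open>pre\<close> followed by monomials, continuity in the last slot of \<open>pre\<close> allows
  that entry to be taken as a monomial, which then joins the others.\<close>

lemma contin_list_eq_0:
  assumes contin: "\<And>xs k. set xs \<subseteq> F \<Longrightarrow> length xs = L \<Longrightarrow> k < L \<Longrightarrow> contin (\<lambda>a. \<Phi> (xs[k := a]))"
    and mono: "\<And>ps. length ps = L \<Longrightarrow> (\<And>q xs. (q, xs) \<in> set ps \<Longrightarrow> q \<in> ar P (length xs) \<and> xs \<noteq> []) \<Longrightarrow>
      \<Phi> (map (\<lambda>(q, xs). hmon q xs) ps) = 0"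
    and xs: "set xs \<subseteq> F" "length xs = L"
  shows "\<Phi> xs = 0"
proof -
  have "\<Phi> (pre @ map (\<lambda>(q, xs). hmon q xs) ps) = 0"
    if "set pre \<subseteq> F" "length pre + length ps = L" "\<And>q xs. (q, xs) \<in> set ps \<Longrightarrow> q \<in> ar P (length xs) \<and> xs \<noteq> []"
    for pre ps
    using that
  proof (induction pre arbitrary: ps rule: rev_induct)
    case Nil
    then show ?case using mono by simp
  next
    case (snoc a pre)
    let ?post = "map (\<lambda>(q, xs). hmon q xs) ps"
    have "set ?post \<subseteq> F" using snoc.prems(3) hmon_in_Fbar by fastforce
    then have "contin (\<lambda>b. \<Phi> ((pre @ a # ?post)[length pre := b]))"
      using snoc.prems by (intro contin) auto
    then have "contin (\<lambda>a. \<Phi> (pre @ a # ?post))" by simp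
    moreover have "\<Phi> (pre @ hmon q xs # ?post) = 0" if "q \<in> ar P (length xs)" "xs \<noteq> []" for q xs
    proof -
      have "\<Phi> (pre @ map (\<lambda>(q, xs). hmon q xs) ((q, xs) # ps)) = 0"
        using snoc.prems that by (intro snoc.IH) auto
      then show ?thesis by simp
    qed
    ultimately have "\<Phi> (pre @ a # ?post) = 0"
      using contin_eq_0[of "\<lambda>a. \<Phi> (pre @ a # ?post)" a] snoc.prems by simp
    then show ?case by simp
  qed
  from this[of xs "[]"] show ?thesis using xs by simp
qed

subsection \<open>The algebra structure\<close>

lemma balanced_cong:
  assumes "\<And>q t. q \<in> ar P n \<Longrightarrow> t \<in> tpow sV n \<Longrightarrow> g q t = h q t" "balanced n h"
  shows "balanced n g"
proof -
  note c = subspace_add[OF ar_subspace] subspace_scale[OF ar_subspace]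
    free.subspace_add[OF subspace_tpow] free.subspace_scale[OF subspace_tpow] act_ar tperm_in_tpow
  show ?thesis
    using assms(2) unfolding balanced_def bilin_on_def by (simp add: assms(1) c)
qed

abbreviation good :: "nat list \<Rightarrow> ('p \<times> ('v list \<Rightarrow>\<^sub>0 'k)) list \<Rightarrow> bool" where
  "good \<equiv> list_all2 (\<lambda>n l. 0 < n \<and> fst l \<in> ar P n \<and> snd l \<in> tpow sV n)"

lemma good_fam: "good ns l \<Longrightarrow> fam ns (map fst l)"
  by (simp add: list_all2_map2 list_all2_mono)

lemma good_tprod: "good ns l \<Longrightarrow> tprod sV (map snd l) \<in> tpow sV (sum_list ns)"
proof (rule tprod_in_tpow)
  assume "good ns l"
  then show "list_all2 (\<lambda>t n. t \<in> tpow sV n) (map snd l) ns"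
    by (simp add: list_all2_map1 list_all2_conv_all_nth)
qed

lemma good_tprod_append:
  "good ns l \<Longrightarrow> good ns' l' \<Longrightarrow>
    tprod sV (map snd l @ map snd l') = tmul sV (tprod sV (map snd l)) (tprod sV (map snd l'))"
proof (rule tprod_append)
  assume "good ns l" "good ns' l'"
  then show "list_all2 (\<lambda>t n. t \<in> tpow sV n) (map snd l) ns" "list_all2 (\<lambda>t n. t \<in> tpow sV n) (map snd l') ns'"
    by (simp_all add: list_all2_map1 list_all2_conv_all_nth)
qed

text \<open>The universal property of \<open>dot\<close>, used for one factor after another from the
  left: each factor only has to be balanced while the others are fixed legal generators.\<close>

lemma mlext_dots:
  assumes "good ns l"
    and "\<And>ns1 n ns2 l1 l2. ns = ns1 @ n # ns2 \<Longrightarrow> 0 < n \<Longrightarrow> good ns1 l1 \<Longrightarrow> good ns2 l2 \<Longrightarrow>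
      balanced n (\<lambda>q t. g (l1 @ (q, t) # l2))"
  shows "mlext g (map2 (\<lambda>n l. dot P sV n (fst l) (snd l)) ns l) = g l"
  using assms
proof (induction arbitrary: g rule: list_all2_induct)
  case (Cons n ns a l)
  obtain q t where a: "a = (q, t)" by (cases a)
  have qt: "0 < n" "q \<in> ar P n" "t \<in> tpow sV n" using Cons.hyps a by auto
  let ?dots = "map2 (\<lambda>n l. dot P sV n (fst l) (snd l)) ns l"
  \<comment> \<open>The inner extension is needed for every generator \<open>b\<close> in the
    support of the representative of the first factor, not just for the given pair
    \<open>a\<close>.\<close>
  have *: "mlext (\<lambda>as. g (b # as)) ?dots = g (b # l)" if b: "b \<in> ar P n \<times> tpow sV n" for b
  proof (rule Cons.IH)
    fix ns1 m ns2 l1 l2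
    assume "ns = ns1 @ m # ns2" "0 < m" "good ns1 l1" "good ns2 l2"
    then show "balanced m (\<lambda>q t. g (b # l1 @ (q, t) # l2))"
      using Cons.prems(1)[of "n # ns1" m ns2 "b # l1" l2] b qt(1) by auto
  qed
  have "mlext g (map2 (\<lambda>n l. dot P sV n (fst l) (snd l)) (n # ns) (a # l)) =
      lext (\<lambda>b. mlext (\<lambda>as. g (b # as)) ?dots) (dot P sV n q t)"
    by (simp add: a)
  also have "\<dots> = lext (case_prod (\<lambda>q t. g ((q, t) # l))) (dot P sV n q t)"
    using keys_F_deg[OF dot_in_F_deg[OF qt(2,3)]] * by (intro lext_cong) auto
  also have "\<dots> = g ((q, t) # l)"
    using Cons.prems(1)[of "[]" n ns "[]" l] Cons.hyps qt by (intro lext_dot) auto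
  finally show ?case by (simp add: a)
qed simp

text \<open>It is enough to vary one factor. With the others inserted, the composite is a single
  partial composition of some \<open>r\<close> with that factor, so permuting the factor acts by a
  block permutation. The concatenated tensors undergo the same block permutation, and
  \<open>dot\<close> absorbs both.\<close>

lemma F_op_dots:
  assumes l: "good ns l" and p: "p \<in> ar P (length ns)"
  shows "F_op P sV p ns (map2 (\<lambda>n l. dot P sV n (fst l) (snd l)) ns l) =
    dot P sV (sum_list ns) (fcomp P p ns (map fst l)) (tprod sV (map snd l))"
  unfolding F_op_def
proof (rule mlext_dots[OF l])
  fix ns1 n ns2 l1 l2
  assume ns: "ns = ns1 @ n # ns2" "0 < n" and l1: "good ns1 l1" and l2: "good ns2 l2"
  let ?k = "sum_list ns1" and ?k2 = "sum_list ns2"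
  let ?L = "?k + 1 + ?k2"
  let ?T1 = "tprod sV (map snd l1)" and ?T2 = "tprod sV (map snd l2)"
  have "p \<in> ar P (length ns1 + 1 + length ns2)" using p by (simp add: ns)
  from fcomp_slot[OF good_fam[OF l1] good_fam[OF l2] this]
  obtain r where r1: "r \<in> ar P ?L"
    and r2: "\<And>n q. 0 < n \<Longrightarrow> q \<in> ar P n \<Longrightarrow>
      fcomp P p (ns1 @ n # ns2) (map fst l1 @ q # map fst l2) = circ P ?L n ?k r q"
    by blast
  note r = r1 r2[OF ns(2), folded ns(1)]
  have T: "tmul sV ?T1 (tmul sV t ?T2) \<in> tpow sV (?L + n - 1)" if "t \<in> tpow sV n" for t
    using tmul_in_tpow[OF good_tprod[OF l1] tmul_in_tpow[OF that good_tprod[OF l2]]] by (simp add: add_ac)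
  have c: "circ P ?L n ?k r q \<in> ar P (?L + n - 1)" if "q \<in> ar P n" for q
    using r(1) that by (intro circ_ar) auto
  have N: "sum_list ns = ?L + n - 1" by (simp add: ns)
  have "balanced n (\<lambda>q t. dot P sV (?L + n - 1) (circ P ?L n ?k r q) (tmul sV ?T1 (tmul sV t ?T2)))"
    unfolding balanced_def
  proof (intro conjI ballI allI impI)
    have k: "?k < ?L" by simp
    note l = lin_add[OF linear_tmul_left] lin_add[OF linear_tmul_right] lin_scale[OF linear_tmul_left]
      lin_scale[OF linear_tmul_right]
    show "bilin_on (scl P) fscale (ar P n) (tpow sV n)
        (\<lambda>q t. dot P sV (?L + n - 1) (circ P ?L n ?k r q) (tmul sV ?T1 (tmul sV t ?T2)))"
      by (rule bilin_onI) (use k T c in \<open>simp_all only: circ_add_right[OF k r(1)] circ_scale_right[OF k r(1)]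
          dot_add_left dot_add_right dot_scale_left dot_scale_right l\<close>)
    fix q t \<sigma> assume q: "q \<in> ar P n" and t: "t \<in> tpow sV n" and \<sigma>: "\<sigma> permutes {..<n}"
    have "circ P ?L n ?k r (act P n q \<sigma>) = circ P ?L n ?k (act P ?L r id) (act P n q \<sigma>)"
      by (simp only: act_id[OF r(1)])
    also have "\<dots> = act P (?L + n - 1) (circ P ?L n ?k r q) (perm_circ ?L n ?k id \<sigma>)"
      using circ_act[OF k permutes_id \<sigma> r(1) q] by simp
    finally show "dot P sV (?L + n - 1) (circ P ?L n ?k r (act P n q \<sigma>)) (tmul sV ?T1 (tmul sV (tperm sV \<sigma> t) ?T2)) =
        dot P sV (?L + n - 1) (circ P ?L n ?k r q) (tmul sV ?T1 (tmul sV t ?T2))"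
      using dot_act[OF c[OF q] T[OF t] perm_circ_permutes[OF permutes_id \<sigma> k]]
      by (simp only: tmul_tperm_tmul[OF good_tprod[OF l1] t good_tprod[OF l2] \<sigma>])
  qed
  then show "balanced n (\<lambda>q t. dot P sV (sum_list ns) (fcomp P p ns (map fst (l1 @ (q, t) # l2)))
      (tprod sV (map snd (l1 @ (q, t) # l2))))"
  proof (rule balanced_cong[rotated])
    fix q t assume q: "q \<in> ar P n" and t: "t \<in> tpow sV n"
    have "tprod sV (map snd l1 @ map snd ((q, t) # l2)) = tmul sV ?T1 (tprod sV (map snd ((q, t) # l2)))"
      using q t ns(2) l2 by (intro good_tprod_append[OF l1, of "n # ns2"]) simp
    then have 1: "tprod sV (map snd (l1 @ (q, t) # l2)) = tmul sV ?T1 (tmul sV t ?T2)" by simp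
    have 2: "map fst (l1 @ (q, t) # l2) = map fst l1 @ q # map fst l2" by simp
    show "dot P sV (sum_list ns) (fcomp P p ns (map fst (l1 @ (q, t) # l2))) (tprod sV (map snd (l1 @ (q, t) # l2))) =
        dot P sV (?L + n - 1) (circ P ?L n ?k r q) (tmul sV ?T1 (tmul sV t ?T2))"
      unfolding 1 2 r(2)[OF q] N ..
  qed
qed

lemma good_keys:
  assumes us: "list_all2 (\<lambda>n u. 0 < n \<and> u \<in> F_deg P sV n) ns us"
    and l: "list_all2 (\<lambda>a u. a \<in> Poly_Mapping.keys u) l us"
  shows "good ns l"
  unfolding list_all2_conv_all_nth
proof (intro conjI allI impI)
  show "length ns = length l" using l us by (simp add: list_all2_lengthD)
  fix i assume i: "i < length ns"
  then have u: "0 < ns ! i" "us ! i \<in> F_deg P sV (ns ! i)" and k: "l ! i \<in> Poly_Mapping.keys (us ! i)"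
    using us l by (auto simp: list_all2_conv_all_nth)
  show "0 < ns ! i" "fst (l ! i) \<in> ar P (ns ! i)" "snd (l ! i) \<in> tpow sV (ns ! i)"
    using keys_F_deg[OF u(2)] k u(1) by auto
qed

lemma F_op_in_F_deg:
  assumes p: "p \<in> ar P (length ns)" and us: "list_all2 (\<lambda>n u. 0 < n \<and> u \<in> F_deg P sV n) ns us"
  shows "F_op P sV p ns us \<in> F_deg P sV (sum_list ns)"
  unfolding F_op_def
  by (rule mlext_in_subspace[OF subspace_F_deg], drule good_keys[OF us])
    (intro dot_in_F_deg fcomp_closed good_fam good_tprod p; assumption)

lemma parts_in_F_deg:
  assumes xs: "set xs \<subseteq> F" and ns: "length ns = length xs" "0 \<notin> set ns"
  shows "list_all2 (\<lambda>n u. 0 < n \<and> u \<in> F_deg P sV n) ns (map2 (\<lambda>x. x) xs ns)"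
  unfolding list_all2_conv_all_nth
proof (intro conjI allI impI)
  fix i assume i: "i < length ns"
  show "0 < ns ! i" using ns(2) i by (metis gr0I nth_mem)
  moreover have "xs ! i \<in> F" using xs i ns(1) by auto
  ultimately show "map2 (\<lambda>x. x) xs ns ! i \<in> F_deg P sV (ns ! i)" using Fbar_deg i ns(1) by simp
qed (use ns(1) in simp)

lemma finite_arities: "finite {ns. length ns = L \<and> sum_list ns = N \<and> 0 \<notin> set (ns :: nat list)}"
  by (rule finite_subset[OF _ finite_compositions[of N]]) auto

lemma aop_add:
  assumes "k < length xs"
  shows "aop p (xs[k := a + b]) = aop p (xs[k := a]) + aop p (xs[k := b])"
proof
  fix N
  have "F_op P sV p ns (map2 (\<lambda>x. x) (xs[k := a + b]) ns) =
      F_op P sV p ns (map2 (\<lambda>x. x) (xs[k := a]) ns) + F_op P sV p ns (map2 (\<lambda>x. x) (xs[k := b]) ns)"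
    if "length ns = length xs" for ns
    using assms that by (simp add: F_op_def map2_update mlext_update_add)
  then show "aop p (xs[k := a + b]) N = (aop p (xs[k := a]) + aop p (xs[k := b])) N"
    by (simp add: Fbar_op_def sum.distrib[symmetric])
qed

lemma aop_scale:
  assumes "k < length xs"
  shows "aop p (xs[k := (\<lambda>n. fscale c (a n))]) = (\<lambda>n. fscale c (aop p (xs[k := a]) n))"
proof
  fix N
  have "F_op P sV p ns (map2 (\<lambda>x. x) (xs[k := (\<lambda>n. fscale c (a n))]) ns) =
      fscale c (F_op P sV p ns (map2 (\<lambda>x. x) (xs[k := a]) ns))"
    if "length ns = length xs" for ns
    using assms that by (simp add: F_op_def map2_update mlext_update_scale)
  then show "aop p (xs[k := (\<lambda>n. fscale c (a n))]) N = fscale c (aop p (xs[k := a]) N)"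
    by (simp add: Fbar_op_def free.scale_sum_right)
qed

text \<open>In total degree at most \<open>N\<close>, argument \<open>k\<close> enters through a
  component of degree at most \<open>N\<close>, which is zero.\<close>

lemma aop_vanishes:
  assumes k: "k < length xs" and v: "vanishes N (xs ! k)"
  shows "vanishes N (aop p xs)"
  unfolding vanishes_def
proof (intro allI impI)
  fix M assume M: "M \<le> N"
  show "aop p xs M = 0"
    unfolding Fbar_op_def
  proof (rule sum.neutral, rule ballI)
    fix ns assume ns: "ns \<in> {ns. length ns = length xs \<and> sum_list ns = M \<and> 0 \<notin> set ns}"
    then have "ns ! k \<le> N" using k M member_le_sum_list[of "ns ! k" ns] by auto
    then have "map2 (\<lambda>x. x) xs ns ! k = 0" using ns k v by (simp add: vanishes_def)
    moreover have "map2 (\<lambda>x. x) xs ns ! k \<in> set (map2 (\<lambda>x. x) xs ns)"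
      using ns k by (intro nth_mem) simp
    ultimately show "F_op P sV p ns (map2 (\<lambda>x. x) xs ns) = 0"
      unfolding F_op_def by (intro mlext_zero) simp
  qed
qed

lemma contin_aop:
  assumes "k < length xs"
  shows "contin (\<lambda>a. aop p (xs[k := a]))"
proof (rule continI)
  show "aop p (xs[k := x + y]) = aop p (xs[k := x]) + aop p (xs[k := y])" for x y
    by (rule aop_add[OF assms])
  show "vanishes N (aop p (xs[k := x]))" if "vanishes N x" for N x
    using aop_vanishes[of k "xs[k := x]" N p] assms that by simp
qed

lemma aop_in_Fbar:
  assumes p: "p \<in> ar P (length xs)" and xs: "set xs \<subseteq> F"
  shows "aop p xs \<in> F"
proof (rule FbarI)
  have F: "F_op P sV p ns (map2 (\<lambda>x. x) xs ns) \<in> F_deg P sV (sum_list ns)"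
    if "length ns = length xs" "0 \<notin> set ns" for ns
    by (rule F_op_in_F_deg[OF _ parts_in_F_deg[OF xs that]]) (simp add: p that)
  show "aop p xs n \<in> F_deg P sV n" for n
    unfolding Fbar_op_def using F by (intro free.subspace_sum[OF subspace_F_deg]) auto
  \<comment> \<open>Positive arities with sum 0 form the empty list. Then \<open>p\<close> has arity
    0, hence is 0, and it is this assumption on P that keeps degree 0 empty.\<close>
  have "F_op P sV p ns (map2 (\<lambda>x. x) xs ns) = 0"
    if ns: "length ns = length xs" "sum_list ns = 0" "0 \<notin> set ns" for ns
  proof -
    have "ns = []" using ns(2,3) by (cases ns) auto
    then have "p = 0" "xs = []" using p ar_0 ns(1) by auto
    moreover have "dot P sV 0 (scl P 0 0) (word sV []) = fscale 0 (dot P sV 0 0 (word sV []))"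
      using ar_0 word_in_tpow[of sV "[]"] by (intro dot_scale_left) auto
    ultimately show ?thesis using \<open>ns = []\<close> by (simp add: F_op_def fcomp_def)
  qed
  then show "aop p xs 0 = 0" unfolding Fbar_op_def by (intro sum.neutral) auto
qed

text \<open>Any other list of arities asks some argument for a component outside its degree, so a
  factor of the multilinear expression is zero.\<close>

lemma aop_hom_deg:
  assumes "length us = length ns" "0 \<notin> set ns"
  shows "aop p (map2 hom_deg ns us) = hom_deg (sum_list ns) (F_op P sV p ns us)"
proof
  fix N :: nat
  let ?A = "{ms. length ms = length ns \<and> sum_list ms = N \<and> 0 \<notin> set ms}"
  let ?f = "\<lambda>ms. F_op P sV p ms (map2 (\<lambda>x. x) (map2 hom_deg ns us) ms)"
  have aop: "aop p (map2 hom_deg ns us) N = sum ?f ?A"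
    using assms by (simp add: Fbar_op_def)
  have 0: "?f ms = 0" if "ms \<noteq> ns" "length ms = length ns" for ms
  proof -
    obtain i where i: "i < length ns" "ms ! i \<noteq> ns ! i"
      using \<open>ms \<noteq> ns\<close> \<open>length ms = length ns\<close> by (metis nth_equalityI)
    then have "map2 (\<lambda>x. x) (map2 hom_deg ns us) ms ! i = 0"
      using assms(1) \<open>length ms = length ns\<close> by (simp add: hom_deg_def)
    moreover have "map2 (\<lambda>x. x) (map2 hom_deg ns us) ms ! i \<in> set (map2 (\<lambda>x. x) (map2 hom_deg ns us) ms)"
      using assms(1) \<open>length ms = length ns\<close> i by (intro nth_mem) simp
    ultimately show ?thesis
      unfolding F_op_def by (intro mlext_zero) simp
  qed
  have "map2 (\<lambda>x. x) (map2 hom_deg ns us) ns = us"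
    using assms(1) by (intro nth_equalityI) (simp_all add: hom_deg_def)
  then have ns: "?f ns = F_op P sV p ns us" by simp
  show "aop p (map2 hom_deg ns us) N = hom_deg (sum_list ns) (F_op P sV p ns us) N"
  proof (cases "sum_list ns = N")
    case True
    have "sum ?f {ns} = sum ?f ?A"
      using True assms(2) 0 by (intro sum.mono_neutral_left finite_arities) auto
    then show ?thesis using True ns aop by (simp add: hom_deg_def)
  next
    case False
    then have "sum ?f ?A = 0" by (intro sum.neutral ballI 0) auto
    then show ?thesis using False aop by (simp add: hom_deg_def)
  qed
qed

abbreviation hmons :: "('p \<times> 'v list) list \<Rightarrow> (nat \<Rightarrow> ('p \<times> ('v list \<Rightarrow>\<^sub>0 'k) \<Rightarrow>\<^sub>0 'k)) list" where
  "hmons \<equiv> map (\<lambda>(q, xs). hmon q xs)"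

lemma aop_hmons:
  assumes ps: "\<And>q xs. (q, xs) \<in> set ps \<Longrightarrow> q \<in> ar P (length xs) \<and> xs \<noteq> []"
    and p: "p \<in> ar P (length ps)"
  shows "aop p (hmons ps) = hmon (fcomp P p (map (length \<circ> snd) ps) (map fst ps)) (concat (map snd ps))"
proof -
  let ?ns = "map (length \<circ> snd) ps" and ?l = "map (\<lambda>(q, xs). (q, word sV xs)) ps"
  have good: "good ?ns ?l"
    unfolding list_all2_conv_all_nth
  proof (intro conjI allI impI)
    fix i assume "i < length ?ns"
    then have i: "i < length ps" by simp
    obtain q xs where qx: "ps ! i = (q, xs)" by (cases "ps ! i")
    then have "q \<in> ar P (length xs) \<and> xs \<noteq> []" using ps[of q xs] nth_mem[OF i] by simp
    then show "0 < ?ns ! i" "fst (?l ! i) \<in> ar P (?ns ! i)" "snd (?l ! i) \<in> tpow sV (?ns ! i)"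
      using i qx word_in_tpow[of sV xs] by auto
  qed simp
  have 1: "hmons ps = map2 hom_deg ?ns (map2 (\<lambda>n l. dot P sV n (fst l) (snd l)) ?ns ?l)"
    by (intro nth_equalityI) (auto simp: hmon_def split: prod.split)
  have 0: "0 \<notin> set ?ns" using ps by force
  have fst: "map fst ?l = map fst ps" by (auto split: prod.split)
  have snd: "tprod sV (map snd ?l) = word sV (concat (map snd ps))"
    using tprod_words[of sV "map snd ps"] by (simp add: comp_def case_prod_beta)
  have p': "p \<in> ar P (length ?ns)" using p by simp
  have len: "length (map2 (\<lambda>n l. dot P sV n (fst l) (snd l)) ?ns ?l) = length ?ns" by simp
  have N: "sum_list ?ns = length (concat (map snd ps))" by (simp add: length_concat comp_def)
  show ?thesis
    unfolding 1 aop_hom_deg[OF len 0] F_op_dots[OF good p'] fst snd N by (simp only: hmon_def)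
qed

lemma hmon_eq_aop:
  assumes "q \<in> ar P (length xs)"
  shows "hmon q xs = aop q (map (emb P sV) xs)"
proof -
  let ?ps = "map (\<lambda>v. (opunit P, [v])) xs"
  have 1: "hmons ?ps = map (emb P sV) xs" by (simp add: emb_eq_hmon)
  have 2: "map (length \<circ> snd) ?ps = replicate (length xs) 1" "map fst ?ps = replicate (length xs) (opunit P)"
    by (simp_all add: comp_def map_replicate_const)
  have 3: "concat (map snd ?ps) = xs" by (induction xs) auto
  have "aop q (hmons ?ps) = hmon (fcomp P q (map (length \<circ> snd) ?ps) (map fst ?ps)) (concat (map snd ?ps))"
    using assms unit_ar by (intro aop_hmons) auto
  then show ?thesis by (simp only: 1 2 3 fcomp_units[OF assms])
qed

lemma aop_circ_hmons:
  assumes ps: "\<And>q xs. (q, xs) \<in> set (as @ bs @ cs) \<Longrightarrow> q \<in> ar P (length xs) \<and> xs \<noteq> []"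
    and p: "p \<in> ar P (length as + 1 + length cs)" and q: "q \<in> ar P (length bs)" "bs \<noteq> []"
  shows "aop (circ P (length as + 1 + length cs) (length bs) (length as) p q) (hmons as @ hmons bs @ hmons cs) =
    aop p (hmons as @ aop q (hmons bs) # hmons cs)"
proof -
  let ?n = "map (length \<circ> snd)" and ?q = "map fst" and ?x = "\<lambda>ps. concat (map snd ps)"
  have fam: "fam (?n ps) (?q ps)" if "set ps \<subseteq> set (as @ bs @ cs)" for ps
    unfolding list_all2_conv_all_nth
  proof (intro conjI allI impI)
    fix i assume "i < length (?n ps)"
    then have i: "i < length ps" by simp
    obtain q xs where qx: "ps ! i = (q, xs)" by (cases "ps ! i")
    then have "(q, xs) \<in> set (as @ bs @ cs)" using that nth_mem[OF i] by auto
    then have "q \<in> ar P (length xs) \<and> xs \<noteq> []" by (rule ps)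
    then show "0 < ?n ps ! i" "?q ps ! i \<in> ar P (?n ps ! i)" using i qx by auto
  qed simp
  have fb: "fcomp P q (?n bs) (?q bs) \<in> ar P (length (?x bs))"
  proof -
    have "fam (?n bs) (?q bs)" by (rule fam) auto
    from fcomp_closed[OF this] q show ?thesis by (simp add: length_concat comp_def)
  qed
  have xb: "?x bs \<noteq> []" using q(2) ps by (cases bs) (auto, force)
  have c: "circ P (length as + 1 + length cs) (length bs) (length as) p q \<in> ar P (length (as @ bs @ cs))"
    using circ_ar[of "length as" "length as + 1 + length cs" p q "length bs"] p q by (simp add: add_ac)
  have "aop (circ P (length as + 1 + length cs) (length bs) (length as) p q) (hmons (as @ bs @ cs)) =
      hmon (fcomp P p (?n as @ sum_list (?n bs) # ?n cs) (?q as @ fcomp P q (?n bs) (?q bs) # ?q cs))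
        (?x (as @ bs @ cs))"
  proof -
    have "fam (?n as) (?q as)" "fam (?n bs) (?q bs)" "fam (?n cs) (?q cs)" by (auto intro!: fam)
    from fcomp_circ[OF this] p q show ?thesis by (subst aop_hmons[OF ps c]) simp_all
  qed
  also have "\<dots> = aop p (hmons (as @ (fcomp P q (?n bs) (?q bs), ?x bs) # cs))"
  proof -
    have new: "q' \<in> ar P (length xs') \<and> xs' \<noteq> []"
      if "(q', xs') \<in> set (as @ (fcomp P q (?n bs) (?q bs), ?x bs) # cs)" for q' xs'
    proof (cases "(q', xs') = (fcomp P q (?n bs) (?q bs), ?x bs)")
      case True
      then show ?thesis using fb xb by (simp only: prod.inject simp_thms)
    next
      case False
      then show ?thesis using that ps[of q' xs'] by auto
    qed
    have "p \<in> ar P (length (as @ (fcomp P q (?n bs) (?q bs), ?x bs) # cs))" using p by simp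
    from aop_hmons[OF new this] show ?thesis by (simp add: length_concat comp_def)
  qed
  also have "hmon (fcomp P q (?n bs) (?q bs)) (?x bs) = aop q (hmons bs)"
    using ps q by (intro aop_hmons[symmetric]) auto
  then have "hmons (as @ (fcomp P q (?n bs) (?q bs), ?x bs) # cs) = hmons as @ aop q (hmons bs) # hmons cs"
    by simp
  finally show ?thesis by simp
qed

lemma set_list_update_subset: "set xs \<subseteq> F \<Longrightarrow> a \<in> F \<Longrightarrow> set (xs[k := a]) \<subseteq> F"
  using set_update_subset_insert[of xs k a] by blast

text \<open>On monomials this is associativity of full composition, \<open>fcomp_circ\<close>;
  continuity in each argument extends it. Together with the unit it makes F an algebra over P,
  stated for one partial composition because this is how the later inductions proceed.\<close>

lemma aop_circ:
  assumes p: "p \<in> ar P (length as + 1 + length cs)" and q: "q \<in> ar P (length bs)" "bs \<noteq> []"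
    and F: "set as \<subseteq> F" "set bs \<subseteq> F" "set cs \<subseteq> F"
  shows "aop (circ P (length as + 1 + length cs) (length bs) (length as) p q) (as @ bs @ cs) =
    aop p (as @ aop q bs # cs)"
proof -
  let ?la = "length as" and ?lb = "length bs" and ?lc = "length cs"
  let ?c = "circ P (?la + 1 + ?lc) ?lb ?la p q"
  \<comment> \<open>The nested expression is written as a function of one flat list, cut at fixed
    places, so that the density principle for lists applies.\<close>
  define G where "G xs = aop p (take ?la xs @ aop q (take ?lb (drop ?la xs)) # drop (?la + ?lb) xs)" for xs
  have "aop ?c xs - G xs = 0" if "set xs \<subseteq> F" "length xs = ?la + ?lb + ?lc" for xs
    using _ _ that
  proof (rule contin_list_eq_0[where \<Phi> = "\<lambda>xs. aop ?c xs - G xs"])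
    fix xs k assume xs: "set xs \<subseteq> F" "length xs = ?la + ?lb + ?lc" and k: "k < ?la + ?lb + ?lc"
    let ?m = "take ?lb (drop ?la xs)"
    let ?ys = "take ?la xs @ aop q ?m # drop (?la + ?lb) xs"
    have m: "set ?m \<subseteq> F" using xs(1) set_take_subset[of ?lb "drop ?la xs"] set_drop_subset[of ?la xs] by blast
    \<comment> \<open>The varying argument belongs to the outer operation on the left, to the inner
      operation, or to the outer one on the right. In the middle case continuity comes from
      composing two operations.\<close>
    consider "k < ?la" | "?la \<le> k" "k < ?la + ?lb" | "?la + ?lb \<le> k" by linarith
    then have "contin (\<lambda>a. G (xs[k := a]))"
    proof cases
      case 1
      then have "G (xs[k := a]) = aop p (?ys[k := a])" for a
        using xs by (simp add: G_def take_update_swap list_update_append)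
      then show ?thesis using 1 xs by (simp add: contin_aop)
    next
      case 2
      then have "G (xs[k := a]) = aop p (?ys[?la := aop q (?m[k - ?la := a])])" for a
        using xs by (simp add: G_def take_update_swap drop_update_swap list_update_append list_update_beyond)
      moreover have "contin (\<lambda>a. aop p (?ys[?la := aop q (?m[k - ?la := a])]))"
      proof (rule contin_compose[where f = "\<lambda>b. aop p (?ys[?la := b])"])
        show "contin (\<lambda>b. aop p (?ys[?la := b]))" using xs by (intro contin_aop) simp
        show "contin (\<lambda>a. aop q (?m[k - ?la := a]))" using xs 2 by (intro contin_aop) simp
        show "aop q (?m[k - ?la := a]) \<in> F" if "a \<in> F" for a
          using xs q by (intro aop_in_Fbar set_list_update_subset m that) simp
      qed
      ultimately show ?thesis by simp
    next
      case 3
      then obtain j where j: "k = ?la + ?lb + j" using le_Suc_ex by blast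
      have "G (xs[k := a]) = aop p (?ys[?la + Suc j := a])" for a
        using xs k j by (simp add: G_def drop_update_swap list_update_append)
      then show ?thesis using j xs k by (simp add: contin_aop)
    qed
    moreover have "contin (\<lambda>a. aop ?c (xs[k := a]))" using xs k by (intro contin_aop) simp
    ultimately show "contin (\<lambda>a. aop ?c (xs[k := a]) - G (xs[k := a]))" by (intro contin_diff)
  next
    fix ps :: "('p \<times> 'v list) list"
    assume ps: "length ps = ?la + ?lb + ?lc"
      "\<And>q xs. (q, xs) \<in> set ps \<Longrightarrow> q \<in> ar P (length xs) \<and> xs \<noteq> []"
    define as' where "as' = take ?la ps"
    define bs' where "bs' = take ?lb (drop ?la ps)"
    define cs' where "cs' = drop (?la + ?lb) ps"
    have ps': "ps = as' @ bs' @ cs'"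
    proof -
      have "drop (?la + ?lb) ps = drop ?lb (drop ?la ps)" by (simp add: add.commute)
      then show ?thesis unfolding as'_def bs'_def cs'_def by (simp only: append_take_drop_id)
    qed
    have len: "length as' = ?la" "length bs' = ?lb" "length cs' = ?lc"
      using ps(1) by (simp_all add: as'_def bs'_def cs'_def)
    have "G (hmons ps) = aop p (hmons as' @ aop q (hmons bs') # hmons cs')"
      by (simp add: G_def as'_def bs'_def cs'_def take_map drop_map)
    also have "\<dots> = aop ?c (hmons as' @ hmons bs' @ hmons cs')"
      using aop_circ_hmons[of as' bs' cs' p q] ps(2) p q len by (force simp: ps')
    also have "\<dots> = aop ?c (hmons ps)" by (simp add: ps')
    finally show "aop ?c (hmons ps) - G (hmons ps) = 0" by simp
  qed
  from this[of "as @ bs @ cs"] show ?thesis using F by (simp add: G_def)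
qed

section \<open>The operad of the monoid\<close>

abbreviation C where "C \<equiv> coend_operad sV"
abbreviation Q where "Q \<equiv> Q_operad P sV"

lemma coend_simps:
  "ar C n = {f. Vector_Spaces.linear sV fscale f \<and> range f \<subseteq> tpow sV n}"
  "scl C = (\<lambda>c f v. fscale c (f v))"
  "circ C m n i f g = (\<lambda>v. tapply sV i g (f v))"
  "opunit C = (\<lambda>v. word sV [v])"
  "act C n f \<sigma> = (\<lambda>v. tperm sV \<sigma> (f v))"
  by (simp_all add: coend_operad_def)

lemma Q_simps:
  "ar Q n = tensor (scl P) (scl C) (ar P n) (ar C n)"
  "circ Q m n i s t = lext (\<lambda>(a, b). lext (\<lambda>(a', b').
     pure_op P C (m + n - 1) (circ P m n i a a') (circ C m n i b b')) t) s"
  "opunit Q = pure_op P C 1 (opunit P) (opunit C)"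
  "act Q n s \<sigma> = lext (\<lambda>(a, b). pure_op P C n (act P n a \<sigma>) (act C n b \<sigma>)) s"
  by (simp_all add: tensor_operad_def)

lemma arC_linear: "f \<in> ar C n \<Longrightarrow> Vector_Spaces.linear sV fscale f"
  and arC_in_tpow: "f \<in> ar C n \<Longrightarrow> f v \<in> tpow sV n"
  by (auto simp: coend_simps)

lemma vector_space_sclC: "vector_space (scl C)"
  unfolding coend_simps
  by unfold_locales (auto simp: free.scale_right_distrib free.scale_left_distrib)

lemma sclC_apply: "scl C c f v = fscale c (f v)"
  by (simp add: coend_simps)

lemma arC_I:
  assumes "\<And>u v. f (u + v) = f u + f v" "\<And>c v. f (sV c v) = fscale c (f v)" "\<And>v. f v \<in> tpow sV n"
  shows "f \<in> ar C n"
  unfolding coend_simps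
  by (intro CollectI conjI linI V.vector_space_axioms vector_space_fscale assms) (use assms(3) in blast)

lemma subspace_arC: "module.subspace (scl C) (ar C n)"
proof -
  interpret c: vector_space "scl C" by (rule vector_space_sclC)
  note l = lin_add[OF arC_linear] lin_scale[OF arC_linear]
  show ?thesis
  proof (rule c.subspaceI)
    show "0 \<in> ar C n" by (rule arC_I) (simp_all add: free.subspace_0[OF subspace_tpow])
    show "f + g \<in> ar C n" if "f \<in> ar C n" "g \<in> ar C n" for f g
      by (rule arC_I) (simp_all add: l[OF that(1)] l[OF that(2)] free.scale_right_distrib
          free.subspace_add[OF subspace_tpow arC_in_tpow[OF that(1)] arC_in_tpow[OF that(2)]])
    show "scl C c f \<in> ar C n" if "f \<in> ar C n" for c f
      by (rule arC_I) (simp_all add: sclC_apply l[OF that] free.scale_right_distrib mult.commute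
          free.subspace_scale[OF subspace_tpow arC_in_tpow[OF that]])
  qed
qed

lemma circC_closed:
  assumes "i < m" "f \<in> ar C m" "g \<in> ar C n"
  shows "circ C m n i f g \<in> ar C (m + n - 1)"
proof (rule arC_I)
  have g: "range g \<subseteq> tpow sV n" using assms(3) by (auto simp: coend_simps)
  show "circ C m n i f g v \<in> tpow sV (m + n - 1)" for v
    using tapply_in_tpow[OF assms(1) g arC_in_tpow[OF assms(2)]] by (simp add: coend_simps)
qed (simp_all add: coend_simps(3) lin_add[OF arC_linear[OF assms(2)]] lin_scale[OF arC_linear[OF assms(2)]]
    lin_add[OF linear_tapply] lin_scale[OF linear_tapply])

lemma actC_closed: "f \<in> ar C n \<Longrightarrow> act C n f \<sigma> \<in> ar C n"
proof (rule arC_I)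
  assume f: "f \<in> ar C n"
  show "act C n f \<sigma> v \<in> tpow sV n" for v
    using tperm_in_tpow[OF arC_in_tpow[OF f]] by (simp add: coend_simps)
  show "act C n f \<sigma> (u + v) = act C n f \<sigma> u + act C n f \<sigma> v" for u v
    by (simp add: coend_simps(5) lin_add[OF arC_linear[OF f]] lin_add[OF linear_tperm])
  show "act C n f \<sigma> (sV c v) = fscale c (act C n f \<sigma> v)" for c v
    by (simp add: coend_simps(5) lin_scale[OF arC_linear[OF f]] lin_scale[OF linear_tperm])
qed

lemma unitC_in_arC: "opunit C \<in> ar C 1"
proof (rule arC_I)
  show "opunit C v \<in> tpow sV 1" for v
    using word_in_tpow[of sV "[v]"] by (simp add: coend_simps)
  show "opunit C (u + v) = opunit C u + opunit C v" "opunit C (sV c v) = fscale c (opunit C v)" for u v c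
    using word_add[of 0 "[0]" sV u v] word_scale[of 0 "[0]" sV c v] by (simp_all add: coend_simps)
qed

subsection \<open>Coinvariants\<close>

definition balancedQ :: "nat \<Rightarrow> ('p \<Rightarrow> ('v \<Rightarrow> ('v list \<Rightarrow>\<^sub>0 'k)) \<Rightarrow> ('c \<Rightarrow>\<^sub>0 'k)) \<Rightarrow> bool" where
  "balancedQ n g \<longleftrightarrow> bilin_on (scl P) (scl C) (ar P n) (ar C n) g \<and>
     (\<forall>q\<in>ar P n. \<forall>f\<in>ar C n. \<forall>\<sigma>. \<sigma> permutes {..<n} \<longrightarrow> g (act P n q \<sigma>) (act C n f \<sigma>) = g q f)"

lemma keys_Q: "s \<in> ar Q n \<Longrightarrow> Poly_Mapping.keys s \<subseteq> ar P n \<times> ar C n"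
  unfolding Q_simps by (rule keys_tensor[OF vector_space_axioms vector_space_sclC ar_subspace subspace_arC])

lemma subspace_Q: "free.subspace (ar Q n)"
  unfolding Q_simps by (rule subspace_tensor)

lemma pure_op_in_Q: "q \<in> ar P n \<Longrightarrow> f \<in> ar C n \<Longrightarrow> pure_op P C n q f \<in> ar Q n"
  unfolding Q_simps pure_op_def by (rule pure_tensor_in_tensor)

lemma bilin_pure_op: "bilin_on (scl P) (scl C) (ar P n) (ar C n) (pure_op P C n)"
  unfolding pure_op_def[abs_def] by (rule bilin_on_pure_tensor)

lemma lext_pure_op:
  "bilin_on (scl P) (scl C) (ar P n) (ar C n) g \<Longrightarrow> q \<in> ar P n \<Longrightarrow> f \<in> ar C n \<Longrightarrow>
    lext (case_prod g) (pure_op P C n q f) = g q f"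
  unfolding pure_op_def by (rule lext_pure_tensor)

lemma Q_expand: "s \<in> ar Q n \<Longrightarrow> lext (case_prod (pure_op P C n)) s = s"
  unfolding Q_simps pure_op_def[abs_def] by (rule tensor_expand)

lemma actQ_closed:
  assumes "s \<in> ar Q n" "\<sigma> permutes {..<n}" shows "act Q n s \<sigma> \<in> ar Q n"
  unfolding Q_simps(4)
  using keys_Q[OF assms(1)] assms(2)
  by (intro lext_in_subspace[OF subspace_Q]) (auto intro!: pure_op_in_Q act_ar actC_closed)

lemma bilin_actQ:
  assumes "\<sigma> permutes {..<n}"
  shows "bilin_on (scl P) (scl C) (ar P n) (ar C n) (\<lambda>a b. pure_op P C n (act P n a \<sigma>) (act C n b \<sigma>))"
proof -
  note b = bilin_on_add_left[OF bilin_pure_op] bilin_on_add_right[OF bilin_pure_op]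
    bilin_on_scale_left[OF bilin_pure_op] bilin_on_scale_right[OF bilin_pure_op]
  have c: "act C n (f + g) \<sigma> = act C n f \<sigma> + act C n g \<sigma>" "act C n (scl C c f) \<sigma> = scl C c (act C n f \<sigma>)" for f g c
    by (auto simp: coend_simps lin_add[OF linear_tperm] lin_scale[OF linear_tperm])
  show ?thesis
    by (rule bilin_onI) (use assms in \<open>simp_all add: act_add act_scale c b act_ar actC_closed\<close>)
qed

lemma actQ_pure_op:
  assumes "\<sigma> permutes {..<n}" "q \<in> ar P n" "f \<in> ar C n"
  shows "act Q n (pure_op P C n q f) \<sigma> = pure_op P C n (act P n q \<sigma>) (act C n f \<sigma>)"
  unfolding Q_simps(4) by (rule lext_pure_op[OF bilin_actQ]) (use assms in auto)

lemma lext_coinv_map: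
  assumes g: "balancedQ n g"
  shows "lext (case_prod g) (coinv_map Q n s) = lext (case_prod g) s"
  unfolding coinv_map_def
proof (rule lext_quot)
  fix r assume "r \<in> {act Q n q \<sigma> - q |q \<sigma>. q \<in> ar Q n \<and> \<sigma> permutes {..<n}}"
  then obtain s \<sigma> where r: "r = act Q n s \<sigma> - s" "s \<in> ar Q n" "\<sigma> permutes {..<n}" by blast
  have b: "bilin_on (scl P) (scl C) (ar P n) (ar C n) g" using g by (simp add: balancedQ_def)
  have "lext (case_prod g) (act Q n s \<sigma>) =
      lext (\<lambda>a. lext (case_prod g) (case a of (a, b) \<Rightarrow> pure_op P C n (act P n a \<sigma>) (act C n b \<sigma>))) s"
    unfolding Q_simps(4) by (rule lext_lext)
  also have "\<dots> = lext (case_prod g) s"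
    using keys_Q[OF r(2)] g r(3)
    by (intro lext_cong) (auto simp: lext_pure_op[OF b] act_ar actC_closed balancedQ_def)
  finally show "lext (case_prod g) r = 0" by (simp add: r(1) lext_diff)
qed

lemma linear_coinv_map: "Vector_Spaces.linear fscale fscale (coinv_map Q n)"
  unfolding coinv_map_def by (rule linear_quot_span)

lemma coinv_map_closed: "s \<in> ar Q n \<Longrightarrow> coinv_map Q n s \<in> ar Q n"
proof -
  let ?R = "{act Q n q \<sigma> - q |q \<sigma>. q \<in> ar Q n \<and> \<sigma> permutes {..<n}}"
  assume s: "s \<in> ar Q n"
  have "?R \<subseteq> ar Q n"
  proof
    fix r assume "r \<in> ?R"
    then obtain q \<sigma> where "r = act Q n q \<sigma> - q" "q \<in> ar Q n" "\<sigma> permutes {..<n}" by blast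
    then show "r \<in> ar Q n" using free.subspace_diff[OF subspace_Q actQ_closed] by simp
  qed
  then have "free.span ?R \<subseteq> ar Q n" by (rule free.span_minimal) (rule subspace_Q)
  then have "s - coinv_map Q n s \<in> ar Q n" unfolding coinv_map_def using diff_quot_in_span by blast
  from free.subspace_diff[OF subspace_Q s this] show ?thesis by simp
qed

definition cls :: "nat \<Rightarrow> 'p \<Rightarrow> ('v \<Rightarrow> ('v list \<Rightarrow>\<^sub>0 'k)) \<Rightarrow> _" where
  "cls n q f = coinv_map Q n (pure_op P C n q f)"

lemma coinv_in_Q: "y \<in> coinv Q n \<Longrightarrow> y \<in> ar Q n"
  by (auto simp: coinv_def coinv_map_closed)

lemmas keys_coinv = keys_Q[OF coinv_in_Q]

lemma coinv_expand:
  assumes "y \<in> coinv Q n" shows "lext (case_prod (cls n)) y = y"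
proof -
  have "coinv_map Q n y = y" using assms by (auto simp: coinv_def coinv_map_def quot_span_idem)
  moreover have "coinv_map Q n (lext (case_prod (pure_op P C n)) y) = lext (case_prod (cls n)) y"
    unfolding lin_lext[OF linear_coinv_map] by (rule lext_cong) (auto simp: cls_def)
  ultimately show ?thesis by (simp add: Q_expand[OF coinv_in_Q[OF assms]])
qed

lemma coinv_mapI: "s \<in> ar Q n \<Longrightarrow> coinv_map Q n s \<in> coinv Q n"
  by (simp add: coinv_def)

lemma subspace_coinv: "free.subspace (coinv Q n)"
proof -
  interpret l: Vector_Spaces.linear fscale fscale "coinv_map Q n" by (rule linear_coinv_map)
  show ?thesis unfolding coinv_def by (rule l.subspace_image[OF subspace_Q])
qed

lemma cls_in_coinv: "q \<in> ar P n \<Longrightarrow> f \<in> ar C n \<Longrightarrow> cls n q f \<in> coinv Q n"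
  unfolding cls_def by (intro coinv_mapI pure_op_in_Q)

lemma bilin_cls: "bilin_on (scl P) (scl C) (ar P n) (ar C n) (cls n)"
  unfolding cls_def[abs_def] by (rule bilin_on_linear[OF linear_coinv_map bilin_pure_op])

lemma cls_act:
  assumes "\<sigma> permutes {..<n}" "q \<in> ar P n" "f \<in> ar C n"
  shows "cls n (act P n q \<sigma>) (act C n f \<sigma>) = cls n q f"
proof -
  have "act Q n (pure_op P C n q f) \<sigma> - pure_op P C n q f
      \<in> {act Q n q \<sigma> - q |q \<sigma>. q \<in> ar Q n \<and> \<sigma> permutes {..<n}}"
    using assms pure_op_in_Q by blast
  from free.span_base[OF this] show ?thesis
    unfolding cls_def coinv_map_def actQ_pure_op[OF assms, symmetric] by (rule quot_span_eqI)
qed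

subsection \<open>Coinvariants as linear maps\<close>

text \<open>The degree n part of v \<mapsto> y(v), defined on all of Q(n) and not just on classes.
  Composites can thus be evaluated before they are projected to coinvariants.\<close>

definition ev :: "nat \<Rightarrow> ('p \<times> ('v \<Rightarrow> ('v list \<Rightarrow>\<^sub>0 'k)) \<Rightarrow>\<^sub>0 'k) \<Rightarrow> 'v \<Rightarrow> ('p \<times> ('v list \<Rightarrow>\<^sub>0 'k) \<Rightarrow>\<^sub>0 'k)" where
  "ev n s v = lext (\<lambda>(q, f). dot P sV n q (f v)) s"

lemma balancedQ_ev: "balancedQ n (\<lambda>q f. dot P sV n q (f v))"
  unfolding balancedQ_def
proof (intro conjI ballI allI impI)
  show "bilin_on (scl P) (scl C) (ar P n) (ar C n) (\<lambda>q f. dot P sV n q (f v))"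
    by (rule bilin_onI) (simp_all add: arC_in_tpow sclC_apply dot_add_left dot_add_right dot_scale_left dot_scale_right)
qed (simp add: coend_simps(5) dot_act arC_in_tpow)

lemma linear_ev: "Vector_Spaces.linear fscale fscale (\<lambda>s. ev n s v)"
  unfolding ev_def by (rule linear_lext)

lemma ev_coinv_map: "ev n (coinv_map Q n s) v = ev n s v"
  unfolding ev_def by (rule lext_coinv_map[OF balancedQ_ev])

lemma ev_pure_op: "q \<in> ar P n \<Longrightarrow> f \<in> ar C n \<Longrightarrow> ev n (pure_op P C n q f) v = dot P sV n q (f v)"
  unfolding ev_def by (rule lext_pure_op) (use balancedQ_ev in \<open>simp_all add: balancedQ_def\<close>)

lemma ev_cls: "q \<in> ar P n \<Longrightarrow> f \<in> ar C n \<Longrightarrow> ev n (cls n q f) v = dot P sV n q (f v)"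
  unfolding cls_def by (simp add: ev_coinv_map ev_pure_op)

lemma ev_in_F_deg: "s \<in> ar Q n \<Longrightarrow> ev n s v \<in> F_deg P sV n"
  unfolding ev_def
  by (rule lext_in_subspace[OF subspace_F_deg]) (auto intro!: dot_in_F_deg dest!: subsetD[OF keys_Q] arC_in_tpow)

lemma ev_add:
  assumes "s \<in> ar Q n" shows "ev n s (u + v) = ev n s u + ev n s v"
proof -
  have "ev n s (u + v) = lext (\<lambda>a. (case a of (q, f) \<Rightarrow> dot P sV n q (f u)) + (case a of (q, f) \<Rightarrow> dot P sV n q (f v))) s"
    unfolding ev_def using keys_Q[OF assms]
    by (intro lext_cong) (auto simp: lin_add[OF arC_linear] arC_in_tpow dot_add_right)
  then show ?thesis unfolding ev_def lext_fun_add .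
qed

lemma ev_scale:
  assumes "s \<in> ar Q n" shows "ev n s (sV c v) = fscale c (ev n s v)"
proof -
  have "ev n s (sV c v) = lext (\<lambda>a. fscale c (case a of (q, f) \<Rightarrow> dot P sV n q (f v))) s"
    unfolding ev_def using keys_Q[OF assms]
    by (intro lext_cong) (auto simp: lin_scale[OF arC_linear] arC_in_tpow dot_scale_right)
  then show ?thesis unfolding ev_def lext_fun_scale .
qed

text \<open>Tensoring with a linear form \<open>l\<close>; for \<open>l\<close> in a dual basis, these maps assemble to an inverse
  of \<open>ev\<close>.\<close>

definition tens :: "nat \<Rightarrow> ('v \<Rightarrow> 'k) \<Rightarrow> ('p \<times> ('v list \<Rightarrow>\<^sub>0 'k) \<Rightarrow>\<^sub>0 'k) \<Rightarrow> ('p \<times> ('v \<Rightarrow> ('v list \<Rightarrow>\<^sub>0 'k)) \<Rightarrow>\<^sub>0 'k)" where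
  "tens n l u = lext (\<lambda>(q, t). cls n q (\<lambda>v. fscale (l v) t)) u"

lemma linear_tens: "Vector_Spaces.linear fscale fscale (tens n l)"
  unfolding tens_def by (rule linear_lext)

lemma form_in_arC:
  assumes l: "\<And>u v. l (u + v) = l u + l v" "\<And>c v. l (sV c v) = c * l v" and t: "t \<in> tpow sV n"
  shows "(\<lambda>v. fscale (l v) t) \<in> ar C n"
  by (rule arC_I) (simp_all add: l free.scale_left_distrib free.subspace_scale[OF subspace_tpow t])

lemma tens_dot:
  assumes l: "\<And>u v. l (u + v) = l u + l v" "\<And>c v. l (sV c v) = c * l v"
    and "q \<in> ar P n" "t \<in> tpow sV n"
  shows "tens n l (dot P sV n q t) = cls n q (\<lambda>v. fscale (l v) t)"
  unfolding tens_def
proof (rule lext_dot)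
  note f = form_in_arC[OF l]
  note b = bilin_on_add_left[OF bilin_cls] bilin_on_add_right[OF bilin_cls]
    bilin_on_scale_left[OF bilin_cls] bilin_on_scale_right[OF bilin_cls]
  show "balanced n (\<lambda>q t. cls n q (\<lambda>v. fscale (l v) t))"
    unfolding balanced_def
  proof (intro conjI ballI allI impI)
    have 1: "(\<lambda>v. fscale (l v) (t + t')) = (\<lambda>v. fscale (l v) t) + (\<lambda>v. fscale (l v) t')" for t t' :: "'v list \<Rightarrow>\<^sub>0 'k"
      by (auto simp: free.scale_right_distrib)
    have 2: "(\<lambda>v. fscale (l v) (fscale c t)) = scl C c (\<lambda>v. fscale (l v) t)" for c and t :: "'v list \<Rightarrow>\<^sub>0 'k"
      by (auto simp: sclC_apply mult.commute)
    show "bilin_on (scl P) fscale (ar P n) (tpow sV n) (\<lambda>q t. cls n q (\<lambda>v. fscale (l v) t))"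
      by (rule bilin_onI) (simp_all only: 1 2 b f)
    fix q t \<sigma> assume a: "q \<in> ar P n" "t \<in> tpow sV n" "\<sigma> permutes {..<n}"
    have "(\<lambda>v. fscale (l v) (tperm sV \<sigma> t)) = act C n (\<lambda>v. fscale (l v) t) \<sigma>"
      by (simp add: coend_simps(5) lin_scale[OF linear_tperm])
    then show "cls n (act P n q \<sigma>) (\<lambda>v. fscale (l v) (tperm sV \<sigma> t)) = cls n q (\<lambda>v. fscale (l v) t)"
      using a f by (simp only: cls_act)
  qed
qed fact+

lemma tens_in_coinv:
  assumes l: "\<And>u v. l (u + v) = l u + l v" "\<And>c v. l (sV c v) = c * l v" and u: "u \<in> F_deg P sV n"
  shows "tens n l u \<in> coinv Q n"
  unfolding tens_def using keys_F_deg[OF u]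
  by (intro lext_in_subspace[OF subspace_coinv]) (auto intro!: cls_in_coinv form_in_arC l)

lemma ev_tens:
  assumes l: "\<And>u v. l (u + v) = l u + l v" "\<And>c v. l (sV c v) = c * l v" and u: "u \<in> F_deg P sV n"
  shows "ev n (tens n l u) v = fscale (l v) u"
proof -
  have "ev n (tens n l u) v = lext (\<lambda>a. ev n (case a of (q, t) \<Rightarrow> cls n q (\<lambda>v. fscale (l v) t)) v) u"
    unfolding tens_def by (rule lin_lext[OF linear_ev])
  also have "\<dots> = lext (\<lambda>a. fscale (l v) (case_prod (dot P sV n) a)) u"
    using keys_F_deg[OF u]
    by (intro lext_cong) (auto simp: ev_cls form_in_arC[OF l] dot_scale_right)
  finally show ?thesis by (simp add: lext_fun_scale F_deg_expand[OF u])
qed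

end

section \<open>Coinvariants against linear maps on a finite-dimensional V\<close>

locale fd_free_algebra = free_algebra P sV
  for P :: "('k::field, 'p::ab_group_add) operad_data"
    and sV :: "'k \<Rightarrow> 'v::ab_group_add \<Rightarrow> 'v" +
  assumes fin_dim_V: "fin_dim sV UNIV"
begin

text \<open>The forms are the coordinates in a basis extracted from a finite spanning set. Finite
  dimension enters the argument through the resulting finite expansion of every vector.\<close>

lemma dual_basis:
  obtains B and l :: "'v \<Rightarrow> 'v \<Rightarrow> 'k" where "finite B"
    "\<forall>b u v. l b (u + v) = l b u + l b v" "\<forall>b c v. l b (sV c v) = c * l b v"
    "\<forall>v. (\<Sum>b\<in>B. sV (l b v) b) = v"
proof -
  obtain S where S: "finite S" "UNIV \<subseteq> V.span S" using fin_dim_V by (auto simp: fin_dim_def)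
  obtain B where B: "B \<subseteq> S" "V.independent B" "S \<subseteq> V.span B"
    by (rule V.maximal_independent_subset)
  have "V.span S \<subseteq> V.span B" by (rule V.span_minimal[OF B(3) V.subspace_span])
  then have span: "v \<in> V.span B" for v using S(2) by blast
  have fin: "finite B" using B(1) S(1) by (rule finite_subset)
  show thesis
  proof (rule that[of B "\<lambda>b v. V.representation B v b"])
    show "\<forall>v. (\<Sum>b\<in>B. sV (V.representation B v b) b) = v"
      by (intro allI V.sum_representation_eq[OF B(2) span fin]) simp
  qed (simp_all add: fin V.representation_add[OF B(2) span span] V.representation_scale[OF B(2) span])
qed

text \<open>The witness is the sum over the basis of Y(b) tensored with the coordinate form of b;
  evaluating it at v gives the expansion of Y(v).\<close>

lemma ev_surj:
  assumes Y: "\<And>u v. Y (u + v) = Y u + Y v" "\<And>c v. Y (sV c v) = fscale c (Y v)" "\<And>v. Y v \<in> F_deg P sV n"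
  obtains y where "y \<in> coinv Q n" "ev n y = Y"
proof -
  obtain B and l :: "'v \<Rightarrow> 'v \<Rightarrow> 'k" where B: "finite B" and l':
    "\<forall>b u v. l b (u + v) = l b u + l b v" "\<forall>b c v. l b (sV c v) = c * l b v"
    and e: "\<forall>v. (\<Sum>b\<in>B. sV (l b v) b) = v"
    by (rule dual_basis)
  note l = l'(1)[rule_format] l'(2)[rule_format]
  have Y': "Vector_Spaces.linear sV fscale Y"
    by (rule linI) (simp_all add: V.vector_space_axioms vector_space_fscale Y)
  show thesis
  proof (rule that)
    show "(\<Sum>b\<in>B. tens n (l b) (Y b)) \<in> coinv Q n"
      by (intro free.subspace_sum[OF subspace_coinv] tens_in_coinv l Y(3))
    show "ev n (\<Sum>b\<in>B. tens n (l b) (Y b)) = Y"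
    proof
      fix v
      have "ev n (\<Sum>b\<in>B. tens n (l b) (Y b)) v = (\<Sum>b\<in>B. fscale (l b v) (Y b))"
        by (simp add: lin_sum[OF linear_ev] ev_tens[OF l Y(3)])
      also have "\<dots> = Y (\<Sum>b\<in>B. sV (l b v) b)"
        by (simp add: lin_sum[OF Y'] lin_scale[OF Y'])
      finally show "ev n (\<Sum>b\<in>B. tens n (l b) (Y b)) v = Y v" by (simp add: e)
    qed
  qed
qed

text \<open>Tensoring the values y(b) with the coordinate forms recovers \<open>y\<close>: on a
  class of q and f this is the expansion of the map f along the basis, by linearity of the class in
  f.\<close>

lemma ev_inj:
  assumes y: "y \<in> coinv Q n" and 0: "\<And>v. ev n y v = 0"
  shows "y = 0"
proof -
  obtain B and l :: "'v \<Rightarrow> 'v \<Rightarrow> 'k" where B: "finite B" and l':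
    "\<forall>b u v. l b (u + v) = l b u + l b v" "\<forall>b c v. l b (sV c v) = c * l b v"
    and e: "\<forall>v. (\<Sum>b\<in>B. sV (l b v) b) = v"
    by (rule dual_basis)
  note l = l'(1)[rule_format] l'(2)[rule_format]
  have cls: "(\<Sum>b\<in>B. cls n q (\<lambda>v. fscale (l b v) (f b))) = cls n q f" if qf: "q \<in> ar P n" "f \<in> ar C n" for q f
  proof -
    have "(\<Sum>b\<in>B. cls n q (\<lambda>v. fscale (l b v) (f b))) = cls n q (\<Sum>b\<in>B. (\<lambda>v. fscale (l b v) (f b)))"
      using qf by (intro bilin_on_sum_right[OF bilin_cls vector_space_sclC subspace_arC, symmetric] form_in_arC l arC_in_tpow)
    also have "(\<Sum>b\<in>B. (\<lambda>v. fscale (l b v) (f b))) = f"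
    proof
      fix v
      have "(\<Sum>b\<in>B. (\<lambda>v. fscale (l b v) (f b))) v = (\<Sum>b\<in>B. fscale (l b v) (f b))"
        by (induction B rule: infinite_finite_induct) auto
      also have "\<dots> = f (\<Sum>b\<in>B. sV (l b v) b)"
        by (simp add: lin_sum[OF arC_linear[OF qf(2)]] lin_scale[OF arC_linear[OF qf(2)]])
      finally show "(\<Sum>b\<in>B. (\<lambda>v. fscale (l b v) (f b))) v = f v" by (simp add: e)
    qed
    finally show ?thesis .
  qed
  have "tens n (l b) (ev n y b) = lext (\<lambda>(q, f). cls n q (\<lambda>v. fscale (l b v) (f b))) y" for b
    unfolding ev_def lin_lext[OF linear_tens] using keys_coinv[OF y]
    by (intro lext_cong) (auto simp: tens_dot[OF l] arC_in_tpow)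
  then have "(\<Sum>b\<in>B. tens n (l b) (ev n y b)) =
      lext (\<lambda>a. \<Sum>b\<in>B. (case a of (q, f) \<Rightarrow> cls n q (\<lambda>v. fscale (l b v) (f b)))) y"
    by (simp add: lext_fun_sum)
  also have "\<dots> = lext (case_prod (cls n)) y"
    using keys_coinv[OF y] by (intro lext_cong) (auto simp: cls)
  finally show ?thesis by (simp add: coinv_expand[OF y] 0 lin_0[OF linear_tens])
qed

end

section \<open>Finite sums over positions of a list\<close>

lemma sum_fun_apply: "(\<Sum>i\<in>I. f i) x = (\<Sum>i\<in>I. f i x)"
  by (induction I rule: infinite_finite_induct) auto

lemma additive_sum:
  fixes f :: "'a::ab_group_add \<Rightarrow> 'b::ab_group_add"
  assumes "\<And>a b. f (a + b) = f a + f b"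
  shows "f (sum g I) = (\<Sum>i\<in>I. f (g i))"
proof -
  have "f 0 = 0" using assms[of 0 0] by simp
  then show ?thesis by (induction I rule: infinite_finite_induct) (simp_all add: assms)
qed

lemma sum_lessThan_add: "(\<Sum>i<m + n. f i) = (\<Sum>i<m. f i) + (\<Sum>i<n. f (m + i))"
  for f :: "nat \<Rightarrow> 'a::comm_monoid_add"
  by (induction n) (simp_all add: add.assoc)

text \<open>The shape of a Leibniz rule: a sum over the positions of a concatenation splits into the
  sums over its parts.\<close>

lemma sum_update_append:
  fixes f :: "'a list \<Rightarrow> 'b::comm_monoid_add"
  shows "(\<Sum>i<length (as @ bs). f ((as @ bs)[i := g ((as @ bs) ! i)])) =
    (\<Sum>i<length as. f (as[i := g (as ! i)] @ bs)) + (\<Sum>i<length bs. f (as @ bs[i := g (bs ! i)]))"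
  by (simp add: sum_lessThan_add list_update_append nth_append)

lemma sum_update_Cons:
  fixes f :: "'a list \<Rightarrow> 'b::comm_monoid_add"
  shows "(\<Sum>i<length (a # as). f ((a # as)[i := g ((a # as) ! i)])) =
    f (g a # as) + (\<Sum>i<length as. f (a # as[i := g (as ! i)]))"
  by (simp add: sum.lessThan_Suc_shift del: sum.lessThan_Suc)

context free_algebra
begin

section \<open>The infinitesimal action\<close>

abbreviation M where "M \<equiv> carrier (MD Q)"

lemma M_iff: "y \<in> M \<longleftrightarrow> y 0 = 0 \<and> (\<forall>n\<ge>1. y n \<in> coinv Q n)"
  by (simp add: MD_def)

lemma M_deg: "y \<in> M \<Longrightarrow> 0 < n \<Longrightarrow> y n \<in> coinv Q n"
  by (simp add: M_iff)

definition eval :: "(nat \<Rightarrow> ('p \<times> ('v \<Rightarrow> ('v list \<Rightarrow>\<^sub>0 'k)) \<Rightarrow>\<^sub>0 'k)) \<Rightarrow> 'v \<Rightarrow> nat \<Rightarrow> ('p \<times> ('v list \<Rightarrow>\<^sub>0 'k) \<Rightarrow>\<^sub>0 'k)" where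
  "eval y v = (\<lambda>n. ev n (y n) v)"

lemma eval_in_Fbar: "y \<in> M \<Longrightarrow> eval y v \<in> F"
proof (rule FbarI)
  assume y: "y \<in> M"
  then show "eval y v 0 = 0" by (simp add: eval_def M_iff lin_0[OF linear_ev])
  show "eval y v n \<in> F_deg P sV n" if "0 < n" for n
    unfolding eval_def by (intro ev_in_F_deg coinv_in_Q M_deg y that)
qed

lemma balanced_lext:
  assumes "\<And>a. a \<in> Poly_Mapping.keys y \<Longrightarrow> balanced m (g a)"
  shows "balanced m (\<lambda>p t. lext (\<lambda>a. g a p t) y)"
  unfolding balanced_def
proof (intro conjI ballI allI impI)
  have b: "bilin_on (scl P) fscale (ar P m) (tpow sV m) (g a)" if "a \<in> Poly_Mapping.keys y" for a
    using assms[OF that] by (simp add: balanced_def)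
  show "bilin_on (scl P) fscale (ar P m) (tpow sV m) (\<lambda>p t. lext (\<lambda>a. g a p t) y)"
    by (rule bilin_onI)
      (simp_all flip: lext_fun_add lext_fun_scale,
        (intro lext_cong, simp add: bilin_on_add_left[OF b] bilin_on_add_right[OF b]
          bilin_on_scale_left[OF b] bilin_on_scale_right[OF b])+)
  fix p t \<sigma> assume "p \<in> ar P m" "t \<in> tpow sV m" "\<sigma> permutes {..<m}"
  then show "lext (\<lambda>a. g a (act P m p \<sigma>) (tperm sV \<sigma> t)) y = lext (\<lambda>a. g a p t) y"
    using assms by (intro lext_cong) (simp add: balanced_def)
qed

text \<open>A single insertion at \<open>i\<close> is not invariant. After permuting by \<sigma> it
  becomes, up to a block permutation absorbed by \<open>dot\<close>, the insertion at
  \<open>\<sigma> i\<close>; hence the sum over all positions is merely reindexed.\<close>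

lemma balanced_insert:
  assumes q: "q \<in> ar P n" and f: "f \<in> ar C n"
  shows "balanced m (\<lambda>p t. \<Sum>i<m. dot P sV (m + n - 1) (circ P m n i p q) (tapply sV i f t))"
  unfolding balanced_def
proof (intro conjI ballI allI impI)
  have f': "Vector_Spaces.linear sV fscale f" "range f \<subseteq> tpow sV n"
    using f by (auto simp: coend_simps)
  have c: "circ P m n i p q \<in> ar P (m + n - 1)" if "i < m" "p \<in> ar P m" for i p
    using that q by (intro circ_ar)
  have t: "tapply sV i f t \<in> tpow sV (m + n - 1)" if "i < m" "t \<in> tpow sV m" for i t
    using that by (intro tapply_in_tpow f'(2))
  show "bilin_on (scl P) fscale (ar P m) (tpow sV m)
      (\<lambda>p t. \<Sum>i<m. dot P sV (m + n - 1) (circ P m n i p q) (tapply sV i f t))"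
    by (rule bilin_onI; simp only: sum.distrib[symmetric] free.scale_sum_right; intro sum.cong refl;
        simp del: One_nat_def add: circ_add_left circ_scale_left q lin_add[OF linear_tapply]
          lin_scale[OF linear_tapply] c t dot_add_left dot_add_right dot_scale_left dot_scale_right)
  fix p s \<sigma> assume p: "p \<in> ar P m" and s: "s \<in> tpow sV m" and \<sigma>: "\<sigma> permutes {..<m}"
  have \<sigma>i: "\<sigma> i < m" if "i < m" for i using permutes_in_image[OF \<sigma>, of i] that by simp
  have "(\<Sum>i<m. dot P sV (m + n - 1) (circ P m n i (act P m p \<sigma>) q) (tapply sV i f (tperm sV \<sigma> s))) =
      (\<Sum>i<m. dot P sV (m + n - 1) (circ P m n (\<sigma> i) p q) (tapply sV (\<sigma> i) f s))"
  proof (rule sum.cong[OF refl])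
    fix i assume "i \<in> {..<m}"
    then have i: "i < m" by simp
    have "circ P m n i (act P m p \<sigma>) q = circ P m n i (act P m p \<sigma>) (act P n q id)"
      by (simp only: act_id[OF q])
    also have "\<dots> = act P (m + n - 1) (circ P m n (\<sigma> i) p q) (perm_circ m n i \<sigma> id)"
      by (rule circ_act[OF i \<sigma> permutes_id p q])
    finally show "dot P sV (m + n - 1) (circ P m n i (act P m p \<sigma>) q) (tapply sV i f (tperm sV \<sigma> s)) =
        dot P sV (m + n - 1) (circ P m n (\<sigma> i) p q) (tapply sV (\<sigma> i) f s)"
      by (simp only: tapply_tperm[OF f' \<sigma> i s]
          dot_act[OF c[OF \<sigma>i[OF i] p] t[OF \<sigma>i[OF i] s] perm_circ_permutes[OF \<sigma> permutes_id i]])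
  qed
  also have "\<dots> = (\<Sum>i<m. dot P sV (m + n - 1) (circ P m n i p q) (tapply sV i f s))"
    by (rule sum.permute[OF \<sigma>, symmetric, unfolded comp_def])
  finally show "(\<Sum>i<m. dot P sV (m + n - 1) (circ P m n i (act P m p \<sigma>) q) (tapply sV i f (tperm sV \<sigma> s))) =
      (\<Sum>i<m. dot P sV (m + n - 1) (circ P m n i p q) (tapply sV i f s))" .
qed

lemma insert_F_dot:
  assumes y: "y \<in> ar Q n" and p: "p \<in> ar P m" and t: "t \<in> tpow sV m"
  shows "insert_F P sV m n (dot P sV m p t) y =
    lext (\<lambda>(q, f). \<Sum>i<m. dot P sV (m + n - 1) (circ P m n i p q) (tapply sV i f t)) y"
  unfolding insert_F_def
proof (rule lext_dot[OF _ p t])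
  show "balanced m (\<lambda>p t. lext (\<lambda>(q, f). \<Sum>i<m. dot P sV (m + n - 1) (circ P m n i p q) (tapply sV i f t)) y)"
  proof (rule balanced_lext)
    fix a assume "a \<in> Poly_Mapping.keys y"
    then obtain q f where "a = (q, f)" "q \<in> ar P n" "f \<in> ar C n" using keys_Q[OF y] by auto
    then show "balanced m (\<lambda>p t. case a of (q, f) \<Rightarrow>
        \<Sum>i<m. dot P sV (m + n - 1) (circ P m n i p q) (tapply sV i f t))"
      by (simp only: prod.case balanced_insert)
  qed
qed

lemma linear_insert_F: "Vector_Spaces.linear fscale fscale (\<lambda>z. insert_F P sV m n z y)"
  unfolding insert_F_def by (rule linear_lext)

lemma insert_F_in_F_deg:
  assumes y: "y \<in> ar Q n" and z: "z \<in> F_deg P sV m"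
  shows "insert_F P sV m n z y \<in> F_deg P sV (m + n - 1)"
  unfolding insert_F_def
proof (rule lext_in_subspace[OF subspace_F_deg], split prod.split, intro allI impI, rule lext_in_subspace[OF subspace_F_deg], split prod.split, intro allI impI free.subspace_sum[OF subspace_F_deg])
  fix a p t b q f i
  assume "a \<in> Poly_Mapping.keys z" "a = (p, t)" "b \<in> Poly_Mapping.keys y" "b = (q, f)" "i \<in> {..<m}"
  then have "p \<in> ar P m" "t \<in> tpow sV m" "q \<in> ar P n" "range f \<subseteq> tpow sV n" "i < m"
    using keys_F_deg[OF z] keys_Q[OF y] by (auto simp: coend_simps)
  then show "dot P sV (m + n - 1) (circ P m n i p q) (tapply sV i f t) \<in> F_deg P sV (m + n - 1)"
    by (intro dot_in_F_deg circ_ar tapply_in_tpow)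
qed

definition D :: "(nat \<Rightarrow> ('p \<times> ('v \<Rightarrow> ('v list \<Rightarrow>\<^sub>0 'k)) \<Rightarrow>\<^sub>0 'k)) \<Rightarrow>
    (nat \<Rightarrow> ('p \<times> ('v list \<Rightarrow>\<^sub>0 'k) \<Rightarrow>\<^sub>0 'k)) \<Rightarrow> nat \<Rightarrow> ('p \<times> ('v list \<Rightarrow>\<^sub>0 'k) \<Rightarrow>\<^sub>0 'k)" where
  "D x z = insert_Fbar P sV z x"

lemma D_apply: "D x z N = (\<Sum>m\<in>{1..N}. insert_F P sV m (N + 1 - m) (z m) (x (N + 1 - m)))"
  by (simp add: D_def insert_Fbar_def Let_def)

lemma D_add: "D x (a + b) = D x a + D x b"
  by (auto simp: D_apply lin_add[OF linear_insert_F] sum.distrib)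

lemma D_0: "D x 0 = 0"
  by (auto simp: D_apply lin_0[OF linear_insert_F])

lemma D_scale: "D x (\<lambda>n. fscale c (a n)) = (\<lambda>n. fscale c (D x a n))"
  by (auto simp: D_apply lin_scale[OF linear_insert_F] free.scale_sum_right)

lemma D_sum: "D x (sum f I) = (\<Sum>i\<in>I. D x (f i))"
  by (rule additive_sum[where f = "D x"]) (rule D_add)

lemma D_in_Fbar:
  assumes x: "x \<in> M" and z: "z \<in> F" shows "D x z \<in> F"
proof (rule FbarI)
  fix N :: nat assume "0 < N"
  show "D x z N \<in> F_deg P sV N"
    unfolding D_apply
  proof (rule free.subspace_sum[OF subspace_F_deg])
    fix m assume m: "m \<in> {1..N}"
    then have "insert_F P sV m (N + 1 - m) (z m) (x (N + 1 - m)) \<in> F_deg P sV (m + (N + 1 - m) - 1)"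
      using x z by (intro insert_F_in_F_deg coinv_in_Q M_deg Fbar_deg) auto
    then show "insert_F P sV m (N + 1 - m) (z m) (x (N + 1 - m)) \<in> F_deg P sV N" using m by simp
  qed
qed (simp add: D_apply)

lemma D_vanishes: "vanishes N z \<Longrightarrow> vanishes N (D x z)"
  unfolding vanishes_def D_apply by (auto intro!: sum.neutral simp: lin_0[OF linear_insert_F])

lemma contin_D: "contin (D x)"
  by (rule continI) (simp_all add: D_add D_vanishes)

lemma sum_list_replicate_update: "i < L \<Longrightarrow> sum_list ((replicate L 1)[i := k]) = L - 1 + (k::nat)"
  by (simp add: sum_list_update sum_list_replicate)

text \<open>All arguments except number \<open>i\<close> live in degree 1. So at most one list of
  arities contributes in degree \<open>N\<close>, the one giving slot \<open>i\<close> the remaining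
  degree \<open>N - (length us - 1)\<close>.\<close>

lemma aop_slot:
  fixes us :: "('p \<times> ('v list \<Rightarrow>\<^sub>0 'k) \<Rightarrow>\<^sub>0 'k) list"
  assumes i: "i < length us"
  shows "aop p ((map (hom_deg 1) us)[i := a]) N =
    (if length us \<le> N
     then F_op P sV p ((replicate (length us) 1)[i := N + 1 - length us]) (us[i := a (N + 1 - length us)]) else 0)"
proof -
  let ?L = "length us" and ?xs = "(map (hom_deg 1) us)[i := a]"
  let ?A = "{ns. length ns = ?L \<and> sum_list ns = N \<and> 0 \<notin> set ns}"
  let ?f = "\<lambda>ns. F_op P sV p ns (map2 (\<lambda>x. x) ?xs ns)"
  let ?ns = "(replicate ?L 1)[i := N + 1 - ?L]"
  have aop: "aop p ?xs N = sum ?f ?A" by (simp add: Fbar_op_def)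
  have 0: "?f ns = 0" if ns: "ns \<in> ?A" "\<not> (?L \<le> N \<and> ns = ?ns)" for ns
  proof (cases "\<exists>j<?L. j \<noteq> i \<and> ns ! j \<noteq> 1")
    case True
    then obtain j where j: "j < ?L" "j \<noteq> i" "ns ! j \<noteq> 1" by blast
    then have "map2 (\<lambda>x. x) ?xs ns ! j = 0" using ns by (simp add: hom_deg_def)
    moreover have "map2 (\<lambda>x. x) ?xs ns ! j \<in> set (map2 (\<lambda>x. x) ?xs ns)"
      using ns j by (intro nth_mem) simp
    ultimately show ?thesis unfolding F_op_def by (intro mlext_zero) simp
  next
    case False
    then have eq: "ns = (replicate ?L 1)[i := ns ! i]"
      using ns i by (intro nth_equalityI) (auto simp: nth_list_update)
    have "ns ! i \<in> set ns" using ns i by (intro nth_mem) simp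
    then have "0 < ns ! i" using ns by (auto intro: gr0I)
    moreover have "sum_list ns = ?L - 1 + ns ! i"
      using sum_list_replicate_update[OF i, of "ns ! i"] eq by simp
    ultimately have "?L \<le> N" "ns ! i = N + 1 - ?L" using ns i by auto
    then show ?thesis using ns eq by simp
  qed
  show ?thesis
  proof (cases "?L \<le> N")
    case True
    have "?ns \<in> ?A"
      using True i sum_list_replicate_update[OF i, of "N + 1 - ?L"]
        set_update_subset_insert[of "replicate ?L 1" i "N + 1 - ?L"] by auto
    then have "sum ?f {?ns} = sum ?f ?A"
      using 0 by (intro sum.mono_neutral_left finite_arities) auto
    moreover have "map2 (\<lambda>x. x) ?xs ?ns = us[i := a (N + 1 - ?L)]"
      using i by (intro nth_equalityI) (auto simp: nth_list_update hom_deg_def)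
    ultimately show ?thesis using True aop by simp
  next
    case False
    then have "sum ?f ?A = 0" using 0 by (intro sum.neutral ballI) blast
    then show ?thesis using False aop by simp
  qed
qed

text \<open>Units in all other slots reduce the full composition to the partial one at
  \<open>i\<close>, and single letters around \<open>f (xs ! i)\<close> concatenate to the tensor
  produced by \<open>tapply\<close>.\<close>

lemma F_op_slot:
  assumes p: "p \<in> ar P (length xs)" and i: "i < length xs"
    and q: "q \<in> ar P n" "0 < n" and f: "f \<in> ar C n"
  shows "F_op P sV p ((replicate (length xs) 1)[i := n])
      ((map (\<lambda>v. dot P sV 1 (opunit P) (word sV [v])) xs)[i := dot P sV n q (f (xs ! i))]) =
    dot P sV (length xs + n - 1) (circ P (length xs) n i p q) (tapply sV i f (word sV xs))"
proof -
  let ?L = "length xs"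
  let ?ns = "(replicate ?L 1)[i := n]"
  let ?l = "(map (\<lambda>v. (opunit P, word sV [v])) xs)[i := (q, f (xs ! i))]"
  have good: "good ?ns ?l"
    unfolding list_all2_conv_all_nth
    using unit_ar q arC_in_tpow[OF f] word_in_tpow[of sV "[v]" for v] i
    by (auto simp: nth_list_update)
  have 1: "(map (\<lambda>v. dot P sV 1 (opunit P) (word sV [v])) xs)[i := dot P sV n q (f (xs ! i))] =
      map2 (\<lambda>n l. dot P sV n (fst l) (snd l)) ?ns ?l"
    using i by (intro nth_equalityI) (auto simp: nth_list_update)
  have 2: "sum_list ?ns = ?L + n - 1" using sum_list_replicate_update[OF i, of n] i by simp
  have u1: "fam (replicate k 1) (replicate k (opunit P))" for k
    using unit_ar by (simp add: list_all2_conv_all_nth)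
  have ns: "?ns = replicate i 1 @ n # replicate (?L - Suc i) 1"
    using i by (simp add: upd_conv_take_nth_drop)
  have "map fst ?l = (replicate ?L (opunit P))[i := q]"
    by (simp add: map_update map_replicate_const comp_def)
  then have qs: "map fst ?l = replicate i (opunit P) @ q # replicate (?L - Suc i) (opunit P)"
    using i by (simp add: upd_conv_take_nth_drop)
  have len: "length ?ns = ?L" by simp
  have c: "circ P ?L n i p q \<in> ar P (?L + n - 1)" using i p q by (intro circ_ar)
  have p1: "fcomp_from P ?L 0 p (replicate i 1) (replicate i (opunit P)) = p"
    using fcomp_from_units[OF p, of 0 i] i by simp
  have "fcomp P p ?ns (map fst ?l) = fcomp_from P (?L + n - 1) (i + n) (circ P ?L n i p q)
      (replicate (?L - Suc i) 1) (replicate (?L - Suc i) (opunit P))"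
    unfolding fcomp_def len unfolding ns qs fcomp_from_append[OF u1] p1
    by (simp add: sum_list_replicate)
  also have "\<dots> = circ P ?L n i p q"
    using i by (intro fcomp_from_units[OF c]) simp
  finally have 3: "fcomp P p ?ns (map fst ?l) = circ P ?L n i p q" .
  have ts: "map snd ?l = map (word sV) (map (\<lambda>v. [v]) (take i xs)) @ f (xs ! i) #
      map (word sV) (map (\<lambda>v. [v]) (drop (Suc i) xs))"
    using i by (simp add: upd_conv_take_nth_drop take_map drop_map comp_def)
  have conc: "concat (map (\<lambda>v. [v]) ys) = ys" for ys :: "'v list" by (induction ys) auto
  have g1: "list_all2 (\<lambda>t n. t \<in> tpow sV n) (map (word sV) (map (\<lambda>v. [v]) ys)) (replicate (length ys) 1)" for ys
    using word_in_tpow[of sV "[v]" for v] by (simp add: list_all2_conv_all_nth)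
  have g2: "list_all2 (\<lambda>t n. t \<in> tpow sV n) (f (xs ! i) # map (word sV) (map (\<lambda>v. [v]) ys))
      (n # replicate (length ys) 1)" for ys
    using g1 arC_in_tpow[OF f] by simp
  have "tprod sV (map snd ?l) = tmul sV (word sV (take i xs)) (tmul sV (f (xs ! i)) (word sV (drop (Suc i) xs)))"
    unfolding ts tprod_append[OF g1 g2] tprod_simps tprod_words conc ..
  also have "\<dots> = tapply sV i f (word sV xs)"
    by (simp add: tapply_word[OF arC_linear[OF f] i] tmul_word_Nil_right[OF word_in_tpow])
  finally have 4: "tprod sV (map snd ?l) = tapply sV i f (word sV xs)" .
  have p': "p \<in> ar P (length ?ns)" using p by simp
  show ?thesis unfolding 1 F_op_dots[OF good p'] 2 3 4 ..
qed

lemma linear_F_op: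
  assumes "i < length us"
  shows "Vector_Spaces.linear fscale fscale (\<lambda>u. F_op P sV p ns (us[i := u]))"
  unfolding F_op_def
  by (rule linI) (simp_all add: vector_space_fscale mlext_update_add mlext_update_scale assms)

text \<open>In degree \<open>N\<close> the monomial of degree \<open>?L\<close> meets the component
  of \<open>x\<close> of arity \<open>N + 1 - ?L\<close>. Each insertion at \<open>i\<close> then
  appears on the right as the operation whose argument \<open>i\<close> is that component evaluated
  at the letter \<open>vs ! i\<close>.\<close>

lemma D_hmon:
  assumes x: "x \<in> M" and p: "p \<in> ar P (length vs)" and vs: "vs \<noteq> []"
  shows "D x (hmon p vs) = (\<Sum>i<length vs. aop p ((map (emb P sV) vs)[i := eval x (vs ! i)]))"
proof
  fix N :: nat
  let ?L = "length vs" and ?us = "map (\<lambda>v. dot P sV 1 (opunit P) (word sV [v])) vs"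
  let ?n = "N + 1 - ?L"
  have "emb P sV v = hom_deg 1 (dot P sV 1 (opunit P) (word sV [v]))" for v
    by (auto simp: emb_def hom_deg_def)
  then have emb: "map (emb P sV) vs = map (hom_deg 1) ?us" by simp
  have rhs: "(\<Sum>i<?L. aop p ((map (emb P sV) vs)[i := eval x (vs ! i)])) N =
      (if ?L \<le> N then \<Sum>i<?L. F_op P sV p ((replicate ?L 1)[i := ?n]) (?us[i := eval x (vs ! i) ?n]) else 0)"
    unfolding sum_fun_apply emb using aop_slot[of _ ?us p _ N] by simp
  have L: "0 < ?L" using vs by simp
  have "D x (hmon p vs) N = (\<Sum>m\<in>{1..N}. if m = ?L then insert_F P sV ?L ?n (dot P sV ?L p (word sV vs)) (x ?n) else 0)"
    unfolding D_apply by (rule sum.cong) (auto simp: hmon_def hom_deg_def lin_0[OF linear_insert_F])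
  then have lhs: "D x (hmon p vs) N =
      (if ?L \<le> N then insert_F P sV ?L ?n (dot P sV ?L p (word sV vs)) (x ?n) else 0)"
    using L by (simp add: Suc_le_eq)
  show "D x (hmon p vs) N = (\<Sum>i<?L. aop p ((map (emb P sV) vs)[i := eval x (vs ! i)])) N"
  proof (cases "?L \<le> N")
    case True
    then have n: "0 < ?n" by simp
    note xn = coinv_in_Q[OF M_deg[OF x n]]
    have "insert_F P sV ?L ?n (dot P sV ?L p (word sV vs)) (x ?n) =
        lext (\<lambda>a. \<Sum>i<?L. case a of (q, f) \<Rightarrow> dot P sV (?L + ?n - 1) (circ P ?L ?n i p q) (tapply sV i f (word sV vs))) (x ?n)"
      unfolding insert_F_dot[OF xn p word_in_tpow] by (rule lext_cong) auto
    also have "\<dots> = (\<Sum>i<?L. lext (\<lambda>(q, f). dot P sV (?L + ?n - 1) (circ P ?L ?n i p q) (tapply sV i f (word sV vs))) (x ?n))"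
      by (rule lext_fun_sum)
    also have "\<dots> = (\<Sum>i<?L. F_op P sV p ((replicate ?L 1)[i := ?n]) (?us[i := eval x (vs ! i) ?n]))"
    proof (rule sum.cong[OF refl])
      fix i assume "i \<in> {..<?L}"
      then have i: "i < ?L" by simp
      have "F_op P sV p ((replicate ?L 1)[i := ?n]) (?us[i := eval x (vs ! i) ?n]) =
          lext (\<lambda>a. F_op P sV p ((replicate ?L 1)[i := ?n]) (?us[i := case a of (q, f) \<Rightarrow> dot P sV ?n q (f (vs ! i))])) (x ?n)"
        unfolding eval_def ev_def using i by (intro lin_lext linear_F_op) simp
      also have "\<dots> = lext (\<lambda>(q, f). dot P sV (?L + ?n - 1) (circ P ?L ?n i p q) (tapply sV i f (word sV vs))) (x ?n)"
      proof (rule lext_cong)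
        fix a assume "a \<in> Poly_Mapping.keys (x ?n)"
        then obtain q f where "a = (q, f)" "q \<in> ar P ?n" "f \<in> ar C ?n" using keys_Q[OF xn] by auto
        then show "F_op P sV p ((replicate ?L 1)[i := ?n]) (?us[i := case a of (q, f) \<Rightarrow> dot P sV ?n q (f (vs ! i))]) =
            (case a of (q, f) \<Rightarrow> dot P sV (?L + ?n - 1) (circ P ?L ?n i p q) (tapply sV i f (word sV vs)))"
          using F_op_slot[OF p i _ n] by simp
      qed
      finally show "lext (\<lambda>(q, f). dot P sV (?L + ?n - 1) (circ P ?L ?n i p q) (tapply sV i f (word sV vs))) (x ?n) =
          F_op P sV p ((replicate ?L 1)[i := ?n]) (?us[i := eval x (vs ! i) ?n])" ..
    qed
    finally show ?thesis unfolding lhs rhs using True by simp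
  next
    case False
    then show ?thesis unfolding lhs rhs by simp
  qed
qed

lemma aop_unit:
  assumes a: "a \<in> F" shows "aop (opunit P) [a] = a"
proof -
  have "aop (opunit P) [a] - a = 0"
  proof (rule contin_eq_0[where f = "\<lambda>a. aop (opunit P) [a] - a", OF _ _ a])
    have "contin (\<lambda>a. aop (opunit P) [a])" using contin_aop[of 0 "[0]" "opunit P"] by simp
    moreover have "contin (\<lambda>a. a)" by (rule continI) (rule refl)
    ultimately show "contin (\<lambda>a. aop (opunit P) [a] - a)" by (rule contin_diff)
    fix q and xs :: "'v list" assume q: "q \<in> ar P (length xs)" "xs \<noteq> []"
    have "aop (opunit P) (hmons [(q, xs)]) = hmon q xs"
      using unit_ar q circ_unit_left[OF q(1)] by (subst aop_hmons) (auto simp: fcomp_def)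
    then show "aop (opunit P) [hmon q xs] - hmon q xs = 0" by simp
  qed
  then show ?thesis by simp
qed

lemma D_emb:
  assumes "x \<in> M" shows "D x (emb P sV v) = eval x v"
  using D_hmon[OF assms, of "opunit P" "[v]"] unit_ar
  by (simp add: emb_eq_hmon[symmetric] aop_unit eval_in_Fbar assms)

lemma aop_Nil:
  assumes "p \<in> ar P 0" shows "aop p [] = 0"
proof
  fix N :: nat
  show "aop p [] N = 0 N"
    using Fbar_at_0[OF aop_in_Fbar[of p "[]"]] assms by (cases "N = 0") (auto simp: Fbar_op_def intro!: sum.neutral)
qed

text \<open>Replacing one monomial \<open>q.(x1 \<dots> xn)\<close> among the arguments of \<open>p\<close> by \<open>x1, \<dots>, xn\<close>, and \<open>p\<close> by
  \<open>p \<circ>\<^sub>i q\<close>, leaves fewer arguments that are not generators.\<close>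

lemma hmons_induct:
  assumes base: "\<And>p us. p \<in> ar P (length us) \<Longrightarrow> R p (map (emb P sV) us)"
    and step: "\<And>p q as bs cs. p \<in> ar P (length as + 1 + length cs) \<Longrightarrow> q \<in> ar P (length bs) \<Longrightarrow> bs \<noteq> [] \<Longrightarrow>
      set as \<subseteq> F \<Longrightarrow> set bs \<subseteq> F \<Longrightarrow> set cs \<subseteq> F \<Longrightarrow>
      R (circ P (length as + 1 + length cs) (length bs) (length as) p q) (as @ bs @ cs) \<Longrightarrow> R q bs \<Longrightarrow>
      R p (as @ aop q bs # cs)"
    and ps: "\<And>q xs. (q, xs) \<in> set ps \<Longrightarrow> q \<in> ar P (length xs) \<and> xs \<noteq> []"
    and p: "p \<in> ar P (length ps)"
  shows "R p (hmons ps)"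
proof -
  \<comment> \<open>The induction needs a front part of generators already unfolded: the letters of
    the first monomial move into it while \<open>p\<close> grows to a partial composite.\<close>
  have "R p (map (emb P sV) us @ hmons ps)"
    if "p \<in> ar P (length us + length ps)" "\<And>q xs. (q, xs) \<in> set ps \<Longrightarrow> q \<in> ar P (length xs) \<and> xs \<noteq> []" for us
    using that
  proof (induction ps arbitrary: p us)
    case Nil
    then show ?case using base by simp
  next
    case (Cons a ps)
    obtain q xs where a: "a = (q, xs)" by (cases a)
    have q: "q \<in> ar P (length xs)" "xs \<noteq> []" using Cons.prems(2) a by auto
    have F: "set (map (emb P sV) us) \<subseteq> F" for us using emb_in_Fbar by auto
    have ps: "set (hmons ps) \<subseteq> F" using Cons.prems(2) hmon_in_Fbar by fastforce
    let ?c = "circ P (length us + 1 + length ps) (length xs) (length us) p q"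
    have "?c \<in> ar P (length us + 1 + length ps + length xs - 1)"
      using Cons.prems q by (intro circ_ar) auto
    then have "?c \<in> ar P (length (us @ xs) + length ps)" by (simp add: add_ac)
    then have "R ?c (map (emb P sV) (us @ xs) @ hmons ps)"
      using Cons.prems(2) by (intro Cons.IH) auto
    then have "R p (map (emb P sV) us @ aop q (map (emb P sV) xs) # hmons ps)"
      using Cons.prems(1) q base[OF q(1)] F ps by (intro step) auto
    then show ?case by (simp add: a hmon_eq_aop[OF q(1)])
  qed
  from this[of "[]"] show ?thesis using ps p by simp
qed

lemma contin_sum: "(\<And>i. i \<in> I \<Longrightarrow> contin (f i)) \<Longrightarrow> contin (\<lambda>a. \<Sum>i\<in>I. f i a)"
proof (induction I rule: infinite_finite_induct)
  case (insert i I)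
  have "contin (\<lambda>a. f i a - ((\<lambda>a. 0) a - (\<Sum>i\<in>I. f i a)))"
    using insert by (intro contin_diff[of "f i"] contin_diff[of "\<lambda>a. 0"]) (auto simp: contin_def vanishes_def)
  moreover have "f i a - (0 - (\<Sum>i\<in>I. f i a)) = (\<Sum>i\<in>insert i I. f i a)" for a
    using insert.hyps by simp
  ultimately show ?case by (simp only:)
qed (auto simp: contin_def vanishes_def)

text \<open>Generators are covered by \<open>D_hmon\<close>. When an argument is itself
  \<open>aop q bs\<close>, the rule for the partial composite splits over the three blocks of
  arguments; the middle sum refolds, by additivity, to the derivative of that argument.\<close>

lemma D_aop:
  assumes x: "x \<in> M" and p: "p \<in> ar P (length as)" and as: "set as \<subseteq> F"
  shows "D x (aop p as) = (\<Sum>i<length as. aop p (as[i := D x (as ! i)]))"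
proof -
  let ?R = "\<lambda>p as. D x (aop p as) = (\<Sum>i<length as. aop p (as[i := D x (as ! i)]))"
  have hm: "?R p (hmons ps)"
    if "\<And>q xs. (q, xs) \<in> set ps \<Longrightarrow> q \<in> ar P (length xs) \<and> xs \<noteq> []" "p \<in> ar P (length ps)" for ps
    using _ _ that
  proof (rule hmons_induct[where R = ?R])
    fix p and us :: "'v list"
    assume p: "p \<in> ar P (length us)"
    show "?R p (map (emb P sV) us)"
    proof (cases "us = []")
      case True
      then show ?thesis using p by (simp add: aop_Nil D_0)
    next
      case False
      then show ?thesis using D_hmon[OF x p] by (simp add: hmon_eq_aop[OF p, symmetric] D_emb[OF x])
    qed
  next
    fix p q as bs cs
    assume p: "p \<in> ar P (length as + 1 + length cs)" and q: "q \<in> ar P (length bs)" "bs \<noteq> []"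
      and F: "set as \<subseteq> F" "set bs \<subseteq> F" "set cs \<subseteq> F"
      and IH: "?R (circ P (length as + 1 + length cs) (length bs) (length as) p q) (as @ bs @ cs)" "?R q bs"
    let ?c = "circ P (length as + 1 + length cs) (length bs) (length as) p q"
    have DF: "D x (as ! i) \<in> F" if "set as \<subseteq> F" "i < length as" for as i
      using that by (intro D_in_Fbar[OF x]) auto
    have up: "set (as[i := D x (as ! i)]) \<subseteq> F" if "set as \<subseteq> F" "i < length as" for as i
      by (rule set_list_update_subset[OF that(1) DF[OF that]])
    have "D x (aop p (as @ aop q bs # cs)) = D x (aop ?c (as @ bs @ cs))"
      by (simp only: aop_circ[OF p q F])
    also have "\<dots> = (\<Sum>i<length as. aop ?c (as[i := D x (as ! i)] @ bs @ cs)) +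
        ((\<Sum>i<length bs. aop ?c (as @ bs[i := D x (bs ! i)] @ cs)) +
         (\<Sum>i<length cs. aop ?c (as @ bs @ cs[i := D x (cs ! i)])))"
      unfolding IH(1) sum_update_append[of "\<lambda>l. aop ?c l" as "bs @ cs"]
        sum_update_append[of "\<lambda>l. aop ?c (as @ l)" bs cs] ..
    also have "(\<Sum>i<length as. aop ?c (as[i := D x (as ! i)] @ bs @ cs)) =
        (\<Sum>i<length as. aop p (as[i := D x (as ! i)] @ aop q bs # cs))"
    proof (rule sum.cong[OF refl])
      fix i assume "i \<in> {..<length as}"
      then have "set (as[i := D x (as ! i)]) \<subseteq> F" using up F by simp
      then show "aop ?c (as[i := D x (as ! i)] @ bs @ cs) = aop p (as[i := D x (as ! i)] @ aop q bs # cs)"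
        using aop_circ[of p "as[i := D x (as ! i)]" cs q bs] p q F by simp
    qed
    also have "(\<Sum>i<length bs. aop ?c (as @ bs[i := D x (bs ! i)] @ cs)) =
        (\<Sum>i<length bs. aop p (as @ aop q (bs[i := D x (bs ! i)]) # cs))"
    proof (rule sum.cong[OF refl])
      fix i assume "i \<in> {..<length bs}"
      then have "set (bs[i := D x (bs ! i)]) \<subseteq> F" using up F by simp
      then show "aop ?c (as @ bs[i := D x (bs ! i)] @ cs) = aop p (as @ aop q (bs[i := D x (bs ! i)]) # cs)"
        using aop_circ[of p as cs q "bs[i := D x (bs ! i)]"] p q F by simp
    qed
    also have "(\<Sum>i<length cs. aop ?c (as @ bs @ cs[i := D x (cs ! i)])) =
        (\<Sum>i<length cs. aop p (as @ aop q bs # cs[i := D x (cs ! i)]))"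
    proof (rule sum.cong[OF refl])
      fix i assume "i \<in> {..<length cs}"
      then have "set (cs[i := D x (cs ! i)]) \<subseteq> F" using up F by simp
      then show "aop ?c (as @ bs @ cs[i := D x (cs ! i)]) = aop p (as @ aop q bs # cs[i := D x (cs ! i)])"
        using aop_circ[of p as "cs[i := D x (cs ! i)]" q bs] p q F by simp
    qed
    also have "(\<Sum>i<length bs. aop p (as @ aop q (bs[i := D x (bs ! i)]) # cs)) =
        aop p (as @ D x (aop q bs) # cs)"
    proof -
      have "aop p (as @ (\<Sum>i\<in>I. h i) # cs) = (\<Sum>i\<in>I. aop p (as @ h i # cs))" for I :: "nat set" and h
        using aop_add[of "length as" "as @ 0 # cs" p]
        by (intro additive_sum[where f = "\<lambda>a. aop p (as @ a # cs)"]) simp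
      then show ?thesis unfolding IH(2) by simp
    qed
    finally show "?R p (as @ aop q bs # cs)"
      unfolding sum_update_append[of "\<lambda>l. aop p l" as "aop q bs # cs" "D x"]
        sum_update_Cons[of "\<lambda>l. aop p (as @ l)" "aop q bs" cs "D x"] .
  qed
  have "D x (aop p as) - (\<Sum>i<length as. aop p (as[i := D x (as ! i)])) = 0"
    using _ _ as refl
  proof (rule contin_list_eq_0[where \<Phi> = "\<lambda>as. D x (aop p as) - (\<Sum>i<length as. aop p (as[i := D x (as ! i)]))"])
    fix xs k assume xs: "set xs \<subseteq> F" "length xs = length as" and k: "k < length as"
    have c: "contin (\<lambda>a. aop p (xs[k := a]))" if "length xs = length as" for xs using that k by (intro contin_aop) simp
    show "contin (\<lambda>a. D x (aop p (xs[k := a])) -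
        (\<Sum>i<length (xs[k := a]). aop p (xs[k := a, i := D x (xs[k := a] ! i)])))"
    proof (rule contin_diff)
      show "contin (\<lambda>a. D x (aop p (xs[k := a])))"
        using xs p by (intro contin_compose[OF contin_D c] aop_in_Fbar set_list_update_subset) auto
      have "contin (\<lambda>a. aop p (xs[k := a, i := D x (xs[k := a] ! i)]))" for i
      proof (cases "i = k")
        case True
        then have "(\<lambda>a. aop p (xs[k := a, i := D x (xs[k := a] ! i)])) = (\<lambda>a. aop p (xs[k := D x a]))"
          using xs k by simp
        then show ?thesis using contin_compose[OF c[OF xs(2)] contin_D[of x] D_in_Fbar[OF x]] by simp
      next
        case False
        then have "(\<lambda>a. aop p (xs[k := a, i := D x (xs[k := a] ! i)])) = (\<lambda>a. aop p ((xs[i := D x (xs ! i)])[k := a]))"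
          by (simp add: list_update_swap)
        then show ?thesis using c[of "xs[i := D x (xs ! i)]"] xs by simp
      qed
      then show "contin (\<lambda>a. \<Sum>i<length (xs[k := a]). aop p (xs[k := a, i := D x (xs[k := a] ! i)]))"
        by (simp add: contin_sum)
    qed
  next
    fix ps :: "('p \<times> 'v list) list"
    assume "length ps = length as" "\<And>q xs. (q, xs) \<in> set ps \<Longrightarrow> q \<in> ar P (length xs) \<and> xs \<noteq> []"
    with hm[of ps] p show "D x (aop p (hmons ps)) -
        (\<Sum>i<length (hmons ps). aop p ((hmons ps)[i := D x (hmons ps ! i)])) = 0" by simp
  qed
  then show ?thesis by simp
qed

section \<open>The pre-Lie product evaluated on V\<close>

lemma circQ_closed:
  assumes "i < m" "s \<in> ar Q m" "t \<in> ar Q n"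
  shows "circ Q m n i s t \<in> ar Q (m + n - 1)"
  unfolding Q_simps(2)
proof (rule lext_in_subspace[OF subspace_Q], split prod.split, intro allI impI, rule lext_in_subspace[OF subspace_Q], split prod.split, intro allI impI)
  fix a q f b q' f'
  assume "a \<in> Poly_Mapping.keys s" "a = (q, f)" "b \<in> Poly_Mapping.keys t" "b = (q', f')"
  then have "q \<in> ar P m" "f \<in> ar C m" "q' \<in> ar P n" "f' \<in> ar C n"
    using keys_Q[OF assms(2)] keys_Q[OF assms(3)] by auto
  then show "pure_op P C (m + n - 1) (circ P m n i q q') (circ C m n i f f') \<in> ar Q (m + n - 1)"
    by (intro pure_op_in_Q circ_ar circC_closed assms(1))
qed

lemma prelie_in_M:
  assumes "x \<in> M" "y \<in> M" shows "prelie Q x y \<in> M"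
  unfolding M_iff
proof (intro conjI allI impI)
  fix N :: nat assume N: "1 \<le> N"
  show "prelie Q x y N \<in> coinv Q N"
    unfolding prelie_def Let_def
  proof (rule free.subspace_sum[OF subspace_coinv], rule coinv_mapI, rule free.subspace_sum[OF subspace_Q])
    fix m i assume m: "m \<in> {1..N}" and i: "i \<in> {..<m}"
    have "circ Q m (N + 1 - m) i (x m) (y (N + 1 - m)) \<in> ar Q (m + (N + 1 - m) - 1)"
      using m i assms by (intro circQ_closed coinv_in_Q M_deg) auto
    then show "circ Q m (N + 1 - m) i (x m) (y (N + 1 - m)) \<in> ar Q N" using m by simp
  qed
qed (simp add: prelie_def)

lemma ev_circQ:
  assumes i: "i < m" and s: "s \<in> ar Q m" and t: "t \<in> ar Q n"
  shows "ev (m + n - 1) (circ Q m n i s t) v =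
    lext (\<lambda>(q, f). lext (\<lambda>(q', f'). dot P sV (m + n - 1) (circ P m n i q q') (tapply sV i f' (f v))) t) s"
  unfolding Q_simps(2) lin_lext[OF linear_ev]
proof (rule lext_cong, clarify)
  fix q f assume "(q, f) \<in> Poly_Mapping.keys s"
  then have q: "q \<in> ar P m" "f \<in> ar C m" using keys_Q[OF s] by auto
  show "ev (m + n - 1) (lext (\<lambda>(a', b'). pure_op P C (m + n - 1) (circ P m n i q a') (circ C m n i f b')) t) v =
      lext (\<lambda>(q', f'). dot P sV (m + n - 1) (circ P m n i q q') (tapply sV i f' (f v))) t"
    unfolding lin_lext[OF linear_ev]
  proof (rule lext_cong, clarify)
    fix q' f' assume "(q', f') \<in> Poly_Mapping.keys t"
    then have q': "q' \<in> ar P n" "f' \<in> ar C n" using keys_Q[OF t] by auto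
    show "ev (m + n - 1) (pure_op P C (m + n - 1) (circ P m n i q q') (circ C m n i f f')) v =
        dot P sV (m + n - 1) (circ P m n i q q') (tapply sV i f' (f v))"
      using ev_pure_op[OF circ_ar[OF i q(1) q'(1)] circC_closed[OF i q(2) q'(2)]]
      by (simp add: coend_simps(3))
  qed
qed

lemma insert_F_ev:
  assumes s: "s \<in> ar Q m" and t: "t \<in> ar Q n"
  shows "insert_F P sV m n (ev m s v) t = (\<Sum>i<m. ev (m + n - 1) (circ Q m n i s t) v)"
proof -
  have "insert_F P sV m n (ev m s v) t = lext (\<lambda>a. insert_F P sV m n (case a of (q, f) \<Rightarrow> dot P sV m q (f v)) t) s"
    unfolding ev_def by (rule lin_lext[OF linear_insert_F])
  also have "\<dots> = lext (\<lambda>a. \<Sum>i<m. case a of (q, f) \<Rightarrow>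
      lext (\<lambda>(q', f'). dot P sV (m + n - 1) (circ P m n i q q') (tapply sV i f' (f v))) t) s"
  proof (rule lext_cong, clarify)
    fix q f assume "(q, f) \<in> Poly_Mapping.keys s"
    then have q: "q \<in> ar P m" "f \<in> ar C m" using keys_Q[OF s] by auto
    have "insert_F P sV m n (dot P sV m q (f v)) t =
        lext (\<lambda>a. \<Sum>i<m. case a of (q', f') \<Rightarrow> dot P sV (m + n - 1) (circ P m n i q q') (tapply sV i f' (f v))) t"
      unfolding insert_F_dot[OF t q(1) arC_in_tpow[OF q(2)]] by (rule lext_cong) auto
    then show "insert_F P sV m n (dot P sV m q (f v)) t =
      (\<Sum>i<m. lext (\<lambda>(q', f'). dot P sV (m + n - 1) (circ P m n i q q') (tapply sV i f' (f v))) t)"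
      by (simp only: lext_fun_sum)
  qed
  also have "\<dots> = (\<Sum>i<m. ev (m + n - 1) (circ Q m n i s t) v)"
    unfolding lext_fun_sum by (intro sum.cong refl ev_circQ[OF _ s t, symmetric]) simp
  finally show ?thesis .
qed

text \<open>Composing f with the insertion of g at place i amounts, at a vector v, to inserting g at
  place i of the tensor f(v). So the pre-Lie product describes what two successive actions do to a
  generator.\<close>

lemma eval_prelie:
  assumes y: "y \<in> M" and x: "x \<in> M"
  shows "eval (prelie Q y x) v = D x (eval y v)"
proof
  fix N :: nat
  have "eval (prelie Q y x) v N = (\<Sum>m\<in>{1..N}. \<Sum>i<m. ev N (circ Q m (N + 1 - m) i (y m) (x (N + 1 - m))) v)"
    by (simp add: eval_def prelie_def Let_def lin_sum[OF linear_ev] ev_coinv_map)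
  also have "\<dots> = (\<Sum>m\<in>{1..N}. insert_F P sV m (N + 1 - m) (ev m (y m) v) (x (N + 1 - m)))"
  proof (rule sum.cong[OF refl])
    fix m assume m: "m \<in> {1..N}"
    then have "y m \<in> ar Q m" "x (N + 1 - m) \<in> ar Q (N + 1 - m)"
      using x y by (auto intro!: coinv_in_Q M_deg)
    from insert_F_ev[OF this, of v] m
    show "(\<Sum>i<m. ev N (circ Q m (N + 1 - m) i (y m) (x (N + 1 - m))) v) =
        insert_F P sV m (N + 1 - m) (ev m (y m) v) (x (N + 1 - m))" by simp
  qed
  finally show "eval (prelie Q y x) v N = D x (eval y v) N"
    by (simp add: D_apply eval_def)
qed

section \<open>The action of symmetric powers\<close>

text \<open>\<open>place \<Phi> U as [w1, \<dots>, wk]\<close> is the sum of the values of \<open>\<Phi>\<close> on the lists obtained from \<open>as\<close>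
  by applying \<open>w1, \<dots>, wk\<close> to the entries at \<open>k\<close> distinct positions taken in \<open>U\<close>.\<close>

fun place where
  "place \<Phi> U as [] = \<Phi> as"
| "place \<Phi> U as (w # ws) = (\<Sum>i\<in>U. place \<Phi> (U - {i}) (as[i := D w (as ! i)]) ws)"

text \<open>With more operators than positions, the positions run out and an empty sum
  remains.\<close>

lemma place_eq_0:
  fixes \<Phi> :: "_ \<Rightarrow> 'c::ab_group_add"
  shows "finite U \<Longrightarrow> card U < length ws \<Longrightarrow> place \<Phi> U as ws = 0"
proof (induction ws arbitrary: U as)
  case (Cons w ws)
  have "place \<Phi> (U - {i}) (as[i := D w (as ! i)]) ws = 0" if "i \<in> U" for i
  proof (rule Cons.IH)
    have "0 < card U" using Cons.prems that by (auto simp: card_gt_0_iff)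
    then show "card (U - {i}) < length ws" using Cons.prems that by simp
  qed (use Cons.prems in simp)
  then show ?case by simp
qed simp

text \<open>On such an element the second of two operators may be merged with the first into their
  pre-Lie product. Generators have this property; on a product the Leibniz rule would add mixed
  terms. The merged term is what the recursion of \<open>sym_act\<close> subtracts.\<close>

definition prim :: "(nat \<Rightarrow> ('p \<times> ('v list \<Rightarrow>\<^sub>0 'k) \<Rightarrow>\<^sub>0 'k)) \<Rightarrow> bool" where
  "prim a \<longleftrightarrow> a \<in> F \<and> (\<forall>w\<in>M. \<forall>x\<in>M. D x (D w a) = D (prelie Q w x) a)"

lemma prim_emb: "prim (emb P sV v)"
  by (simp add: prim_def emb_in_Fbar D_emb prelie_in_M eval_prelie)

text \<open>By the Leibniz rule, \<open>x\<close> hits a free position of \<open>U\<close>, a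
  position already hit by some entry of \<open>ws\<close>, where primitivity merges the two
  operators, or a position outside \<open>U\<close>. The last sum is carried along because a used
  position leaves \<open>U\<close> during the induction.\<close>

lemma D_place:
  assumes x: "x \<in> M" and p: "p \<in> ar P L"
  shows "length as = L \<Longrightarrow> set as \<subseteq> F \<Longrightarrow> U \<subseteq> {..<L} \<Longrightarrow> (\<And>i. i \<in> U \<Longrightarrow> prim (as ! i)) \<Longrightarrow> set ws \<subseteq> M \<Longrightarrow>
    D x (place (aop p) U as ws) = place (aop p) U as (ws @ [x]) +
      (\<Sum>a<length ws. place (aop p) U as (ws[a := prelie Q (ws ! a) x])) +
      (\<Sum>l\<in>{..<L} - U. place (aop p) U (as[l := D x (as ! l)]) ws)"
proof (induction ws arbitrary: as U)
  case Nil
  have "D x (aop p as) = (\<Sum>i<L. aop p (as[i := D x (as ! i)]))"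
    using D_aop[OF x, of p as] p Nil by simp
  also have "\<dots> = (\<Sum>i\<in>U. aop p (as[i := D x (as ! i)])) + (\<Sum>i\<in>{..<L} - U. aop p (as[i := D x (as ! i)]))"
    by (subst add.commute, rule sum.subset_diff) (use Nil in auto)
  finally show ?case by simp
next
  case (Cons w ws)
  let ?pl = "place (aop p)"
  have w: "w \<in> M" using Cons.prems by auto
  have UL: "i < L" if "i \<in> U" for i using Cons.prems(3) that by auto
  let ?A = "\<lambda>i. ?pl (U - {i}) (as[i := D w (as ! i)]) (ws @ [x])"
    and ?B = "\<lambda>i. \<Sum>a<length ws. ?pl (U - {i}) (as[i := D w (as ! i)]) (ws[a := prelie Q (ws ! a) x])"
    and ?C = "\<lambda>i. ?pl (U - {i}) (as[i := D (prelie Q w x) (as ! i)]) ws"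
    and ?E = "\<lambda>i. \<Sum>l\<in>{..<L} - U. ?pl (U - {i}) ((as[l := D x (as ! l)])[i := D w (as[l := D x (as ! l)] ! i)]) ws"
  have "D x (?pl U as (w # ws)) = (\<Sum>i\<in>U. D x (?pl (U - {i}) (as[i := D w (as ! i)]) ws))"
    by (simp only: place.simps D_sum)
  also have "\<dots> = (\<Sum>i\<in>U. ?A i + ?B i + (?C i + ?E i))"
  proof (rule sum.cong[OF refl])
    fix i assume i: "i \<in> U"
    let ?as = "as[i := D w (as ! i)]"
    have ai: "prim (as ! i)" using Cons.prems i by simp
    have "D w (as ! i) \<in> F" using ai by (intro D_in_Fbar[OF w]) (simp add: prim_def)
    then have F: "set ?as \<subseteq> F" using Cons.prems by (intro set_list_update_subset)
    have "D x (?pl (U - {i}) ?as ws) = ?A i + ?B i + (\<Sum>l\<in>{..<L} - (U - {i}). ?pl (U - {i}) (?as[l := D x (?as ! l)]) ws)"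
    proof (rule Cons.IH)
      show "prim (?as ! j)" if "j \<in> U - {i}" for j using that Cons.prems by simp
    qed (use Cons.prems F in auto)
    \<comment> \<open>Position \<open>i\<close> has just left the set of free positions. Its term,
      with \<open>x\<close> acting after \<open>w\<close>, is split off and becomes the pre-Lie term
      for \<open>w\<close>.\<close>
    also have "{..<L} - (U - {i}) = insert i ({..<L} - U)" using UL[OF i] by auto
    also have "(\<Sum>l\<in>insert i ({..<L} - U). ?pl (U - {i}) (?as[l := D x (?as ! l)]) ws) =
        ?pl (U - {i}) (?as[i := D x (?as ! i)]) ws + (\<Sum>l\<in>{..<L} - U. ?pl (U - {i}) (?as[l := D x (?as ! l)]) ws)"
      using i by (intro sum.insert) auto
    also have "?as[i := D x (?as ! i)] = as[i := D (prelie Q w x) (as ! i)]"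
      using ai w x UL[OF i] Cons.prems(1) by (simp add: prim_def)
    also have "(\<Sum>l\<in>{..<L} - U. ?pl (U - {i}) (?as[l := D x (?as ! l)]) ws) = ?E i"
    proof (rule sum.cong[OF refl])
      fix l assume "l \<in> {..<L} - U"
      then have "l \<noteq> i" using i by auto
      then show "?pl (U - {i}) (?as[l := D x (?as ! l)]) ws =
          ?pl (U - {i}) ((as[l := D x (as ! l)])[i := D w (as[l := D x (as ! l)] ! i)]) ws"
        by (simp add: list_update_swap)
    qed
    finally show "D x (?pl (U - {i}) ?as ws) = ?A i + ?B i + (?C i + ?E i)" .
  qed
  also have "\<dots> = sum ?A U + ((sum ?C U + sum ?B U) + sum ?E U)"
    by (simp only: sum.distrib add_ac)
  also have "sum ?A U = ?pl U as ((w # ws) @ [x])" by simp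
  also have "sum ?C U + sum ?B U = (\<Sum>a<length (w # ws). ?pl U as ((w # ws)[a := prelie Q ((w # ws) ! a) x]))"
    unfolding sum_update_Cons[of "\<lambda>l. ?pl U as l" w ws "\<lambda>y. prelie Q y x"] place.simps
    by (subst (2) sum.swap) (rule refl)
  also have "sum ?E U = (\<Sum>l\<in>{..<L} - U. ?pl U (as[l := D x (as ! l)]) (w # ws))"
    unfolding place.simps by (rule sum.swap)
  finally show ?case by (simp only: add.assoc)
qed

text \<open>With all positions free the last sum of \<open>D_place\<close> is empty, and its middle
  sum is the correction subtracted in the recursion. The reversal reflects that the head of the list
  is the last factor.\<close>

lemma sym_act_prims:
  assumes p: "p \<in> ar P (length as)" and as: "\<And>a. a \<in> set as \<Longrightarrow> prim a" and xs: "set xs \<subseteq> M"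
  shows "sym_act P sV (aop p as) xs = place (aop p) {..<length as} as (rev xs)"
  using xs
proof (induction xs rule: length_induct)
  case (1 xs)
  let ?pl = "place (aop p) {..<length as} as"
  show ?case
  proof (cases xs)
    case Nil
    then show ?thesis by simp
  next
    case (Cons x ys)
    have x: "x \<in> M" and ys: "set ys \<subseteq> M" using 1 Cons by auto
    have F: "set as \<subseteq> F" using as by (auto simp: prim_def)
    have upd: "sym_act P sV (aop p as) (ys[i := prelie Q (ys ! i) x]) = ?pl ((rev ys)[length ys - Suc i := prelie Q (ys ! i) x])"
      if i: "i < length ys" for i
    proof -
      have "prelie Q (ys ! i) x \<in> M" using i x ys by (intro prelie_in_M) auto
      then have "set (ys[i := prelie Q (ys ! i) x]) \<subseteq> M"
        using ys set_update_subset_insert[of ys i] by blast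
      then have "sym_act P sV (aop p as) (ys[i := prelie Q (ys ! i) x]) = ?pl (rev (ys[i := prelie Q (ys ! i) x]))"
        using 1(1) Cons by simp
      then show ?thesis using i by (simp add: rev_update)
    qed
    have "sym_act P sV (aop p as) xs = D x (sym_act P sV (aop p as) ys) -
        (\<Sum>i<length ys. sym_act P sV (aop p as) (ys[i := prelie Q (ys ! i) x]))"
      by (simp add: Cons D_def)
    also have "sym_act P sV (aop p as) ys = ?pl (rev ys)"
      using 1(1) Cons ys by simp
    also have "D x (?pl (rev ys)) = ?pl (rev ys @ [x]) +
        (\<Sum>a<length ys. ?pl ((rev ys)[a := prelie Q (rev ys ! a) x]))"
      using D_place[OF x p refl F subset_refl, of "rev ys"] as ys by simp
    also have "(\<Sum>i<length ys. sym_act P sV (aop p as) (ys[i := prelie Q (ys ! i) x])) =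
        (\<Sum>i<length ys. ?pl ((rev ys)[length ys - Suc i := prelie Q (rev ys ! (length ys - Suc i)) x]))"
      using upd by (intro sum.cong refl) (simp add: rev_nth)
    also have "\<dots> = (\<Sum>a<length ys. ?pl ((rev ys)[a := prelie Q (rev ys ! a) x]))"
      by (rule sum.nat_diff_reindex)
    finally show ?thesis by (simp add: Cons)
  qed
qed

text \<open>At most one of the equal operators acts at the new position \<open>i\<close>. It can be
  any of the \<open>Suc k\<close>, and all these choices give the same term.\<close>

lemma place_insert_replicate:
  fixes \<Phi> :: "_ \<Rightarrow> ('c \<Rightarrow>\<^sub>0 'k)"
  assumes "finite U" "i \<notin> U" "i < length as"
  shows "place \<Phi> (insert i U) as (replicate (Suc k) w) = place \<Phi> U as (replicate (Suc k) w) +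
    fscale (of_nat (Suc k)) (place \<Phi> U (as[i := D w (as ! i)]) (replicate k w))"
  using assms
proof (induction k arbitrary: U as)
  case 0
  then show ?case by (simp add: add.commute)
next
  case (Suc k)
  let ?up = "\<lambda>as j. as[j := D w (as ! j)]"
  have "place \<Phi> (insert i U) as (replicate (Suc (Suc k)) w) =
      place \<Phi> U (?up as i) (replicate (Suc k) w) +
      (\<Sum>j\<in>U. place \<Phi> (insert i U - {j}) (?up as j) (replicate (Suc k) w))"
    using Suc.prems by (simp add: replicate_Suc[of "Suc k"] del: replicate_Suc)
  also have "(\<Sum>j\<in>U. place \<Phi> (insert i U - {j}) (?up as j) (replicate (Suc k) w)) =
      (\<Sum>j\<in>U. place \<Phi> (U - {j}) (?up as j) (replicate (Suc k) w) +
         fscale (of_nat (Suc k)) (place \<Phi> (U - {j}) (?up (?up as i) j) (replicate k w)))"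
  proof (rule sum.cong[OF refl])
    fix j assume j: "j \<in> U"
    then have ij: "i \<noteq> j" using Suc.prems by auto
    then have "insert i U - {j} = insert i (U - {j})" by auto
    moreover have "?up (?up as j) i = ?up (?up as i) j" using ij by (simp add: list_update_swap)
    ultimately show "place \<Phi> (insert i U - {j}) (?up as j) (replicate (Suc k) w) =
        place \<Phi> (U - {j}) (?up as j) (replicate (Suc k) w) +
         fscale (of_nat (Suc k)) (place \<Phi> (U - {j}) (?up (?up as i) j) (replicate k w))"
      using Suc.IH[of "U - {j}" "?up as j"] Suc.prems by simp
  qed
  also have "\<dots> = place \<Phi> U as (replicate (Suc (Suc k)) w) +
      fscale (of_nat (Suc k)) (place \<Phi> U (?up as i) (replicate (Suc k) w))"
    by (simp add: sum.distrib replicate_Suc[of "Suc k"] del: replicate_Suc) (simp add: free.scale_sum_right)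
  finally show ?case
    using free.scale_left_distrib[of 1 "of_nat (Suc k)" "place \<Phi> U (?up as i) (replicate (Suc k) w)"]
    by (simp add: add_ac del: replicate_Suc of_nat_Suc) (simp add: add_ac)
qed

end

section \<open>Summing the exponential series on a list of arguments\<close>

locale char0_free_algebra = free_algebra P sV
  for P :: "('k::field_char_0, 'p::ab_group_add) operad_data"
    and sV :: "'k \<Rightarrow> 'v::ab_group_add \<Rightarrow> 'v"
begin

text \<open>Each term of order k runs over ordered choices of positions, so 1/k! leaves one
  contribution for every subset of \<open>U\<close>. The sum over subsets is the expansion of \<Phi>
  with each entry a of \<open>U\<close> replaced by a + D w a.\<close>

lemma sum_place_replicate:
  fixes \<Phi> :: "_ \<Rightarrow> ('c \<Rightarrow>\<^sub>0 'k)"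
  assumes add: "\<And>as i a b. length as = L \<Longrightarrow> i < L \<Longrightarrow> \<Phi> (as[i := a + b]) = \<Phi> (as[i := a]) + \<Phi> (as[i := b])"
    and "finite U" "U \<subseteq> {..<L}" "length as = L" "card U \<le> K"
  shows "(\<Sum>k\<le>K. fscale (inverse (fact k)) (place \<Phi> U as (replicate k w))) =
    \<Phi> (map (\<lambda>i. if i \<in> U then as ! i + D w (as ! i) else as ! i) [0..<L])"
  using assms(2-)
proof (induction U arbitrary: as K rule: finite_induct)
  case empty
  have "(\<Sum>k\<le>K. fscale (inverse (fact k)) (place \<Phi> {} as (replicate k w))) =
      (\<Sum>k\<in>{0}. fscale (inverse (fact k)) (place \<Phi> {} as (replicate k w)))"
    by (rule sum.mono_neutral_right) (auto simp: place_eq_0)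
  moreover have "map ((!) as) [0..<L] = as" using empty map_nth[of as] by simp
  ultimately show ?case by simp
next
  case (insert i U)
  \<comment> \<open>When one operator is spent on \<open>i\<close>, the index drops by one; the
    bound \<open>K'\<close> still reaches \<open>card U\<close>, so no term is lost.\<close>
  obtain K' where K: "K = Suc K'" "card U \<le> K'" using insert by (cases K) auto
  have i: "i < length as" using insert.prems by auto
  let ?e = "\<lambda>U as k. fscale (inverse (fact k) :: 'k) (place \<Phi> U as (replicate k w))"
  let ?as = "as[i := D w (as ! i)]"
  have e: "?e (insert i U) as (Suc k) = ?e U as (Suc k) + ?e U ?as k" for k
  proof -
    have "inverse (fact (Suc k)) * of_nat (Suc k) = (inverse (fact k) :: 'k)"
      unfolding fact_Suc by (simp add: field_simps del: of_nat_Suc)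
    then show ?thesis
      unfolding place_insert_replicate[OF insert.hyps i] free.scale_right_distrib free.scale_scale by simp
  qed
  have "(\<Sum>k\<le>K. ?e (insert i U) as k) = ?e U as 0 + (\<Sum>k\<le>K'. ?e U as (Suc k)) + (\<Sum>k\<le>K'. ?e U ?as k)"
    unfolding K(1) sum.atMost_Suc_shift e sum.distrib by (simp add: add.assoc)
  also have "?e U as 0 + (\<Sum>k\<le>K'. ?e U as (Suc k)) = (\<Sum>k\<le>K. ?e U as k)"
    unfolding K(1) sum.atMost_Suc_shift ..
  also have "\<dots> = \<Phi> (map (\<lambda>j. if j \<in> U then as ! j + D w (as ! j) else as ! j) [0..<L])"
    using insert K by (intro insert.IH) auto
  also have "(\<Sum>k\<le>K'. ?e U ?as k) = \<Phi> (map (\<lambda>j. if j \<in> U then ?as ! j + D w (?as ! j) else ?as ! j) [0..<L])"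
    using insert K by (intro insert.IH) auto
  also have "map (\<lambda>j. if j \<in> U then ?as ! j + D w (?as ! j) else ?as ! j) [0..<L] =
      (map (\<lambda>j. if j \<in> U then as ! j + D w (as ! j) else as ! j) [0..<L])[i := D w (as ! i)]"
    using insert i by (intro nth_equalityI) (auto simp: nth_list_update)
  also have "map (\<lambda>j. if j \<in> U then as ! j + D w (as ! j) else as ! j) [0..<L] =
      (map (\<lambda>j. if j \<in> U then as ! j + D w (as ! j) else as ! j) [0..<L])[i := as ! i]"
    using insert i by (intro nth_equalityI) (auto simp: nth_list_update)
  \<comment> \<open>The subsets without \<open>i\<close> and those with \<open>i\<close> combine by
    additivity of \<Phi> in slot \<open>i\<close>.\<close>
  also have "\<Phi> \<dots> + \<Phi> ((map (\<lambda>j. if j \<in> U then as ! j + D w (as ! j) else as ! j) [0..<L])[i := as ! i, i := D w (as ! i)]) =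
      \<Phi> ((map (\<lambda>j. if j \<in> U then as ! j + D w (as ! j) else as ! j) [0..<L])[i := as ! i + D w (as ! i)])"
    using add[of "map (\<lambda>j. if j \<in> U then as ! j + D w (as ! j) else as ! j) [0..<L]" i] insert i by simp
  also have "(map (\<lambda>j. if j \<in> U then as ! j + D w (as ! j) else as ! j) [0..<L])[i := as ! i + D w (as ! i)] =
      map (\<lambda>j. if j \<in> insert i U then as ! j + D w (as ! j) else as ! j) [0..<L]"
    using insert i by (intro nth_equalityI) (auto simp: nth_list_update)
  finally show ?case .
qed

end

section \<open>Linearity and convergence of the action of symmetric powers\<close>

context free_algebra
begin

lemma coinv_unit_in_M: "coinv_unit Q \<in> M"
  unfolding M_iff
proof (intro conjI allI impI)
  fix n :: nat
  have "opunit Q \<in> ar Q 1"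
    using pure_op_in_Q[OF unit_ar unitC_in_arC] by (simp add: Q_simps(3))
  then show "coinv_unit Q n \<in> coinv Q n"
    by (auto simp: coinv_unit_def coinv_mapI free.subspace_0[OF subspace_coinv] simp del: One_nat_def)
qed (simp add: coinv_unit_def)

lemma M_add: "x \<in> M \<Longrightarrow> y \<in> M \<Longrightarrow> x + y \<in> M"
  by (simp add: M_iff free.subspace_add[OF subspace_coinv])

lemma M_diff: "x \<in> M \<Longrightarrow> y \<in> M \<Longrightarrow> x - y \<in> M"
  by (simp add: M_iff free.subspace_diff[OF subspace_coinv])

lemma eval_add: "eval (x + y) v = eval x v + eval y v"
  by (auto simp: eval_def lin_add[OF linear_ev])

lemma eval_diff: "eval (x - y) v = eval x v - eval y v"
  by (auto simp: eval_def lin_diff[OF linear_ev])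

lemma eval_coinv_unit: "eval (coinv_unit Q) v = emb P sV v"
proof
  fix n :: nat
  have "ev 1 (opunit Q) v = dot P sV 1 (opunit P) (word sV [v])"
    using ev_pure_op[OF unit_ar unitC_in_arC, of v] unfolding Q_simps(3) by (simp add: coend_simps(4))
  then show "eval (coinv_unit Q) v n = emb P sV v n"
    by (simp add: eval_def coinv_unit_def emb_def ev_coinv_map lin_0[OF linear_ev] del: One_nat_def)
qed

lemma sym_act_Cons:
  "sym_act P sV z (x # xs) = D x (sym_act P sV z xs) - (\<Sum>i<length xs. sym_act P sV z (xs[i := prelie Q (xs ! i) x]))"
  by (simp add: D_def)

lemma sym_act_add: "sym_act P sV (a + b) xs = sym_act P sV a xs + sym_act P sV b xs"
proof (induction xs rule: length_induct)
  case (1 xs)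
  show ?case
  proof (cases xs)
    case (Cons x ys)
    have 2: "sym_act P sV (a + b) zs = sym_act P sV a zs + sym_act P sV b zs" if "length zs = length ys" for zs
    proof -
      have "length zs < length xs" using Cons that by simp
      then show ?thesis by (rule 1[rule_format])
    qed
    have "(\<Sum>i<length ys. sym_act P sV (a + b) (ys[i := prelie Q (ys ! i) x])) =
        (\<Sum>i<length ys. sym_act P sV a (ys[i := prelie Q (ys ! i) x])) + (\<Sum>i<length ys. sym_act P sV b (ys[i := prelie Q (ys ! i) x]))"
      unfolding sum.distrib[symmetric] by (rule sum.cong) (simp_all only: 2 length_list_update)
    then show ?thesis unfolding Cons sym_act_Cons 2[OF refl] D_add by (simp only: add_diff_add)
  qed simp
qed

lemma sym_act_scale: "sym_act P sV (\<lambda>n. fscale c (a n)) xs = (\<lambda>n. fscale c (sym_act P sV a xs n))"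
proof (induction xs rule: length_induct)
  case (1 xs)
  show ?case
  proof (cases xs)
    case (Cons x ys)
    have 2: "sym_act P sV (\<lambda>n. fscale c (a n)) zs = (\<lambda>n. fscale c (sym_act P sV a zs n))" if "length zs = length ys" for zs
    proof -
      have "length zs < length xs" using Cons that by simp
      then show ?thesis by (rule 1[rule_format])
    qed
    have "(\<Sum>i<length ys. sym_act P sV (\<lambda>n. fscale c (a n)) (ys[i := prelie Q (ys ! i) x])) N =
        fscale c ((\<Sum>i<length ys. sym_act P sV a (ys[i := prelie Q (ys ! i) x])) N)" for N
      unfolding sum_fun_apply free.scale_sum_right by (rule sum.cong) (simp_all only: 2 length_list_update)
    then show ?thesis unfolding Cons sym_act_Cons 2[OF refl] D_scale
      by (intro ext) (simp add: free.scale_right_diff_distrib)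
  qed simp
qed

lemma sym_act_in_Fbar:
  assumes "z \<in> F" "set xs \<subseteq> M" shows "sym_act P sV z xs \<in> F"
  using assms(2)
proof (induction xs rule: length_induct)
  case (1 xs)
  show ?case
  proof (cases xs)
    case Nil
    then show ?thesis using assms(1) by simp
  next
    case (Cons x ys)
    have x: "x \<in> M" and ys: "set ys \<subseteq> M" using 1 Cons by auto
    have "set (ys[i := prelie Q (ys ! i) x]) \<subseteq> M" if "i < length ys" for i
    proof -
      have "prelie Q (ys ! i) x \<in> M" using that x ys by (intro prelie_in_M) auto
      then show ?thesis using ys set_update_subset_insert[of ys i] by blast
    qed
    then show ?thesis unfolding Cons sym_act_Cons using 1(1) Cons ys
      by (intro Fbar_diff Fbar_sum D_in_Fbar[OF x]) auto
  qed
qed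

lemma sym_act_vanishes:
  assumes "vanishes N z" shows "vanishes N (sym_act P sV z xs)"
proof (induction xs rule: length_induct)
  case (1 xs)
  show ?case
  proof (cases xs)
    case Nil
    then show ?thesis using assms by simp
  next
    case (Cons x ys)
    have 2: "vanishes N (sym_act P sV z zs)" if "length zs = length ys" for zs
    proof -
      have "length zs < length xs" using Cons that by simp
      then show ?thesis by (rule 1[rule_format])
    qed
    have 3: "vanishes N (D x (sym_act P sV z ys))" by (intro D_vanishes 2) simp
    have "vanishes N (sym_act P sV z (ys[i := prelie Q (ys ! i) x]))" for i by (intro 2) simp
    then show ?thesis unfolding Cons sym_act_Cons using 3
      by (simp add: vanishes_def sum_fun_apply)
  qed
qed

text \<open>On a monomial with fewer letters than factors the action is zero, as the positions run
  out. A monomial with at least as many letters starts in degree at least \<open>length xs\<close>,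
  and the action never lowers the valuation. This makes the exponential series finite in each
  degree.\<close>

lemma sym_act_high:
  assumes z: "z \<in> F" and xs: "set xs \<subseteq> M" and N: "N < length xs"
  shows "sym_act P sV z xs N = 0"
proof -
  \<comment> \<open>Packing the components below \<open>length xs\<close> into one additive
    continuous map turns the claim into the vanishing of that map, which may be tested on
    monomials.\<close>
  let ?f = "\<lambda>z N. if N < length xs then sym_act P sV z xs N else 0"
  have "?f z = 0"
  proof (rule contin_eq_0[where f = ?f, OF _ _ z])
    show "contin ?f"
    proof (rule continI)
      show "?f (x + y) = ?f x + ?f y" for x y by (auto simp: sym_act_add)
      show "vanishes N (?f x)" if "vanishes N x" for N x
        using sym_act_vanishes[OF that, of xs] by (simp add: vanishes_def)
    qed
    fix q and vs :: "'v list" assume q: "q \<in> ar P (length vs)" "vs \<noteq> []"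
    show "?f (hmon q vs) = 0"
    proof
      fix N
      show "?f (hmon q vs) N = 0 N"
      proof (cases "length vs < length xs")
        case True
        have "prim a" if "a \<in> set (map (emb P sV) vs)" for a using that prim_emb by auto
        then have "sym_act P sV (hmon q vs) xs = place (aop q) {..<length vs} (map (emb P sV) vs) (rev xs)"
          using sym_act_prims[of q "map (emb P sV) vs" xs] q xs by (simp add: hmon_eq_aop)
        also have "\<dots> = 0" using True by (intro place_eq_0) simp_all
        finally show ?thesis by simp
      next
        case False
        have "vanishes (length vs - 1) (hmon q vs)"
          using q(2) by (auto simp: hmon_def hom_deg_def vanishes_def) (metis Suc_pred diff_Suc_1 le_imp_less_Suc length_greater_0_conv less_irrefl)
        from sym_act_vanishes[OF this, of xs] show ?thesis
          using False q(2) by (auto simp: vanishes_def)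
      qed
    qed
  qed
  then have "?f z N = 0 N" by (rule fun_cong)
  then show ?thesis using N by simp
qed

lemma place_apply: "place \<Phi> U as ws N = place (\<lambda>as. \<Phi> as N) U as ws"
  by (induction ws arbitrary: U as) (simp_all add: sum_fun_apply)

section \<open>Endomorphisms\<close>

text \<open>These conditions determine a map by its values on generators, scalars being absorbed in
  the operadic coefficients. Homogeneity joins them in \<open>E_iff\<close>.\<close>

definition hom_F :: "((nat \<Rightarrow> ('p \<times> ('v list \<Rightarrow>\<^sub>0 'k) \<Rightarrow>\<^sub>0 'k)) \<Rightarrow> (nat \<Rightarrow> ('p \<times> ('v list \<Rightarrow>\<^sub>0 'k) \<Rightarrow>\<^sub>0 'k))) \<Rightarrow> bool" where
  "hom_F f \<longleftrightarrow> contin f \<and> (\<forall>x\<in>F. f x \<in> F) \<and>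
     (\<forall>p as. p \<in> ar P (length as) \<longrightarrow> set as \<subseteq> F \<longrightarrow> f (aop p as) = aop p (map f as))"

text \<open>If an argument is \<open>aop q bs\<close>, the nested operation is unfolded into a
  partial composite, \<open>f\<close> passes to the arguments, and the result is folded again. This
  reaches all monomials from the generators, and continuity does the rest.\<close>

lemma hom_F_I:
  assumes f: "contin f" "\<And>x. x \<in> F \<Longrightarrow> f x \<in> F"
    and e: "\<And>p us. p \<in> ar P (length us) \<Longrightarrow> us \<noteq> [] \<Longrightarrow> f (aop p (map (emb P sV) us)) = aop p (map f (map (emb P sV) us))"
  shows "hom_F f"
  unfolding hom_F_def
proof (intro conjI ballI allI impI)
  have add: "f (x + y) = f x + f y" if "x \<in> F" "y \<in> F" for x y using f(1) that by (simp add: contin_def)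
  have f0: "f 0 = 0" using add[OF Fbar_zero Fbar_zero] by simp
  let ?R = "\<lambda>p as. f (aop p as) = aop p (map f as)"
  have hm: "?R p (hmons ps)"
    if "\<And>q xs. (q, xs) \<in> set ps \<Longrightarrow> q \<in> ar P (length xs) \<and> xs \<noteq> []" "p \<in> ar P (length ps)" for p ps
    using _ _ that
  proof (rule hmons_induct[where R = ?R])
    fix p and us :: "'v list" assume p: "p \<in> ar P (length us)"
    show "?R p (map (emb P sV) us)"
      using e[OF p] aop_Nil[of p] p f0 by (cases "us = []") simp_all
  next
    fix p q as bs cs
    assume p: "p \<in> ar P (length as + 1 + length cs)" and q: "q \<in> ar P (length bs)" "bs \<noteq> []"
      and F: "set as \<subseteq> F" "set bs \<subseteq> F" "set cs \<subseteq> F"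
      and IH: "?R (circ P (length as + 1 + length cs) (length bs) (length as) p q) (as @ bs @ cs)" "?R q bs"
    let ?c = "circ P (length as + 1 + length cs) (length bs) (length as) p q"
    have F': "set (map f as) \<subseteq> F" if "set as \<subseteq> F" for as using that f(2) by auto
    have "f (aop p (as @ aop q bs # cs)) = f (aop ?c (as @ bs @ cs))"
      by (simp only: aop_circ[OF p q F])
    also have "\<dots> = aop ?c (map f as @ map f bs @ map f cs)" unfolding IH(1) by simp
    also have "\<dots> = aop p (map f as @ aop q (map f bs) # map f cs)"
      using aop_circ[of p "map f as" "map f cs" q "map f bs"] p q F F' by simp
    finally show "?R p (as @ aop q bs # cs)" by (simp add: IH(2))
  qed
  fix p as assume p: "p \<in> ar P (length as)" and as: "set as \<subseteq> F"
  have "f (aop p as) - aop p (map f as) = 0"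
    using _ _ as refl
  proof (rule contin_list_eq_0[where \<Phi> = "\<lambda>as. f (aop p as) - aop p (map f as)"])
    fix xs k assume xs: "set xs \<subseteq> F" "length xs = length as" and k: "k < length as"
    have "contin (\<lambda>a. f (aop p (xs[k := a])))"
      using xs p k by (intro contin_compose[OF f(1) contin_aop] aop_in_Fbar set_list_update_subset) auto
    moreover have "contin (\<lambda>a. aop p ((map f xs)[k := f a]))"
      using xs k by (intro contin_compose[OF contin_aop f(1) f(2)]) auto
    ultimately show "contin (\<lambda>a. f (aop p (xs[k := a])) - aop p (map f (xs[k := a])))"
      by (simp only: map_update contin_diff)
  next
    fix ps :: "('p \<times> 'v list) list"
    assume "length ps = length as" "\<And>q xs. (q, xs) \<in> set ps \<Longrightarrow> q \<in> ar P (length xs) \<and> xs \<noteq> []"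
    with hm[of ps p] p have "f (aop p (hmons ps)) = aop p (map f (hmons ps))" by simp
    then show "f (aop p (hmons ps)) - aop p (map f (hmons ps)) = 0" by (simp only: diff_self)
  qed
  then show "f (aop p as) = aop p (map f as)" by simp
qed (use f in auto)

lemma hom_F_ext:
  assumes f: "hom_F f" and g: "hom_F g" and e: "\<And>v. f (emb P sV v) = g (emb P sV v)" and x: "x \<in> F"
  shows "f x = g x"
proof -
  have "f x - g x = 0"
  proof (rule contin_eq_0[where f = "\<lambda>x. f x - g x", OF contin_diff _ x])
    show "contin f" "contin g" using f g by (simp_all add: hom_F_def)
    fix q and vs :: "'v list" assume q: "q \<in> ar P (length vs)" "vs \<noteq> []"
    have em: "set (map (emb P sV) vs) \<subseteq> F" using emb_in_Fbar by auto
    have "f (hmon q vs) = aop q (map f (map (emb P sV) vs))"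
      using f q(1) em unfolding hom_F_def hmon_eq_aop[OF q(1)] by simp
    also have "\<dots> = aop q (map g (map (emb P sV) vs))" by (simp add: e comp_def)
    also have "\<dots> = g (hmon q vs)"
      using g q(1) em unfolding hom_F_def hmon_eq_aop[OF q(1)] by simp
    finally show "f (hmon q vs) - g (hmon q vs) = 0" by (simp only: diff_self)
  qed
  then show ?thesis by simp
qed

lemma hom_F_compose: "hom_F f \<Longrightarrow> hom_F g \<Longrightarrow> hom_F (\<lambda>x. f (g x))"
proof -
  assume f: "hom_F f" and g: "hom_F g"
  have "f (g (aop p as)) = aop p (map (\<lambda>x. f (g x)) as)" if "p \<in> ar P (length as)" "set as \<subseteq> F" for p as
  proof -
    have "set (map g as) \<subseteq> F" using g that(2) by (auto simp: hom_F_def)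
    then have "f (aop p (map g as)) = aop p (map f (map g as))" using f that(1) by (simp add: hom_F_def)
    then show ?thesis using g that by (simp add: hom_F_def comp_def)
  qed
  then show ?thesis
    using f g unfolding hom_F_def by (blast intro: contin_compose)
qed

lemma hom_F_id: "hom_F (\<lambda>x. x)"
proof -
  have "contin (\<lambda>x. x)" by (rule continI) (rule refl)
  then show ?thesis by (simp add: hom_F_def)
qed

section \<open>The valuation topology and the monoid of continuous endomorphisms\<close>

lemma vdist_less_iff: "vdist x y < 1 / 2 ^ N \<longleftrightarrow> vanishes N (x - y)"
  for x y :: "nat \<Rightarrow> 'a::ab_group_add"
proof (cases "x = y")
  case True
  then show ?thesis by (simp add: vdist_def vanishes_def)
next
  case False
  then obtain n where n: "(x - y) n \<noteq> 0" by (force simp: fun_eq_iff)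
  have "vdist x y < 1 / 2 ^ N \<longleftrightarrow> N < val (x - y)"
    using False by (simp add: vdist_def field_simps)
  also have "\<dots> \<longleftrightarrow> vanishes N (x - y)"
  proof
    assume N: "N < val (x - y)"
    show "vanishes N (x - y)"
      unfolding vanishes_def
    proof (intro allI impI)
      fix m assume "m \<le> N"
      then have "m < (LEAST n. (x - y) n \<noteq> 0)" using N by (simp only: val_def)
      then show "(x - y) m = 0" using not_less_Least by blast
    qed
  next
    assume v: "vanishes N (x - y)"
    have "(x - y) (val (x - y)) \<noteq> 0" unfolding val_def by (rule LeastI[of "\<lambda>n. (x - y) n \<noteq> 0", OF n])
    then show "N < val (x - y)" using v unfolding vanishes_def by (meson not_le)
  qed
  finally show ?thesis .
qed

lemma small_power: "0 < e \<Longrightarrow> \<exists>N. 1 / 2 ^ N < (e::real)"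
  using real_arch_pow_inv[of e "1 / 2"] by (simp add: power_one_over)

text \<open>The distance is invariant under translation, so an additive map is continuous as soon as
  it is continuous at zero. The radii \<open>1 / 2 ^ N\<close> suffice, and they correspond to
  vanishing up to degree \<open>N\<close>.\<close>

lemma continuous_iff_contin:
  assumes F: "\<And>x. x \<in> F \<Longrightarrow> f x \<in> F" and add: "\<And>x y. x \<in> F \<Longrightarrow> y \<in> F \<Longrightarrow> f (x + y) = f x + f y"
  shows "continuous_map (Ftop P sV) (Ftop P sV) f \<longleftrightarrow> contin f"
proof -
  interpret m: Metric_space F vdist by (rule Metric_space_vdist)
  have diff: "f x - f y = f (x - y)" if "x \<in> F" "y \<in> F" for x y
    using add[OF Fbar_diff[OF that] that(2)] by (simp add: algebra_simps)
  have f0: "f 0 = 0" using add[OF Fbar_zero Fbar_zero] by simp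
  have "continuous_map (Ftop P sV) (Ftop P sV) f \<longleftrightarrow>
      (\<forall>a\<in>F. \<forall>e>0. \<exists>d>0. \<forall>x. x \<in> F \<and> vdist a x < d \<longrightarrow> vdist (f a) (f x) < e)"
    using F by (subst m.metric_continuous_map[OF Metric_space_vdist]) auto
  also have "\<dots> \<longleftrightarrow> (\<forall>N. \<exists>M. \<forall>x\<in>F. vanishes M x \<longrightarrow> vanishes N (f x))"
  proof (intro iffI allI ballI impI)
    fix N assume c: "\<forall>a\<in>F. \<forall>e>0. \<exists>d>0. \<forall>x. x \<in> F \<and> vdist a x < d \<longrightarrow> vdist (f a) (f x) < e"
    then obtain d where d: "d > 0" "\<And>x. x \<in> F \<Longrightarrow> vdist 0 x < d \<Longrightarrow> vdist (f 0) (f x) < 1 / 2 ^ N"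
      using Fbar_zero by (metis zero_less_divide_1_iff zero_less_numeral zero_less_power)
    obtain M where M: "1 / 2 ^ M < d" using small_power[OF d(1)] by blast
    have "vanishes N (f x)" if "x \<in> F" "vanishes M x" for x
    proof -
      have "vanishes M (0 - x)" using that(2) by (simp add: vanishes_def)
      then have "vdist 0 x < 1 / 2 ^ M" by (simp only: vdist_less_iff)
      then have "vdist (f 0) (f x) < 1 / 2 ^ N" using M by (intro d that(1)) simp
      then have "vanishes N (f 0 - f x)" by (simp only: vdist_less_iff)
      then show ?thesis unfolding f0 by (simp add: vanishes_def)
    qed
    then show "\<exists>M. \<forall>x\<in>F. vanishes M x \<longrightarrow> vanishes N (f x)" by blast
  next
    fix a and e :: real assume v: "\<forall>N. \<exists>M. \<forall>x\<in>F. vanishes M x \<longrightarrow> vanishes N (f x)" and a: "a \<in> F" and e: "0 < e"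
    obtain N where N: "1 / 2 ^ N < e" using small_power[OF e] by blast
    obtain M where M: "\<And>x. x \<in> F \<Longrightarrow> vanishes M x \<Longrightarrow> vanishes N (f x)" using v by blast
    have "vdist (f a) (f x) < e" if "x \<in> F" "vdist a x < 1 / 2 ^ M" for x
    proof -
      have "vanishes M (a - x)" using that(2) by (simp only: vdist_less_iff)
      then have "vanishes N (f a - f x)" unfolding diff[OF a that(1)] by (intro M Fbar_diff a that(1))
      then have "vdist (f a) (f x) < 1 / 2 ^ N" by (simp only: vdist_less_iff)
      then show ?thesis using N by simp
    qed
    then show "\<exists>d>0. \<forall>x. x \<in> F \<and> vdist a x < d \<longrightarrow> vdist (f a) (f x) < e"
      by (intro exI[of _ "1 / 2 ^ M"]) auto
  qed
  also have "\<dots> \<longleftrightarrow> contin f" using add unfolding contin_def by blast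
  finally show ?thesis .
qed

abbreviation E where "E \<equiv> carrier (cont_endos P sV)"

lemma E_iff:
  "f \<in> E \<longleftrightarrow> f \<in> F \<rightarrow>\<^sub>E F \<and> hom_F f \<and> (\<forall>c. \<forall>x\<in>F. f (\<lambda>n. fscale c (x n)) = (\<lambda>n. fscale c (f x n)))"
proof -
  have *: "(\<forall>m. \<forall>p\<in>ar P m. \<forall>xs. length xs = m \<and> set xs \<subseteq> F \<longrightarrow> f (aop p xs) = aop p (map f xs)) \<longleftrightarrow>
      (\<forall>p as. p \<in> ar P (length as) \<longrightarrow> set as \<subseteq> F \<longrightarrow> f (aop p as) = aop p (map f as))"
    by blast
  have "f \<in> E \<longleftrightarrow> f \<in> F \<rightarrow>\<^sub>E F \<and> (\<forall>x\<in>F. \<forall>y\<in>F. f (x + y) = f x + f y) \<and>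
     (\<forall>c. \<forall>x\<in>F. f (\<lambda>n. fscale c (x n)) = (\<lambda>n. fscale c (f x n))) \<and>
     (\<forall>p as. p \<in> ar P (length as) \<longrightarrow> set as \<subseteq> F \<longrightarrow> f (aop p as) = aop p (map f as)) \<and>
     continuous_map (Ftop P sV) (Ftop P sV) f"
    by (simp add: cont_endos_def alg_endo_def * conj_ac)
  also have "\<dots> \<longleftrightarrow> f \<in> F \<rightarrow>\<^sub>E F \<and> (\<forall>x\<in>F. \<forall>y\<in>F. f (x + y) = f x + f y) \<and>
     (\<forall>c. \<forall>x\<in>F. f (\<lambda>n. fscale c (x n)) = (\<lambda>n. fscale c (f x n))) \<and>
     (\<forall>p as. p \<in> ar P (length as) \<longrightarrow> set as \<subseteq> F \<longrightarrow> f (aop p as) = aop p (map f as)) \<and> contin f"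
    using continuous_iff_contin[of f] by (auto simp: PiE_iff)
  also have "\<dots> \<longleftrightarrow> f \<in> F \<rightarrow>\<^sub>E F \<and> hom_F f \<and> (\<forall>c. \<forall>x\<in>F. f (\<lambda>n. fscale c (x n)) = (\<lambda>n. fscale c (f x n)))"
    unfolding hom_F_def contin_def by (auto simp: PiE_iff)
  finally show ?thesis .
qed

lemma hom_F_restrict: "hom_F f \<Longrightarrow> hom_F (restrict f F)"
proof -
  assume f: "hom_F f"
  have 1: "map (restrict f F) as = map f as" if "set as \<subseteq> F" for as using that by auto
  show ?thesis
    using f unfolding hom_F_def contin_def
    by (simp add: Fbar_add aop_in_Fbar 1)
qed

lemma E_ext:
  assumes "f \<in> E" "g \<in> E" "\<And>v. f (emb P sV v) = g (emb P sV v)"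
  shows "f = g"
proof (rule extensionalityI[of _ F])
  show "f \<in> extensional F" "g \<in> extensional F" using assms by (auto simp: E_iff PiE_iff)
  show "f x = g x" if "x \<in> F" for x
    by (rule hom_F_ext[where f = f and g = g, OF _ _ assms(3) that]) (use assms(1,2) in \<open>simp_all add: E_iff\<close>)
qed

lemma E_compose: "f \<in> E \<Longrightarrow> g \<in> E \<Longrightarrow> compose F f g \<in> E"
proof -
  assume f: "f \<in> E" and g: "g \<in> E"
  have "hom_F (compose F f g)"
    unfolding compose_def
    by (rule hom_F_restrict, rule hom_F_compose) (use f g in \<open>simp_all add: E_iff\<close>)
  moreover have "compose F f g \<in> F \<rightarrow>\<^sub>E F"
    using f g by (auto simp: E_iff compose_def)
  ultimately show ?thesis
    using f g Fbar_scale by (auto simp: E_iff compose_def PiE_iff)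
qed

lemma E_id: "(\<lambda>x\<in>F. x) \<in> E"
  unfolding E_iff using hom_F_restrict[OF hom_F_id] Fbar_scale by auto

lemma monoid_cont_endos: "monoid (cont_endos P sV)"
proof (rule monoidI)
  show "\<one>\<^bsub>cont_endos P sV\<^esub> \<in> E" using E_id by (simp add: cont_endos_def)
  show "x \<otimes>\<^bsub>cont_endos P sV\<^esub> y \<in> E" if "x \<in> E" "y \<in> E" for x y
    using E_compose[OF that] by (simp add: cont_endos_def)
  fix x y z assume x: "x \<in> E" "y \<in> E" "z \<in> E"
  then have F: "x \<in> F \<rightarrow> F" "y \<in> F \<rightarrow> F" "z \<in> F \<rightarrow> F" "x \<in> extensional F"
    by (auto simp: E_iff PiE_iff)
  show "x \<otimes>\<^bsub>cont_endos P sV\<^esub> y \<otimes>\<^bsub>cont_endos P sV\<^esub> z = x \<otimes>\<^bsub>cont_endos P sV\<^esub> (y \<otimes>\<^bsub>cont_endos P sV\<^esub> z)"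
    using F by (simp add: cont_endos_def compose_assoc[symmetric, OF F(3)])
  show "\<one>\<^bsub>cont_endos P sV\<^esub> \<otimes>\<^bsub>cont_endos P sV\<^esub> x = x" "x \<otimes>\<^bsub>cont_endos P sV\<^esub> \<one>\<^bsub>cont_endos P sV\<^esub> = x"
    using F by (simp_all add: cont_endos_def Id_compose compose_Id)
qed

end

section \<open>The action of exp(y - I) as a continuous endomorphism\<close>

context char0_free_algebra
begin

text \<open>The terms of order above \<open>N\<close> vanish in degree \<open>N\<close>, so any
  cutoff from \<open>N\<close> on gives the same value. The freedom in \<open>K\<close> allows the
  cutoff to meet further bounds.\<close>

lemma md_act_eq:
  assumes z: "z \<in> F" and y: "y \<in> M" and K: "N \<le> K"
  shows "md_act P sV z y N =
    (\<Sum>k\<le>K. fscale (inverse (fact k)) (sym_act P sV z (replicate k (y - coinv_unit Q)) N))"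
  unfolding md_act_def
proof (rule Sum_any.expand_superset)
  have w: "y - coinv_unit Q \<in> M" by (rule M_diff[OF y coinv_unit_in_M])
  show "{k. fscale (inverse (fact k)) (sym_act P sV z (replicate k (y - coinv_unit Q)) N) \<noteq> 0} \<subseteq> {..K}"
  proof
    fix k assume "k \<in> {k. fscale (inverse (fact k)) (sym_act P sV z (replicate k (y - coinv_unit Q)) N) \<noteq> 0}"
    then have "sym_act P sV z (replicate k (y - coinv_unit Q)) N \<noteq> 0" by auto
    moreover have "set (replicate k (y - coinv_unit Q)) \<subseteq> M" using w by auto
    ultimately have "k \<le> N" using sym_act_high[OF z, of "replicate k (y - coinv_unit Q)" N] by (cases "k \<le> N") auto
    then show "k \<in> {..K}" using K by simp
  qed
qed simp

lemma md_act_hmon: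
  assumes y: "y \<in> M" and p: "p \<in> ar P (length vs)" "vs \<noteq> []"
  shows "md_act P sV (hmon p vs) y = aop p (map (eval y) vs)"
proof
  fix N :: nat
  let ?w = "y - coinv_unit Q" and ?L = "length vs" and ?as = "map (emb P sV) vs"
  have w: "?w \<in> M" by (rule M_diff[OF y coinv_unit_in_M])
  have sa: "sym_act P sV (hmon p vs) (replicate k ?w) N = place (\<lambda>as. aop p as N) {..<?L} ?as (replicate k ?w)" for k
  proof -
    have "set (replicate k ?w) \<subseteq> M" using w by auto
    moreover have "prim a" if "a \<in> set ?as" for a using that prim_emb by auto
    ultimately have "sym_act P sV (aop p ?as) (replicate k ?w) = place (aop p) {..<?L} ?as (replicate k ?w)"
      using sym_act_prims[of p ?as "replicate k ?w"] p by simp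
    then show ?thesis by (simp add: hmon_eq_aop p place_apply)
  qed
  \<comment> \<open>The cutoff \<open>N + ?L\<close> is at least \<open>N\<close>, as the series
    requires, and at least the number \<open>?L\<close> of positions, as the summation over
    placements requires.\<close>
  have "md_act P sV (hmon p vs) y N =
      (\<Sum>k\<le>N + ?L. fscale (inverse (fact k)) (place (\<lambda>as. aop p as N) {..<?L} ?as (replicate k ?w)))"
    unfolding sa[symmetric] by (rule md_act_eq[OF hmon_in_Fbar[OF p] y]) simp
  also have "\<dots> = aop p (map (\<lambda>i. if i \<in> {..<?L} then ?as ! i + D ?w (?as ! i) else ?as ! i) [0..<?L]) N"
    by (rule sum_place_replicate) (simp_all add: aop_add)
  \<comment> \<open>The exponent is y - I, so a generator v together with its first order term is v
    + (y(v) - v) = y(v).\<close>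
  also have "map (\<lambda>i. if i \<in> {..<?L} then ?as ! i + D ?w (?as ! i) else ?as ! i) [0..<?L] = map (eval y) vs"
    by (intro nth_equalityI) (simp_all add: D_emb[OF w] eval_diff eval_coinv_unit)
  finally show "md_act P sV (hmon p vs) y N = aop p (map (eval y) vs) N" .
qed

lemma md_act_emb: "y \<in> M \<Longrightarrow> md_act P sV (emb P sV v) y = eval y v"
  using md_act_hmon[of y "opunit P" "[v]"] unit_ar
  by (simp add: emb_eq_hmon aop_unit eval_in_Fbar)

lemma md_act_add:
  assumes "y \<in> M" "a \<in> F" "b \<in> F"
  shows "md_act P sV (a + b) y = md_act P sV a y + md_act P sV b y"
  by (rule ext) (simp add: md_act_eq[OF _ assms(1) order_refl] Fbar_add assms sym_act_add
      free.scale_right_distrib sum.distrib)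

lemma md_act_scale:
  assumes "y \<in> M" "a \<in> F"
  shows "md_act P sV (\<lambda>n. fscale c (a n)) y = (\<lambda>n. fscale c (md_act P sV a y n))"
  by (rule ext) (simp add: md_act_eq[OF _ assms(1) order_refl] Fbar_scale assms sym_act_scale
      free.scale_sum_right mult.commute)

lemma md_act_vanishes:
  assumes "y \<in> M" "a \<in> F" "vanishes N a"
  shows "vanishes N (md_act P sV a y)"
  using sym_act_vanishes[OF assms(3)]
  by (simp add: vanishes_def md_act_eq[OF assms(2,1) order_refl])

lemma md_act_in_Fbar:
  assumes y: "y \<in> M" and a: "a \<in> F" shows "md_act P sV a y \<in> F"
proof (rule FbarI)
  have "set (replicate k (y - coinv_unit Q)) \<subseteq> M" for k using M_diff[OF y coinv_unit_in_M] by auto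
  note s = sym_act_in_Fbar[OF a this]
  show "md_act P sV a y 0 = 0" by (simp add: md_act_eq[OF a y order_refl] Fbar_at_0[OF a])
  show "md_act P sV a y n \<in> F_deg P sV n" if "0 < n" for n
    unfolding md_act_eq[OF a y order_refl]
    by (intro free.subspace_sum[OF subspace_F_deg] free.subspace_scale[OF subspace_F_deg] Fbar_deg s that)
qed

lemma hom_F_md_act:
  assumes y: "y \<in> M" shows "hom_F (\<lambda>x. md_act P sV x y)"
proof (rule hom_F_I)
  show "contin (\<lambda>x. md_act P sV x y)"
    unfolding contin_def using md_act_add[OF y] md_act_vanishes[OF y] by blast
  fix p and us :: "'v list" assume p: "p \<in> ar P (length us)" "us \<noteq> []"
  show "md_act P sV (aop p (map (emb P sV) us)) y = aop p (map (\<lambda>x. md_act P sV x y) (map (emb P sV) us))"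
    using md_act_hmon[OF y p] by (simp add: hmon_eq_aop[OF p(1)] md_act_emb[OF y] comp_def)
qed (rule md_act_in_Fbar[OF y])

lemma phi_in_E: "y \<in> M \<Longrightarrow> phi P sV y \<in> E"
  unfolding E_iff phi_def
  using hom_F_restrict[OF hom_F_md_act] md_act_in_Fbar md_act_scale Fbar_scale by auto

lemma phi_emb: "y \<in> M \<Longrightarrow> phi P sV y (emb P sV v) = eval y v"
  by (simp add: phi_def emb_in_Fbar md_act_emb)

end

text \<open>Maps such as \<open>dot\<close> in its tensor argument are linear only on a subspace of
  the ambient space. They still commute with \<open>lext\<close> when all values stay in that
  subspace.\<close>

lemma lin_on_lext:
  assumes S: "free.subspace S"
    and L: "\<And>u v. u \<in> S \<Longrightarrow> v \<in> S \<Longrightarrow> L (u + v) = L u + L v" "\<And>c u. u \<in> S \<Longrightarrow> L (fscale c u) = fscale c (L u)"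
    and g: "\<And>a. a \<in> Poly_Mapping.keys u \<Longrightarrow> g a \<in> S"
  shows "L (lext g u) = lext (\<lambda>a. L (g a)) u"
proof -
  have L0: "L 0 = 0" using L(2)[OF free.subspace_0[OF S], of 0] by simp
  have "L (\<Sum>a\<in>A. fscale (c a) (g a)) = (\<Sum>a\<in>A. fscale (c a) (L (g a))) \<and> (\<Sum>a\<in>A. fscale (c a) (g a)) \<in> S"
    if "A \<subseteq> Poly_Mapping.keys u" for A c
    using finite_subset[OF that finite_keys] that
  proof (induction A rule: finite_induct)
    case empty
    show ?case using L0 free.subspace_0[OF S] by simp
  next
    case (insert a A)
    then have "fscale (c a) (g a) \<in> S" using g by (intro free.subspace_scale[OF S]) auto
    then show ?case using insert L g by (simp add: free.subspace_add[OF S])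
  qed
  then show ?thesis unfolding lext_def by blast
qed

context free_algebra
begin

section \<open>The monoid product\<close>

lemma fcomp_from_add:
  "fam ns qs \<Longrightarrow> p \<in> ar P a \<Longrightarrow> p' \<in> ar P a \<Longrightarrow> i + length ns \<le> a \<Longrightarrow>
    fcomp_from P a i (p + p') ns qs = fcomp_from P a i p ns qs + fcomp_from P a i p' ns qs"
proof (induction arbitrary: a i p p' rule: list_all2_induct)
  case (Cons n ns q qs)
  have "circ P a n i p q \<in> ar P (a + n - 1)" "circ P a n i p' q \<in> ar P (a + n - 1)"
    by (intro circ_ar; use Cons in simp)+
  from Cons.IH[OF this, of "i + n"] show ?case using Cons by (simp add: circ_add_left)
qed simp

lemma fcomp_from_scale:
  "fam ns qs \<Longrightarrow> p \<in> ar P a \<Longrightarrow> i + length ns \<le> a \<Longrightarrow>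
    fcomp_from P a i (scl P c p) ns qs = scl P c (fcomp_from P a i p ns qs)"
proof (induction arbitrary: a i p rule: list_all2_induct)
  case (Cons n ns q qs)
  have "circ P a n i p q \<in> ar P (a + n - 1)"
    using Cons by (intro circ_ar) auto
  from Cons.IH[OF this, of "i + n"] show ?case using Cons by (simp add: circ_scale_left)
qed simp

lemma F_op_op:
  assumes p: "p \<in> ar P (length ns)" "p' \<in> ar P (length ns)"
    and us: "list_all2 (\<lambda>n u. 0 < n \<and> u \<in> F_deg P sV n) ns us"
  shows "F_op P sV (p + p') ns us = F_op P sV p ns us + F_op P sV p' ns us"
    and "F_op P sV (scl P c p) ns us = fscale c (F_op P sV p ns us)"
proof -
  note good = good_keys[OF us]
  have cong: "mlext g us = mlext h us" if "\<And>l. list_all2 (\<lambda>a u. a \<in> Poly_Mapping.keys u) l us \<Longrightarrow> g l = h l"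
    for g h :: "('p \<times> ('v list \<Rightarrow>\<^sub>0 'k)) list \<Rightarrow> ('p \<times> ('v list \<Rightarrow>\<^sub>0 'k) \<Rightarrow>\<^sub>0 'k)"
    using that
  proof (induction us arbitrary: g h)
    case (Cons u us)
    show ?case
      unfolding mlext.simps by (intro lext_cong Cons.IH Cons.prems) simp
  qed simp
  have add: "mlext (\<lambda>l. g l + h l) us = mlext g us + mlext h us"
    for g h :: "('p \<times> ('v list \<Rightarrow>\<^sub>0 'k)) list \<Rightarrow> ('p \<times> ('v list \<Rightarrow>\<^sub>0 'k) \<Rightarrow>\<^sub>0 'k)"
    by (induction us arbitrary: g h) (simp_all add: lext_fun_add)
  have scale: "mlext (\<lambda>l. fscale c (g l)) us = fscale c (mlext g us)"
    for g :: "('p \<times> ('v list \<Rightarrow>\<^sub>0 'k)) list \<Rightarrow> ('p \<times> ('v list \<Rightarrow>\<^sub>0 'k) \<Rightarrow>\<^sub>0 'k)"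
    by (induction us arbitrary: g) (simp_all add: lext_fun_scale)
  let ?d = "\<lambda>p l. dot P sV (sum_list ns) (fcomp P p ns (map fst l)) (tprod sV (map snd l))"
  have "?d (p + p') l = ?d p l + ?d p' l" "?d (scl P c p) l = fscale c (?d p l)"
    if "list_all2 (\<lambda>a u. a \<in> Poly_Mapping.keys u) l us" for l
  proof -
    note g = good[OF that]
    have f: "fcomp P (p + p') ns (map fst l) = fcomp P p ns (map fst l) + fcomp P p' ns (map fst l)"
      "fcomp P (scl P c p) ns (map fst l) = scl P c (fcomp P p ns (map fst l))"
      using fcomp_from_add[OF good_fam[OF g] p, of 0] fcomp_from_scale[OF good_fam[OF g] p(1), of 0]
      by (simp_all add: fcomp_def)
    show "?d (p + p') l = ?d p l + ?d p' l" "?d (scl P c p) l = fscale c (?d p l)"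
      unfolding f using fcomp_closed[OF good_fam[OF g]] p good_tprod[OF g]
      by (simp_all add: dot_add_left dot_scale_left)
  qed
  then show "F_op P sV (p + p') ns us = F_op P sV p ns us + F_op P sV p' ns us"
    "F_op P sV (scl P c p) ns us = fscale c (F_op P sV p ns us)"
    unfolding F_op_def add[symmetric] scale[symmetric] by (auto intro!: cong)
qed

lemma aop_op:
  assumes p: "p \<in> ar P (length as)" "p' \<in> ar P (length as)" and as: "set as \<subseteq> F"
  shows "aop (p + p') as N = aop p as N + aop p' as N" and "aop (scl P c p) as N = fscale c (aop p as N)"
proof -
  note us = parts_in_F_deg[OF as]
  show "aop (p + p') as N = aop p as N + aop p' as N"
    unfolding Fbar_op_def sum.distrib[symmetric]
    using F_op_op(1)[OF _ _ us] p by (intro sum.cong) auto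
  show "aop (scl P c p) as N = fscale c (aop p as N)"
    unfolding Fbar_op_def free.scale_sum_right
    using F_op_op(2)[OF _ _ us] p by (intro sum.cong) auto
qed

definition linmap :: "('v \<Rightarrow> nat \<Rightarrow> ('p \<times> ('v list \<Rightarrow>\<^sub>0 'k) \<Rightarrow>\<^sub>0 'k)) \<Rightarrow> bool" where
  "linmap h \<longleftrightarrow> (\<forall>v. h v \<in> F) \<and> (\<forall>u v. h (u + v) = h u + h v) \<and>
     (\<forall>c v. h (sV c v) = (\<lambda>n. fscale c (h v n)))"

lemma linmap_emb: "linmap (emb P sV)"
proof -
  have w: "word sV [v] \<in> tpow sV 1" for v using word_in_tpow[of sV "[v]"] by simp
  have "word sV [u + v] = word sV [u] + word sV [v]" "word sV [sV c v] = fscale c (word sV [v])" for u v c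
    using word_add[of 0 "[0]" sV u v] word_scale[of 0 "[0]" sV c v] by simp_all
  then show ?thesis
    unfolding linmap_def using unit_ar w emb_in_Fbar
    by (intro conjI allI ext) (simp_all add: emb_def dot_add_right dot_scale_right del: One_nat_def)
qed

lemma linmap_hom_deg_ev:
  assumes "s \<in> ar Q n" "0 < n" shows "linmap (\<lambda>v. hom_deg n (ev n s v))"
  unfolding linmap_def using assms
  by (auto simp: ev_add ev_scale hom_deg_def intro!: Fbar_hom_deg[unfolded hom_deg_def] ev_in_F_deg)

abbreviation app :: "('v \<Rightarrow> nat \<Rightarrow> ('p \<times> ('v list \<Rightarrow>\<^sub>0 'k) \<Rightarrow>\<^sub>0 'k)) list \<Rightarrow> 'v list \<Rightarrow>
    (nat \<Rightarrow> ('p \<times> ('v list \<Rightarrow>\<^sub>0 'k) \<Rightarrow>\<^sub>0 'k)) list" where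
  "app \<equiv> map2 (\<lambda>h v. h v)"

lemma app_in_Fbar: "list_all linmap hs \<Longrightarrow> set (app hs xs) \<subseteq> F"
  by (auto simp: list_all_iff linmap_def dest!: set_zip_leftD)

lemma app_append: "length hs = length xs \<Longrightarrow> app (hs @ hs') (xs @ xs') = app hs xs @ app hs' xs'"
  by simp

text \<open>The maps in \<open>hs\<close> may differ from slot to slot, so a permutation of the
  slots would permute them. The expression therefore takes an operation and a tensor separately,
  before any passage to coinvariants.\<close>

definition subst :: "'p \<Rightarrow> ('v \<Rightarrow> nat \<Rightarrow> ('p \<times> ('v list \<Rightarrow>\<^sub>0 'k) \<Rightarrow>\<^sub>0 'k)) list \<Rightarrow> ('v list \<Rightarrow>\<^sub>0 'k) \<Rightarrow> nat \<Rightarrow>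
    ('p \<times> ('v list \<Rightarrow>\<^sub>0 'k) \<Rightarrow>\<^sub>0 'k)" where
  "subst q hs t N = lext (\<lambda>xs. aop q (app hs xs) N) t"

lemma linear_subst: "Vector_Spaces.linear fscale fscale (\<lambda>t. subst q hs t N)"
  unfolding subst_def by (rule linear_lext)

lemma subst_word:
  assumes hs: "list_all linmap hs" and len: "length xs = length hs"
  shows "subst q hs (word sV xs) N = aop q (app hs xs) N"
  unfolding subst_def
proof (rule lext_word[OF _ len], rule mlin_onI)
  fix xs :: "'v list" and k u v c assume k: "length xs = length hs" "k < length hs"
  have up: "app hs (xs[k := u]) = (app hs xs)[k := (hs ! k) u]" for u
    using k by (intro nth_equalityI) (auto simp: nth_list_update)
  have h: "linmap (hs ! k)" using hs k by (simp add: list_all_length)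
  show "aop q (app hs (xs[k := u + v])) N = aop q (app hs (xs[k := u])) N + aop q (app hs (xs[k := v])) N"
    using h k aop_add[of k "app hs xs" q "(hs ! k) u" "(hs ! k) v"] unfolding up linmap_def by simp
  show "aop q (app hs (xs[k := sV c u])) N = fscale c (aop q (app hs (xs[k := u])) N)"
    using h k aop_scale[of k "app hs xs" q c "(hs ! k) u"] unfolding up linmap_def by simp
qed

lemma bilin_subst:
  assumes hs: "list_all linmap hs" "length hs = a"
  shows "bilin_on (scl P) (scl C) (ar P a) (ar C a) (\<lambda>q f. subst q hs (f v) N)"
proof (rule bilin_onI)
  fix q q' f assume q: "q \<in> ar P a" "q' \<in> ar P a" and f: "f \<in> ar C a"
  have len: "length (app hs xs) = a" if "xs \<in> Poly_Mapping.keys (f v)" for xs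
    using keys_tpow[OF arC_in_tpow[OF f], of v] that hs(2) by auto
  show "subst (q + q') hs (f v) N = subst q hs (f v) N + subst q' hs (f v) N"
    unfolding subst_def lext_fun_add[symmetric]
    using q by (intro lext_cong aop_op(1) app_in_Fbar hs) (simp_all only: len)
next
  fix c q f assume q: "q \<in> ar P a" and f: "f \<in> ar C a"
  have len: "length (app hs xs) = a" if "xs \<in> Poly_Mapping.keys (f v)" for xs
    using keys_tpow[OF arC_in_tpow[OF f], of v] that hs(2) by auto
  show "subst (scl P c q) hs (f v) N = fscale c (subst q hs (f v) N)"
    unfolding subst_def lext_fun_scale[symmetric]
    using q by (intro lext_cong aop_op(2) app_in_Fbar hs) (simp_all only: len)
qed (simp_all add: sclC_apply lin_add[OF linear_subst] lin_scale[OF linear_subst])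

definition subst_Q :: "('p \<times> ('v \<Rightarrow> ('v list \<Rightarrow>\<^sub>0 'k)) \<Rightarrow>\<^sub>0 'k) \<Rightarrow> 'v \<Rightarrow> ('v \<Rightarrow> nat \<Rightarrow> ('p \<times> ('v list \<Rightarrow>\<^sub>0 'k) \<Rightarrow>\<^sub>0 'k)) list \<Rightarrow> nat \<Rightarrow>
    ('p \<times> ('v list \<Rightarrow>\<^sub>0 'k) \<Rightarrow>\<^sub>0 'k)" where
  "subst_Q s v hs = (\<lambda>N. lext (\<lambda>(q, f). subst q hs (f v) N) s)"

lemma aop_lext:
  "aop p (as @ (\<lambda>N. lext (\<lambda>a. G a N) t) # bs) N = lext (\<lambda>a. aop p (as @ G a # bs) N) t"
proof -
  have e: "(\<lambda>N. lext (\<lambda>a. G a N) t) = (\<Sum>a\<in>Poly_Mapping.keys t. (\<lambda>N. fscale (Poly_Mapping.lookup t a) (G a N)))"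
    by (rule ext) (simp add: lext_def sum_fun_apply)
  have add: "aop p (as @ (x + y) # bs) = aop p (as @ x # bs) + aop p (as @ y # bs)" for x y
    using aop_add[of "length as" "as @ 0 # bs" p x y] by simp
  have scale: "aop p (as @ (\<lambda>N. fscale c (x N)) # bs) = (\<lambda>N. fscale c (aop p (as @ x # bs) N))" for c x
    using aop_scale[of "length as" "as @ 0 # bs" p c x] by simp
  show ?thesis
    unfolding e additive_sum[where f = "\<lambda>x. aop p (as @ x # bs)", OF add] scale sum_fun_apply
    unfolding lext_def ..
qed

lemma subst_circ:
  assumes q: "q \<in> ar P (length hs1 + 1 + length hs3)" and q': "q' \<in> ar P (length hs2)" "hs2 \<noteq> []"
    and f: "f \<in> ar C (length hs2)" and t: "t \<in> tpow sV (length hs1 + 1 + length hs3)"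
    and hs: "list_all linmap hs1" "list_all linmap hs2" "list_all linmap hs3"
  shows "subst (circ P (length hs1 + 1 + length hs3) (length hs2) (length hs1) q q') (hs1 @ hs2 @ hs3) (tapply sV (length hs1) f t) N =
    lext (\<lambda>xs. lext (\<lambda>ys. aop q (app hs1 (take (length hs1) xs) @ aop q' (app hs2 ys) # app hs3 (drop (Suc (length hs1)) xs)) N)
      (f (xs ! length hs1))) t"
proof -
  let ?i = "length hs1"
  let ?c = "circ P (?i + 1 + length hs3) (length hs2) ?i q q'"
  let ?S = "\<lambda>t. subst ?c (hs1 @ hs2 @ hs3) t N"
  have lin: "Vector_Spaces.linear fscale fscale (\<lambda>t. ?S (tapply sV ?i f t))"
    by (rule linear_compose[OF linear_tapply linear_subst])
  have "?S (tapply sV ?i f t) = ?S (tapply sV ?i f (lext (word sV) t))"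
    by (simp add: tpow_expand[OF t])
  also have "\<dots> = lext (\<lambda>xs. ?S (tapply sV ?i f (word sV xs))) t"
    by (rule lin_lext[OF lin])
  also have "\<dots> = lext (\<lambda>xs. lext (\<lambda>ys. aop q (app hs1 (take ?i xs) @ aop q' (app hs2 ys) # app hs3 (drop (Suc ?i) xs)) N)
      (f (xs ! ?i))) t"
  proof (rule lext_cong)
    fix xs assume "xs \<in> Poly_Mapping.keys t"
    then have xs: "length xs = ?i + 1 + length hs3" using keys_tpow[OF t] by auto
    let ?T = "\<lambda>u. ?S (tmul sV (word sV (take ?i xs)) (tmul sV u (word sV (drop (Suc ?i) xs))))"
    have linT: "Vector_Spaces.linear fscale fscale ?T"
      by (rule linear_compose[OF linear_compose[OF linear_tmul_left linear_tmul_right] linear_subst])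
    have fx: "f (xs ! ?i) \<in> tpow sV (length hs2)" by (rule arC_in_tpow[OF f])
    have "?S (tapply sV ?i f (word sV xs)) = ?T (f (xs ! ?i))"
      using xs by (simp add: tapply_word[OF arC_linear[OF f]] tmul_word_Nil_right[OF word_in_tpow])
    also have "\<dots> = ?T (lext (word sV) (f (xs ! ?i)))" by (simp add: tpow_expand[OF fx])
    also have "\<dots> = lext (\<lambda>ys. ?T (word sV ys)) (f (xs ! ?i))" by (rule lin_lext[OF linT])
    also have "\<dots> = lext (\<lambda>ys. aop q (app hs1 (take ?i xs) @ aop q' (app hs2 ys) # app hs3 (drop (Suc ?i) xs)) N) (f (xs ! ?i))"
    proof (rule lext_cong)
      fix ys assume "ys \<in> Poly_Mapping.keys (f (xs ! ?i))"
      then have ys: "length ys = length hs2" using keys_tpow[OF fx] by auto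
      have "?T (word sV ys) = aop ?c (app (hs1 @ hs2 @ hs3) (take ?i xs @ ys @ drop (Suc ?i) xs)) N"
        unfolding tmul_word using xs ys hs by (intro subst_word) simp_all
      also have "app (hs1 @ hs2 @ hs3) (take ?i xs @ ys @ drop (Suc ?i) xs) =
          app hs1 (take ?i xs) @ app hs2 ys @ app hs3 (drop (Suc ?i) xs)"
        using xs ys by simp
      also have "aop ?c \<dots> = aop q (app hs1 (take ?i xs) @ aop q' (app hs2 ys) # app hs3 (drop (Suc ?i) xs))"
      proof -
        have l: "length (app hs1 (take ?i xs)) = ?i" "length (app hs2 ys) = length hs2"
          "length (app hs3 (drop (Suc ?i) xs)) = length hs3" using xs ys by simp_all
        note ac = aop_circ[of q "app hs1 (take ?i xs)" "app hs3 (drop (Suc ?i) xs)" q' "app hs2 ys", unfolded l]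
        have "app hs2 ys \<noteq> []" using l(2) q'(2) by (metis length_0_conv)
        then show ?thesis by (intro ac q q' app_in_Fbar hs)
      qed
      finally show "?T (word sV ys) = aop q (app hs1 (take ?i xs) @ aop q' (app hs2 ys) # app hs3 (drop (Suc ?i) xs)) N" .
    qed
    finally show "?S (tapply sV ?i f (word sV xs)) =
        lext (\<lambda>ys. aop q (app hs1 (take ?i xs) @ aop q' (app hs2 ys) # app hs3 (drop (Suc ?i) xs)) N) (f (xs ! ?i))" .
  qed
  finally show ?thesis .
qed

text \<open>In the factor P this is the algebra axiom \<open>aop_circ\<close>. In the factor C the
  inserted map expands one letter into a word, whose letters feed the maps \<open>hs2\<close>.
  Together the inserted element \<open>t\<close> acts as a single map in its slot.\<close>

lemma subst_Q_circ:
  assumes s: "s \<in> ar Q (length hs1 + 1 + length hs3)" and t: "t \<in> ar Q (length hs2)" "hs2 \<noteq> []"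
    and hs: "list_all linmap hs1" "list_all linmap hs2" "list_all linmap hs3"
  shows "subst_Q (circ Q (length hs1 + 1 + length hs3) (length hs2) (length hs1) s t) v (hs1 @ hs2 @ hs3) =
    subst_Q s v (hs1 @ (\<lambda>w. subst_Q t w hs2) # hs3)"
proof
  fix N
  let ?i = "length hs1" and ?a = "length hs1 + 1 + length hs3" and ?n = "length hs2"
  let ?X = "\<lambda>q xs q' ys. aop q (app hs1 (take ?i xs) @ aop q' (app hs2 ys) # app hs3 (drop (Suc ?i) xs)) N"
  have n: "?i < ?a" "?a + ?n - 1 = length (hs1 @ hs2 @ hs3)" using t(2) by auto
  have "subst_Q (circ Q ?a ?n ?i s t) v (hs1 @ hs2 @ hs3) N =
      lext (\<lambda>(q, f). lext (\<lambda>(q', f'). subst (circ P ?a ?n ?i q q') (hs1 @ hs2 @ hs3) (tapply sV ?i f' (f v)) N) t) s"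
    unfolding subst_Q_def Q_simps(2) lext_lext
  proof (rule lext_cong, clarify)
    fix q f assume "(q, f) \<in> Poly_Mapping.keys s"
    then have q: "q \<in> ar P ?a" "f \<in> ar C ?a" using keys_Q[OF s] by auto
    show "lext (\<lambda>(q, f). subst q (hs1 @ hs2 @ hs3) (f v) N)
        (lext (\<lambda>(a', b'). pure_op P C (?a + ?n - 1) (circ P ?a ?n ?i q a') (circ C ?a ?n ?i f b')) t) =
      lext (\<lambda>(q', f'). subst (circ P ?a ?n ?i q q') (hs1 @ hs2 @ hs3) (tapply sV ?i f' (f v)) N) t"
      unfolding lext_lext
    proof (rule lext_cong, clarify)
      fix q' f' assume "(q', f') \<in> Poly_Mapping.keys t"
      then have q': "q' \<in> ar P ?n" "f' \<in> ar C ?n" using keys_Q[OF t(1)] by auto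
      have "bilin_on (scl P) (scl C) (ar P (?a + ?n - 1)) (ar C (?a + ?n - 1)) (\<lambda>q f. subst q (hs1 @ hs2 @ hs3) (f v) N)"
        unfolding n(2) using hs by (intro bilin_subst) simp_all
      from lext_pure_op[OF this circ_ar[OF n(1) q(1) q'(1)] circC_closed[OF n(1) q(2) q'(2)]]
      show "lext (\<lambda>(q, f). subst q (hs1 @ hs2 @ hs3) (f v) N)
          (pure_op P C (?a + ?n - 1) (circ P ?a ?n ?i q q') (circ C ?a ?n ?i f f')) =
        subst (circ P ?a ?n ?i q q') (hs1 @ hs2 @ hs3) (tapply sV ?i f' (f v)) N"
        by (simp only: coend_simps(3))
    qed
  qed
  also have "\<dots> = lext (\<lambda>(q, f). lext (\<lambda>(q', f'). lext (\<lambda>xs. lext (\<lambda>ys. ?X q xs q' ys) (f' (xs ! ?i))) (f v)) t) s"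
  proof (rule lext_cong, clarify, rule lext_cong, clarify)
    fix q f q' f' assume "(q, f) \<in> Poly_Mapping.keys s" "(q', f') \<in> Poly_Mapping.keys t"
    then show "subst (circ P ?a ?n ?i q q') (hs1 @ hs2 @ hs3) (tapply sV ?i f' (f v)) N =
        lext (\<lambda>xs. lext (\<lambda>ys. ?X q xs q' ys) (f' (xs ! ?i))) (f v)"
      using keys_Q[OF s] keys_Q[OF t(1)] hs t(2) by (intro subst_circ arC_in_tpow) auto
  qed
  \<comment> \<open>The expansions of \<open>t\<close> and of the tensor \<open>f v\<close> are
    interchanged, so that \<open>t\<close> can be summed inside the slot of the letter it acts
    on.\<close>
  also have "\<dots> = lext (\<lambda>(q, f). lext (\<lambda>xs. lext (\<lambda>(q', f'). lext (\<lambda>ys. ?X q xs q' ys) (f' (xs ! ?i))) t) (f v)) s"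
  proof (rule lext_cong, clarify)
    fix q f
    show "lext (\<lambda>(q', f'). lext (\<lambda>xs. lext (\<lambda>ys. ?X q xs q' ys) (f' (xs ! ?i))) (f v)) t =
        lext (\<lambda>xs. lext (\<lambda>(q', f'). lext (\<lambda>ys. ?X q xs q' ys) (f' (xs ! ?i))) t) (f v)"
      unfolding case_prod_beta by (rule lext_swap)
  qed
  also have "\<dots> = subst_Q s v (hs1 @ (\<lambda>w. subst_Q t w hs2) # hs3) N"
    unfolding subst_Q_def[of s]
  proof (rule lext_cong, clarify)
    fix q f assume "(q, f) \<in> Poly_Mapping.keys s"
    then have f: "f \<in> ar C ?a" using keys_Q[OF s] by auto
    show "lext (\<lambda>xs. lext (\<lambda>(q', f'). lext (\<lambda>ys. ?X q xs q' ys) (f' (xs ! ?i))) t) (f v) =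
        subst q (hs1 @ (\<lambda>w. subst_Q t w hs2) # hs3) (f v) N"
      unfolding subst_def[of q]
    proof (rule lext_cong)
      fix xs assume "xs \<in> Poly_Mapping.keys (f v)"
      then have xs: "length xs = ?a" using keys_tpow[OF arC_in_tpow[OF f]] by auto
      have "xs = take ?i xs @ xs ! ?i # drop (Suc ?i) xs" using xs by (intro id_take_nth_drop) simp
      then have "app (hs1 @ (\<lambda>w. subst_Q t w hs2) # hs3) xs =
          app (hs1 @ (\<lambda>w. subst_Q t w hs2) # hs3) (take ?i xs @ xs ! ?i # drop (Suc ?i) xs)" by simp
      also have "\<dots> = app hs1 (take ?i xs) @ subst_Q t (xs ! ?i) hs2 # app hs3 (drop (Suc ?i) xs)"
        using xs by (subst app_append) simp_all
      finally have 1: "aop q (app (hs1 @ (\<lambda>w. subst_Q t w hs2) # hs3) xs) N =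
          aop q (app hs1 (take ?i xs) @ subst_Q t (xs ! ?i) hs2 # app hs3 (drop (Suc ?i) xs)) N" by simp
      also have "\<dots> = lext (\<lambda>b. aop q (app hs1 (take ?i xs) @ (\<lambda>N. case b of (q', f') \<Rightarrow> subst q' hs2 (f' (xs ! ?i)) N)
          # app hs3 (drop (Suc ?i) xs)) N) t"
        unfolding subst_Q_def by (rule aop_lext)
      also have "\<dots> = lext (\<lambda>(q', f'). lext (\<lambda>ys. ?X q xs q' ys) (f' (xs ! ?i))) t"
        unfolding subst_def case_prod_beta by (rule lext_cong, rule aop_lext)
      finally show "lext (\<lambda>(q', f'). lext (\<lambda>ys. ?X q xs q' ys) (f' (xs ! ?i))) t =
          aop q (app (hs1 @ (\<lambda>w. subst_Q t w hs2) # hs3) xs) N" ..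
    qed
  qed
  finally show "subst_Q (circ Q ?a ?n ?i s t) v (hs1 @ hs2 @ hs3) N =
      subst_Q s v (hs1 @ (\<lambda>w. subst_Q t w hs2) # hs3) N" .
qed

lemma app_replicate: "length xs = n \<Longrightarrow> app (replicate n h) xs = map h xs"
  by (intro nth_equalityI) simp_all

text \<open>A monomial is its operadic coefficient applied to generators, so generators in all slots
  reproduce plain evaluation, placed in degree \<open>n\<close>.\<close>

lemma subst_Q_emb:
  assumes t: "t \<in> ar Q n"
  shows "subst_Q t w (replicate n (emb P sV)) = hom_deg n (ev n t w)"
proof
  fix N
  have 1: "aop q (app (replicate n (emb P sV)) xs) N = hom_deg n (dot P sV n q (word sV xs)) N"
    if "q \<in> ar P n" "length xs = n" for q xs
    using that hmon_eq_aop[of q xs] by (simp add: app_replicate hmon_def)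
  have "subst_Q t w (replicate n (emb P sV)) N =
      lext (\<lambda>(q, f). lext (\<lambda>xs. hom_deg n (dot P sV n q (word sV xs)) N) (f w)) t"
    unfolding subst_Q_def subst_def
    using keys_Q[OF t] keys_tpow[OF arC_in_tpow] by (intro lext_cong, clarify, intro lext_cong 1) blast+
  also have "\<dots> = hom_deg n (ev n t w) N"
  proof (cases "N = n")
    case True
    have "lext (\<lambda>xs. dot P sV n q (word sV xs)) (f w) = dot P sV n q (f w)" if "q \<in> ar P n" "f \<in> ar C n" for q f
    proof -
      have fw: "f w \<in> tpow sV n" by (rule arC_in_tpow[OF that(2)])
      have "dot P sV n q (lext (word sV) (f w)) = lext (\<lambda>xs. dot P sV n q (word sV xs)) (f w)"
      proof (rule lin_on_lext[OF subspace_tpow])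
        show "word sV xs \<in> tpow sV n" if "xs \<in> Poly_Mapping.keys (f w)" for xs
          using keys_tpow[OF fw] that word_in_tpow[of sV xs] by auto
      qed (use \<open>q \<in> ar P n\<close> in \<open>simp_all add: dot_add_right dot_scale_right\<close>)
      then show ?thesis by (simp add: tpow_expand[OF fw])
    qed
    then show ?thesis using True keys_Q[OF t] unfolding hom_deg_def ev_def
      by (simp, intro lext_cong) auto
  next
    case False
    then have "lext (\<lambda>(q, f). lext (\<lambda>xs. hom_deg n (dot P sV n q (word sV xs)) N) (f w)) t = lext (\<lambda>_. 0) t"
      by (intro lext_cong) (auto simp: hom_deg_def lext_fun_0)
    then show ?thesis using False by (simp add: hom_deg_def lext_fun_0)
  qed
  finally show "subst_Q t w (replicate n (emb P sV)) N = hom_deg n (ev n t w) N" .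
qed

section \<open>Full composites in Q and the product \<diamond> evaluated on V\<close>

abbreviation famQ :: "nat list \<Rightarrow> ('p \<times> ('v \<Rightarrow> ('v list \<Rightarrow>\<^sub>0 'k)) \<Rightarrow>\<^sub>0 'k) list \<Rightarrow> bool" where
  "famQ \<equiv> list_all2 (\<lambda>n t. 0 < n \<and> t \<in> ar Q n)"

lemma fcomp_from_Q_closed:
  "famQ ns ts \<Longrightarrow> s \<in> ar Q a \<Longrightarrow> i + length ns \<le> a \<Longrightarrow>
    fcomp_from Q a i s ns ts \<in> ar Q (a + sum_list ns - length ns)"
proof (induction arbitrary: a i s rule: list_all2_induct)
  case (Cons n ns t ts)
  have "circ Q a n i s t \<in> ar Q (a + n - 1)" using Cons by (intro circQ_closed) auto
  from Cons.IH[OF this, of "i + n"] show ?case using Cons by (simp add: algebra_simps)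
qed simp

lemma fcomp_Q_closed: "famQ ns ts \<Longrightarrow> s \<in> ar Q (length ns) \<Longrightarrow> fcomp Q s ns ts \<in> ar Q (sum_list ns)"
  using fcomp_from_Q_closed[of ns ts s "length ns" 0] by (simp add: fcomp_def)

text \<open>With generators in all inputs of the composite, each inserted factor turns its block of
  generators into one slot that carries its own evaluation. The first \<open>i\<close> slots are
  those already passed and hold generators.\<close>

lemma subst_Q_fcomp_from:
  "famQ ns ts \<Longrightarrow> s \<in> ar Q a \<Longrightarrow> i + length ns = a \<Longrightarrow>
    subst_Q (fcomp_from Q a i s ns ts) v (replicate (i + sum_list ns) (emb P sV)) =
    subst_Q s v (replicate i (emb P sV) @ map2 (\<lambda>n t w. hom_deg n (ev n t w)) ns ts)"
proof (induction arbitrary: a i s rule: list_all2_induct)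
  case (Cons n ns t ts)
  let ?e = "emb P sV" and ?hs = "map2 (\<lambda>n t w. hom_deg n (ev n t w)) ns ts"
  have n: "0 < n" "t \<in> ar Q n" and len: "length ?hs = length ns"
    using Cons.hyps by (auto simp: list_all2_lengthD)
  have e: "list_all linmap (replicate k ?e)" for k using linmap_emb by (simp add: list_all_iff)
  have hs: "list_all linmap ?hs"
    using Cons.hyps by (auto simp: list_all_length list_all2_conv_all_nth intro!: linmap_hom_deg_ev)
  have a: "length (replicate i ?e) + 1 + length ?hs = a" using len Cons.prems by simp
  have "circ Q a n i s t \<in> ar Q (a + n - 1)" using Cons.prems n by (intro circQ_closed) auto
  then have "subst_Q (fcomp_from Q (a + n - 1) (i + n) (circ Q a n i s t) ns ts) v (replicate (i + n + sum_list ns) ?e) =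
      subst_Q (circ Q a n i s t) v (replicate (i + n) ?e @ ?hs)"
    using Cons.prems n by (intro Cons.IH) auto
  also have "\<dots> = subst_Q (circ Q a n i s t) v (replicate i ?e @ replicate n ?e @ ?hs)"
    by (simp add: replicate_add)
  also have "\<dots> = subst_Q s v (replicate i ?e @ (\<lambda>w. subst_Q t w (replicate n ?e)) # ?hs)"
    using subst_Q_circ[of s "replicate i ?e" ?hs t "replicate n ?e"] Cons.prems n e hs
    unfolding a by (simp del: replicate_Suc)
  also have "(\<lambda>w. subst_Q t w (replicate n ?e)) = (\<lambda>w. hom_deg n (ev n t w))"
    using subst_Q_emb[OF n(2)] by simp
  finally show ?case by (simp add: add.assoc)
qed simp

lemma ev_fcomp:
  assumes "famQ ns ts" "s \<in> ar Q (length ns)"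
  shows "hom_deg (sum_list ns) (ev (sum_list ns) (fcomp Q s ns ts) v) =
    subst_Q s v (map2 (\<lambda>n t w. hom_deg n (ev n t w)) ns ts)"
  using subst_Q_fcomp_from[OF assms, of 0 v] subst_Q_emb[OF fcomp_Q_closed[OF assms]]
  by (simp add: fcomp_def)

lemma famQ_M:
  assumes "y \<in> M" "0 \<notin> set ns" shows "famQ ns (map y ns)"
  unfolding list_all2_conv_all_nth
proof (intro conjI allI impI)
  fix i assume i: "i < length ns"
  show "0 < ns ! i" using assms(2) i by (metis gr0I nth_mem)
  then show "map y ns ! i \<in> ar Q (ns ! i)" using i by (simp add: coinv_in_Q M_deg assms(1))
qed simp

lemma length_le_sum_list: "0 \<notin> set ns \<Longrightarrow> length ns \<le> sum_list (ns :: nat list)"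
  by (induction ns) auto

lemma loz_in_M:
  assumes x: "x \<in> M" and y: "y \<in> M" shows "loz Q x y \<in> M"
  unfolding M_iff
proof (intro conjI allI impI)
  have "ns = []" if "sum_list ns = 0" "0 \<notin> set ns" for ns :: "nat list"
    using length_le_sum_list[OF that(2)] that(1) by simp
  then have "{ns. sum_list ns = 0 \<and> 0 \<notin> set ns} = {[] :: nat list}"
    by (auto simp del: sum_list_eq_0_iff)
  then show "loz Q x y 0 = 0"
    using x by (simp add: loz_def M_iff fcomp_def lin_0[OF linear_coinv_map])
  fix N :: nat assume N: "1 \<le> N"
  show "loz Q x y N \<in> coinv Q N"
    unfolding loz_def
  proof (rule free.subspace_sum[OF subspace_coinv], rule coinv_mapI)
    fix ns assume "ns \<in> {ns. sum_list ns = N \<and> 0 \<notin> set ns}"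
    then have ns: "sum_list ns = N" "0 \<notin> set ns" by auto
    then have "0 < length ns" using N by auto
    then have "x (length ns) \<in> ar Q (length ns)" by (intro coinv_in_Q M_deg x)
    from fcomp_Q_closed[OF famQ_M[OF y ns(2)] this]
    show "fcomp Q (x (length ns)) ns (map y ns) \<in> ar Q N" by (simp add: ns)
  qed
qed

text \<open>Splitting every series y(v) into homogeneous parts, degree \<open>N\<close> collects one
  term for each composition of \<open>N\<close> into \<open>r\<close> positive parts.\<close>

lemma subst_Q_expand:
  assumes s: "s \<in> ar Q r"
  shows "subst_Q s v (replicate r (eval y)) N =
    (\<Sum>ns | length ns = r \<and> sum_list ns = N \<and> 0 \<notin> set ns.
      subst_Q s v (map2 (\<lambda>n t w. hom_deg n (ev n t w)) ns (map y ns)) N)"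
proof -
  let ?A = "{ns. length ns = r \<and> sum_list ns = N \<and> 0 \<notin> set ns}"
  let ?h = "\<lambda>ns. map2 (\<lambda>n t w. hom_deg n (ev n t w)) ns (map y ns)"
  have 1: "aop q (app (replicate r (eval y)) xs) N = (\<Sum>ns\<in>?A. aop q (app (?h ns) xs) N)"
    if xs: "length xs = r" for q xs
  proof -
    have "aop q (app (replicate r (eval y)) xs) N = (\<Sum>ns\<in>?A. F_op P sV q ns (map2 (\<lambda>x. x) (map (eval y) xs) ns))"
      using xs by (simp add: app_replicate Fbar_op_def)
    also have "\<dots> = (\<Sum>ns\<in>?A. aop q (app (?h ns) xs) N)"
    proof (rule sum.cong[OF refl])
      fix ns assume ns: "ns \<in> ?A"
      have "app (?h ns) xs = map2 hom_deg ns (map2 (\<lambda>x. x) (map (eval y) xs) ns)"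
        using ns xs by (intro nth_equalityI) (simp_all add: eval_def)
      then have "aop q (app (?h ns) xs) = hom_deg (sum_list ns) (F_op P sV q ns (map2 (\<lambda>x. x) (map (eval y) xs) ns))"
        using ns xs aop_hom_deg[of "map2 (\<lambda>x. x) (map (eval y) xs) ns" ns q] by simp
      then show "F_op P sV q ns (map2 (\<lambda>x. x) (map (eval y) xs) ns) = aop q (app (?h ns) xs) N"
        using ns by (simp add: hom_deg_def)
    qed
    finally show ?thesis .
  qed
  show ?thesis
    unfolding subst_Q_def lext_fun_sum[symmetric]
  proof (rule lext_cong, clarify)
    fix q f assume "(q, f) \<in> Poly_Mapping.keys s"
    then have "f \<in> ar C r" using keys_Q[OF s] by auto
    then show "subst q (replicate r (eval y)) (f v) N = (\<Sum>ns\<in>?A. subst q (?h ns) (f v) N)"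
      unfolding subst_def lext_fun_sum[symmetric] using keys_tpow[OF arC_in_tpow]
      by (intro lext_cong 1) blast
  qed
qed

text \<open>The compositions of \<open>N\<close> in the definition of \<diamond> are grouped by
  their number \<open>r\<close> of parts; each group is the expansion of substituting the series
  \<open>y\<close> into all slots of \<open>x r\<close>.\<close>

lemma eval_loz:
  assumes x: "x \<in> M" and y: "y \<in> M"
  shows "eval (loz Q x y) v N = (\<Sum>r\<in>{1..N}. subst_Q (x r) v (replicate r (eval y)) N)"
proof (cases "N = 0")
  case True
  then show ?thesis using loz_in_M[OF x y] by (simp add: eval_def M_iff lin_0[OF linear_ev])
next
  case False
  let ?A = "{ns. sum_list ns = N \<and> 0 \<notin> set ns}"
  let ?f = "\<lambda>ns. subst_Q (x (length ns)) v (map2 (\<lambda>n t w. hom_deg n (ev n t w)) ns (map y ns)) N"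
  have "eval (loz Q x y) v N = (\<Sum>ns\<in>?A. ev N (fcomp Q (x (length ns)) ns (map y ns)) v)"
    by (simp add: eval_def loz_def lin_sum[OF linear_ev] ev_coinv_map)
  also have "\<dots> = sum ?f ?A"
  proof (rule sum.cong[OF refl])
    fix ns assume "ns \<in> ?A"
    then have ns: "sum_list ns = N" "0 \<notin> set ns" by auto
    then have "0 < length ns" using False by auto
    then have xr: "x (length ns) \<in> ar Q (length ns)" by (intro coinv_in_Q M_deg x)
    from fun_cong[OF ev_fcomp[OF famQ_M[OF y ns(2)] xr, of v], of N]
    show "ev N (fcomp Q (x (length ns)) ns (map y ns)) v = ?f ns"
      unfolding ns(1) hom_deg_def[of N] by (simp only: simp_thms if_True)
  qed
  also have "\<dots> = (\<Sum>r\<in>{1..N}. sum ?f {ns \<in> ?A. length ns = r})"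
  proof (rule sum.group[symmetric])
    have "length ns \<in> {1..N}" if "ns \<in> ?A" for ns
      using that length_le_sum_list[of ns] False by (cases ns) auto
    then show "length ` ?A \<subseteq> {1..N}" by blast
  qed (simp_all add: finite_compositions)
  also have "\<dots> = (\<Sum>r\<in>{1..N}. subst_Q (x r) v (replicate r (eval y)) N)"
  proof (rule sum.cong[OF refl])
    fix r assume "r \<in> {1..N}"
    then have "x r \<in> ar Q r" by (intro coinv_in_Q M_deg x) simp
    moreover have "{ns \<in> ?A. length ns = r} = {ns. length ns = r \<and> sum_list ns = N \<and> 0 \<notin> set ns}" by auto
    ultimately show "sum ?f {ns \<in> ?A. length ns = r} = subst_Q (x r) v (replicate r (eval y)) N"
      using subst_Q_expand[of "x r" r v y N] by (auto intro!: sum.cong)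
  qed
  finally show ?thesis .
qed

end

section \<open>Multiplicativity of \<phi>\<close>

context char0_free_algebra
begin

text \<open>The action does not lower the valuation, so the part of \<open>z\<close> in degrees
  above \<open>N\<close> is invisible in degree \<open>N\<close>.\<close>

lemma md_act_sum_deg:
  assumes y: "y \<in> M" and z: "z \<in> F"
  shows "md_act P sV z y N = (\<Sum>r\<in>{1..N}. md_act P sV (hom_deg r (z r)) y N)"
proof -
  let ?t = "\<Sum>n\<in>{1..N}. hom_deg n (z n)"
  have h: "hom_deg n (z n) \<in> F" if "n \<in> {1..N}" for n
    using that by (intro Fbar_hom_deg Fbar_deg[OF z]) auto
  have t: "?t \<in> F" by (intro Fbar_sum h)
  have "(z - ?t) m = 0" if "m \<le> N" for m
    using that Fbar_at_0[OF z] by (cases "m = 0") (auto simp: sum_fun_apply hom_deg_def sum.delta)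
  then have "vanishes N (md_act P sV (z - ?t) y)"
    using z t by (intro md_act_vanishes y Fbar_diff) (auto simp: vanishes_def)
  then have "md_act P sV (z - ?t) y N = 0" by (simp add: vanishes_def)
  moreover have "md_act P sV z y = md_act P sV (z - ?t) y + md_act P sV ?t y"
    using md_act_add[OF y Fbar_diff[OF z t] t] by simp
  moreover have "md_act P sV (\<Sum>n\<in>A. hom_deg n (z n)) y N = (\<Sum>n\<in>A. md_act P sV (hom_deg n (z n)) y N)"
    if "A \<subseteq> {1..N}" for A
    using finite_subset[OF that finite_atLeastAtMost] that
  proof (induction A rule: finite_induct)
    case empty
    have "vanishes N (md_act P sV 0 y)" by (intro md_act_vanishes y Fbar_zero) (simp add: vanishes_def)
    then have "md_act P sV 0 y N = 0" by (simp only: vanishes_def order_refl)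
    then show ?case by (simp only: sum.empty)
  next
    case (insert n A)
    have 1: "md_act P sV (hom_deg n (z n) + (\<Sum>n\<in>A. hom_deg n (z n))) y =
        md_act P sV (hom_deg n (z n)) y + md_act P sV (\<Sum>n\<in>A. hom_deg n (z n)) y"
      using insert by (intro md_act_add y Fbar_sum h) auto
    have 2: "md_act P sV (\<Sum>n\<in>A. hom_deg n (z n)) y N = (\<Sum>n\<in>A. md_act P sV (hom_deg n (z n)) y N)"
      using insert by blast
    have "md_act P sV (\<Sum>n\<in>insert n A. hom_deg n (z n)) y = md_act P sV (hom_deg n (z n) + (\<Sum>n\<in>A. hom_deg n (z n))) y"
      by (rule arg_cong[where f = "\<lambda>z. md_act P sV z y"]) (rule sum.insert[OF insert.hyps])
    also note 1
    finally have "md_act P sV (\<Sum>n\<in>insert n A. hom_deg n (z n)) y N =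
        (md_act P sV (hom_deg n (z n)) y + md_act P sV (\<Sum>n\<in>A. hom_deg n (z n)) y) N"
      by (rule fun_cong)
    also have "\<dots> = md_act P sV (hom_deg n (z n)) y N + md_act P sV (\<Sum>n\<in>A. hom_deg n (z n)) y N"
      by (rule plus_fun_apply)
    also note 2
    also have "md_act P sV (hom_deg n (z n)) y N + (\<Sum>n\<in>A. md_act P sV (hom_deg n (z n)) y N) =
        (\<Sum>n\<in>insert n A. md_act P sV (hom_deg n (z n)) y N)"
      by (rule sum.insert[OF insert.hyps, symmetric])
    finally show ?case .
  qed
  ultimately show ?thesis by simp
qed

text \<open>Both sides are linear in the representative \<open>s\<close>. Expanding \<open>s\<close>
  and then the tensor f(v) leaves monomials, where the formula p.(y(x1), ..., y(xn))
  applies.\<close>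

lemma md_act_ev:
  assumes y: "y \<in> M" and s: "s \<in> ar Q r" and r: "0 < r"
  shows "md_act P sV (hom_deg r (ev r s v)) y N = subst_Q s v (replicate r (eval y)) N"
proof -
  let ?L = "\<lambda>u. md_act P sV (hom_deg r u) y N"
  have L1: "?L (u + v) = ?L u + ?L v" if "u \<in> F_deg P sV r" "v \<in> F_deg P sV r" for u v
    unfolding hom_deg_add using md_act_add[OF y Fbar_hom_deg[OF that(1) r] Fbar_hom_deg[OF that(2) r]] by simp
  have L2: "?L (fscale c u) = fscale c (?L u)" if "u \<in> F_deg P sV r" for u c
  proof -
    have "hom_deg r (fscale c u) = (\<lambda>n. fscale c (hom_deg r u n))" by (auto simp: hom_deg_def)
    then show "?L (fscale c u) = fscale c (?L u)"
      using md_act_scale[OF y Fbar_hom_deg[OF that r], of c] by simp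
  qed
  note lin = lin_on_lext[where L = ?L, OF subspace_F_deg[of r]]
  have 1: "?L (dot P sV r q t) = subst q (replicate r (eval y)) t N" if q: "q \<in> ar P r" and t: "t \<in> tpow sV r" for q t
  proof -
    have k: "length xs = r" if "xs \<in> Poly_Mapping.keys t" for xs using keys_tpow[OF t] that by auto
    have w: "word sV xs \<in> tpow sV r" if "xs \<in> Poly_Mapping.keys t" for xs
      using word_in_tpow[of sV xs] k[OF that] by simp
    have "dot P sV r q t = dot P sV r q (lext (word sV) t)" by (simp add: tpow_expand[OF t])
    also have "\<dots> = lext (\<lambda>xs. dot P sV r q (word sV xs)) t"
      using q w by (intro lin_on_lext[OF subspace_tpow] dot_add_right dot_scale_right)
    finally have "?L (dot P sV r q t) = ?L (lext (\<lambda>xs. dot P sV r q (word sV xs)) t)"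
      by (rule arg_cong)
    also have "\<dots> = lext (\<lambda>xs. ?L (dot P sV r q (word sV xs))) t"
      by (rule lin) (intro L1 L2 dot_in_F_deg[OF q w]; assumption)+
    also have "\<dots> = subst q (replicate r (eval y)) t N"
      unfolding subst_def
    proof (rule lext_cong)
      fix xs assume "xs \<in> Poly_Mapping.keys t"
      then have xs: "length xs = r" by (rule k)
      then have "hom_deg r (dot P sV r q (word sV xs)) = hmon q xs" by (simp add: hmon_def)
      then show "?L (dot P sV r q (word sV xs)) = aop q (app (replicate r (eval y)) xs) N"
        using md_act_hmon[OF y, of q xs] xs q r by (auto simp: app_replicate)
    qed
    finally show ?thesis .
  qed
  have kQ: "q \<in> ar P r" "f v \<in> tpow sV r" if "(q, f) \<in> Poly_Mapping.keys s" for q f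
    using keys_Q[OF s] that arC_in_tpow by auto
  have "?L (ev r s v) = lext (\<lambda>a. ?L (case a of (q, f) \<Rightarrow> dot P sV r q (f v))) s"
    unfolding ev_def
  proof (rule lin)
    show "(case a of (q, f) \<Rightarrow> dot P sV r q (f v)) \<in> F_deg P sV r" if "a \<in> Poly_Mapping.keys s" for a
      using that kQ by (cases a) (auto intro!: dot_in_F_deg)
  qed (intro L1 L2; assumption)+
  also have "\<dots> = subst_Q s v (replicate r (eval y)) N"
    unfolding subst_Q_def
  proof (rule lext_cong)
    fix a assume a: "a \<in> Poly_Mapping.keys s"
    obtain q f where qf: "a = (q, f)" by (cases a)
    show "?L (case a of (q, f) \<Rightarrow> dot P sV r q (f v)) = (case a of (q, f) \<Rightarrow> subst q (replicate r (eval y)) (f v) N)"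
      unfolding qf prod.case using a qf by (intro 1 kQ) simp_all
  qed
  finally show ?thesis .
qed

lemma eval_loz_md_act:
  assumes x: "x \<in> M" and y: "y \<in> M"
  shows "eval (loz Q x y) v = md_act P sV (eval x v) y"
proof
  fix N
  have "md_act P sV (eval x v) y N = (\<Sum>r\<in>{1..N}. md_act P sV (hom_deg r (ev r (x r) v)) y N)"
    using md_act_sum_deg[OF y eval_in_Fbar[OF x], of v N] by (simp add: eval_def)
  also have "\<dots> = (\<Sum>r\<in>{1..N}. subst_Q (x r) v (replicate r (eval y)) N)"
    by (intro sum.cong refl md_act_ev y coinv_in_Q M_deg x) auto
  finally show "eval (loz Q x y) v N = md_act P sV (eval x v) y N"
    using eval_loz[OF x y] by simp
qed

text \<open>On a generator, acting by \<open>x\<close> gives x(v), and acting by \<open>y\<close>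
  afterwards gives the value of x \<diamond> y. The second factor acts last, hence the reversal;
  agreement on generators decides.\<close>

lemma phi_loz:
  assumes x: "x \<in> M" and y: "y \<in> M"
  shows "phi P sV (loz Q x y) = compose F (phi P sV y) (phi P sV x)"
proof (rule E_ext)
  show "phi P sV (loz Q x y) \<in> E" by (intro phi_in_E loz_in_M x y)
  show "compose F (phi P sV y) (phi P sV x) \<in> E" by (intro E_compose phi_in_E x y)
  show "phi P sV (loz Q x y) (emb P sV v) = compose F (phi P sV y) (phi P sV x) (emb P sV v)" for v
    by (simp add: phi_emb x y loz_in_M compose_def emb_in_Fbar eval_loz_md_act)
      (simp add: phi_def eval_in_Fbar x)
qed

lemma phi_unit: "phi P sV (coinv_unit Q) = (\<lambda>x\<in>F. x)"
  by (rule E_ext[OF phi_in_E[OF coinv_unit_in_M] E_id])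
    (simp add: phi_emb coinv_unit_in_M eval_coinv_unit emb_in_Fbar)

end

section \<open>Transport along anti-isomorphisms\<close>

text \<open>As \<open>h\<close> is injective, each axiom can be tested after applying it, where the
  factors appear in reverse order and the axiom is known in \<open>H\<close>. Associativity of
  \<diamond> thus needs no computation of iterated composites.\<close>

lemma monoid_if_anti_iso:
  assumes H: "monoid H" and h: "bij_betw h (carrier G) (carrier H)"
    and closed: "\<And>x y. x \<in> carrier G \<Longrightarrow> y \<in> carrier G \<Longrightarrow> x \<otimes>\<^bsub>G\<^esub> y \<in> carrier G" "\<one>\<^bsub>G\<^esub> \<in> carrier G"
    and hom: "\<And>x y. x \<in> carrier G \<Longrightarrow> y \<in> carrier G \<Longrightarrow> h (x \<otimes>\<^bsub>G\<^esub> y) = h y \<otimes>\<^bsub>H\<^esub> h x" "h \<one>\<^bsub>G\<^esub> = \<one>\<^bsub>H\<^esub>"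
  shows "monoid G"
proof -
  interpret H: monoid H by fact
  have inj: "x = y" if "h x = h y" "x \<in> carrier G" "y \<in> carrier G" for x y
    using h that by (auto simp: bij_betw_def dest: inj_onD)
  have hc: "h x \<in> carrier H" if "x \<in> carrier G" for x
    using h that by (auto simp: bij_betw_def)
  show ?thesis
    by (rule monoidI) (auto intro!: inj simp: closed hom hc H.m_assoc)
qed

lemma group_if_anti_iso:
  assumes H: "group H" and h: "bij_betw h (carrier G) (carrier H)"
    and closed: "\<And>x y. x \<in> carrier G \<Longrightarrow> y \<in> carrier G \<Longrightarrow> x \<otimes>\<^bsub>G\<^esub> y \<in> carrier G" "\<one>\<^bsub>G\<^esub> \<in> carrier G"
    and hom: "\<And>x y. x \<in> carrier G \<Longrightarrow> y \<in> carrier G \<Longrightarrow> h (x \<otimes>\<^bsub>G\<^esub> y) = h y \<otimes>\<^bsub>H\<^esub> h x" "h \<one>\<^bsub>G\<^esub> = \<one>\<^bsub>H\<^esub>"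
  shows "group G"
proof -
  interpret H: group H by fact
  interpret G: monoid G by (rule monoid_if_anti_iso[OF H.is_monoid h closed hom])
  show ?thesis
  proof (rule G.group_l_invI)
    fix x assume x: "x \<in> carrier G"
    then have hx: "h x \<in> carrier H" using h by (auto simp: bij_betw_def)
    then have "inv\<^bsub>H\<^esub> h x \<in> h ` carrier G" using h by (simp add: bij_betw_def)
    then obtain y where y: "y \<in> carrier G" "h y = inv\<^bsub>H\<^esub> h x" by auto
    have "h (y \<otimes>\<^bsub>G\<^esub> x) = h \<one>\<^bsub>G\<^esub>" using x y hx by (simp add: hom)
    then have "y \<otimes>\<^bsub>G\<^esub> x = \<one>\<^bsub>G\<^esub>"
      using h x y closed by (auto simp: bij_betw_def dest: inj_onD)
    then show "\<exists>y\<in>carrier G. y \<otimes>\<^bsub>G\<^esub> x = \<one>\<^bsub>G\<^esub>" using y by blast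
  qed
qed

section \<open>Lowest degree components\<close>

context free_algebra
begin

text \<open>A number is a sum of that many positive integers only as a sum of ones. So in the lowest
  possible degree an operation sees just the linear parts of its arguments.\<close>

lemma aop_lowest:
  "aop p as (length as) = F_op P sV p (replicate (length as) 1) (map (\<lambda>a. a 1) as)"
proof -
  have "ns = replicate (length ns) 1" if "sum_list ns = length ns" "0 \<notin> set ns" for ns :: "nat list"
    using that
  proof (induction ns)
    case (Cons n ns)
    then have "n = 1" "sum_list ns = length ns" using length_le_sum_list[of ns] by auto
    then show ?case using Cons by simp
  qed simp
  then have "{ns. length ns = length as \<and> sum_list ns = length as \<and> 0 \<notin> set ns} = {replicate (length as) (1::nat)}"
    by (auto simp: sum_list_replicate) metis
  moreover have "map2 (\<lambda>x. x) as (replicate (length as) 1) = map (\<lambda>a. a 1) as"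
    by (intro nth_equalityI) simp_all
  ultimately show ?thesis by (simp add: Fbar_op_def)
qed

text \<open>The compositions of Q are defined by \<open>lext\<close> on the whole free space, which
  makes them additive in the first argument without any condition on arities.\<close>

lemma fcomp_from_Q_add:
  "fcomp_from Q a i (s + s') ns ts = fcomp_from Q a i s ns ts + fcomp_from Q a i s' ns ts"
proof (induction ns arbitrary: a i s s' ts)
  case (Cons n ns)
  show ?case
  proof (cases ts)
    case (Cons t ts')
    have "circ Q a n i (s + s') t = circ Q a n i s t + circ Q a n i s' t"
      unfolding Q_simps(2) by (rule lext_add)
    then show ?thesis unfolding Cons fcomp_from.simps by (simp only: Cons.IH)
  qed simp
qed simp

lemma loz_add_left: "loz Q (x + x') y = loz Q x y + loz Q x' y"
  by (rule ext) (simp add: loz_def fcomp_def fcomp_from_Q_add lin_add[OF linear_coinv_map] sum.distrib)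

lemma loz_at_1:
  assumes "x 1 = 0" shows "loz Q x y 1 = 0"
  unfolding loz_def
proof (rule sum.neutral, rule ballI)
  fix ns :: "nat list" assume "ns \<in> {ns. sum_list ns = 1 \<and> 0 \<notin> set ns}"
  then have ns: "sum_list ns = 1" "0 \<notin> set ns" by auto
  then have "length ns \<noteq> 0" "length ns \<le> 1" using length_le_sum_list[OF ns(2)] by auto
  then have l: "length ns = 1" by linarith
  have "fcomp_from Q 1 0 0 ns (map y ns) = 0"
    using fcomp_from_Q_add[of 1 0 0 0 ns "map y ns"] by simp
  then show "coinv_map Q 1 (fcomp Q (x (length ns)) ns (map y ns)) = 0"
    unfolding fcomp_def l assms by (simp add: lin_0[OF linear_coinv_map])
qed

abbreviation T where "T \<equiv> carrier (tangent_autos P sV)"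

lemma GB_iff: "x \<in> carrier (GB Q) \<longleftrightarrow> x \<in> M \<and> x 1 = 0"
proof -
  have "x \<in> carrier (GB Q) \<longleftrightarrow> x 0 = 0 \<and> x 1 = 0 \<and> (\<forall>n\<ge>2. x n \<in> coinv Q n)"
    by (simp add: GB_def)
  also have "\<dots> \<longleftrightarrow> x 0 = 0 \<and> (\<forall>n\<ge>1. x n \<in> coinv Q n) \<and> x 1 = 0"
  proof (intro iffI conjI allI impI; (elim conjE)?)
    fix n :: nat assume x: "x 1 = 0" "\<forall>n\<ge>2. x n \<in> coinv Q n" and n: "1 \<le> n"
    show "x n \<in> coinv Q n"
    proof (cases "n = 1")
      case True
      then show ?thesis using x(1) free.subspace_0[OF subspace_coinv] by simp
    next
      case False
      then show ?thesis using x(2) n by simp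
    qed
  qed auto
  finally show ?thesis by (simp add: M_iff)
qed

end

locale char0_fd_free_algebra = char0_free_algebra P sV + fd_free_algebra P sV
  for P :: "('k::field_char_0, 'p::ab_group_add) operad_data"
    and sV :: "'k \<Rightarrow> 'v::ab_group_add \<Rightarrow> 'v"
begin

section \<open>The anti-isomorphisms\<close>

lemma eval_inj:
  assumes y: "y \<in> M" "y' \<in> M" and e: "\<And>v. eval y v = eval y' v"
  shows "y = y'"
proof
  fix n
  show "y n = y' n"
  proof (cases "n = 0")
    case True
    then show ?thesis using y by (simp add: M_iff)
  next
    case False
    then have d: "y n - y' n \<in> coinv Q n"
      using y by (intro free.subspace_diff[OF subspace_coinv] M_deg) auto
    have "ev n (y n - y' n) v = 0" for v
      using fun_cong[OF e, of v n] by (simp add: eval_def lin_diff[OF linear_ev])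
    from ev_inj[OF d this] show ?thesis by simp
  qed
qed

lemma phi_inj:
  assumes "y \<in> M" "y' \<in> M" "phi P sV y = phi P sV y'" shows "y = y'"
  using assms by (intro eval_inj) (simp_all flip: phi_emb)

text \<open>In each degree the restriction of \<open>f\<close> to generators is a linear map on V,
  hence the evaluation of a class. The classes form the required \<open>y\<close>, and the two
  endomorphisms agree on generators.\<close>

lemma phi_surj:
  assumes f: "f \<in> E" obtains y where "y \<in> M" "phi P sV y = f"
proof -
  have fF: "f x \<in> F" if "x \<in> F" for x using f that by (auto simp: E_iff PiE_iff)
  have add: "f (x + y) = f x + f y" if "x \<in> F" "y \<in> F" for x y
    using f that by (auto simp: E_iff hom_F_def contin_def)
  have scale: "f (\<lambda>n. fscale c (x n)) = (\<lambda>n. fscale c (f x n))" if "x \<in> F" for c x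
    using f that by (auto simp: E_iff)
  have e: "emb P sV (u + v) = emb P sV u + emb P sV v" "emb P sV (sV c v) = (\<lambda>n. fscale c (emb P sV v n))" for u v c
    using linmap_emb by (simp_all add: linmap_def)
  have "\<exists>y. y \<in> coinv Q n \<and> ev n y = (\<lambda>v. f (emb P sV v) n)" if n: "0 < n" for n
  proof -
    have Y: "f (emb P sV (u + v)) n = f (emb P sV u) n + f (emb P sV v) n"
      "f (emb P sV (sV c v)) n = fscale c (f (emb P sV v) n)" for u v c
      unfolding e by (simp_all add: add scale emb_in_Fbar)
    have "f (emb P sV v) n \<in> F_deg P sV n" for v by (intro Fbar_deg fF emb_in_Fbar n)
    from ev_surj[of "\<lambda>v. f (emb P sV v) n", OF Y this] show ?thesis by metis
  qed
  then obtain y where y: "\<And>n. 0 < n \<Longrightarrow> y n \<in> coinv Q n" "\<And>n. 0 < n \<Longrightarrow> ev n (y n) = (\<lambda>v. f (emb P sV v) n)"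
    by metis
  \<comment> \<open>The classes were chosen in positive degrees only; degree 0 is set to zero as
    membership in the monoid demands.\<close>
  let ?y = "\<lambda>n. if n = 0 then 0 else y n"
  have yM: "?y \<in> M" using y by (simp add: M_iff)
  have "eval ?y v = f (emb P sV v)" for v
  proof
    fix n
    show "eval ?y v n = f (emb P sV v) n"
      using Fbar_at_0[OF fF[OF emb_in_Fbar]] y(2)[of n]
      by (cases "n = 0") (simp_all add: eval_def lin_0[OF linear_ev])
  qed
  then have "phi P sV ?y = f" by (intro E_ext phi_in_E yM f) (simp add: phi_emb[OF yM])
  then show thesis using that yM by blast
qed

lemma bij_betw_phi: "bij_betw (phi P sV) M E"
  unfolding bij_betw_def
proof (intro conjI inj_onI equalityI subsetI)
  show "x = y" if "x \<in> M" "y \<in> M" "phi P sV x = phi P sV y" for x y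
    using that by (rule phi_inj)
  show "f \<in> E" if "f \<in> phi P sV ` M" for f using that phi_in_E by blast
  show "f \<in> phi P sV ` M" if f: "f \<in> E" for f by (rule phi_surj[OF f]) blast
qed

lemma loz_unit_left: "z \<in> M \<Longrightarrow> loz Q (coinv_unit Q) z = z"
proof (rule phi_inj)
  assume z: "z \<in> M"
  have "phi P sV z \<in> F \<rightarrow>\<^sub>E F" using phi_in_E[OF z] by (simp add: E_iff)
  then show "phi P sV (loz Q (coinv_unit Q) z) = phi P sV z"
    unfolding phi_loz[OF coinv_unit_in_M z] phi_unit by (intro compose_Id) (auto simp: PiE_iff)
qed (simp_all add: loz_in_M coinv_unit_in_M)

lemma tangent_phi_iff:
  assumes "y \<in> M"
  shows "tangent_to_id P sV (phi P sV y) \<longleftrightarrow> (\<forall>v. eval y v 1 = emb P sV v 1)"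
  unfolding tangent_to_id_def Fbar2_def phi_emb[OF assms]
  using Fbar_diff[OF eval_in_Fbar[OF assms] emb_in_Fbar] by auto

text \<open>Write f as \<phi> of some y whose linear part is the identity. If z starts in degree N +
  1, the component of f(z) there depends only on that component of z, and on monomials it sees only
  the linear parts of the series y(v). So it is left unchanged.\<close>

lemma tangent_raises:
  assumes f: "f \<in> E" "tangent_to_id P sV f" and z: "z \<in> F" "vanishes N z"
  shows "vanishes (Suc N) (f z - z)"
proof -
  obtain y where y: "y \<in> M" and fy: "f = phi P sV y" by (metis phi_surj[OF f(1)])
  have e: "eval y v 1 = emb P sV v 1" for v
    using f(2) unfolding fy tangent_phi_iff[OF y] by blast
  let ?L = "Suc N"
  have top: "md_act P sV (hom_deg ?L u) y ?L = u" if "u \<in> F_deg P sV ?L" for u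
    using that
  proof (induction rule: F_deg_induct)
    case zero
    have "vanishes ?L (md_act P sV 0 y)" by (intro md_act_vanishes y Fbar_zero) (simp add: vanishes_def)
    then show ?case unfolding hom_deg_0 vanishes_def by blast
  next
    case (dot q xs)
    have h: "hom_deg ?L (dot P sV ?L q (word sV xs)) = hmon q xs" using dot by (simp add: hmon_def)
    have q: "q \<in> ar P (length xs)" "xs \<noteq> []" using dot by auto
    have "md_act P sV (hmon q xs) y ?L = aop q (map (eval y) xs) (length xs)"
      by (simp only: md_act_hmon[OF y q] dot)
    also have "\<dots> = aop q (map (emb P sV) xs) (length xs)"
      using aop_lowest[of q "map (eval y) xs"] aop_lowest[of q "map (emb P sV) xs"] e
      by (simp add: comp_def del: One_nat_def)
    also have "\<dots> = hmon q xs ?L" by (simp only: hmon_eq_aop[OF q(1)] dot)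
    also have "\<dots> = dot P sV ?L q (word sV xs)" using dot by (simp add: hmon_def hom_deg_def)
    finally show ?case unfolding h .
  next
    case (add u v)
    have "md_act P sV (hom_deg ?L (u + v)) y = md_act P sV (hom_deg ?L u) y + md_act P sV (hom_deg ?L v) y"
      unfolding hom_deg_add using add by (intro md_act_add y Fbar_hom_deg) auto
    then show ?case using add by simp
  qed
  have fz: "f z = md_act P sV z y" unfolding fy phi_def using z by simp
  have "md_act P sV z y ?L = (\<Sum>r\<in>{1..?L}. if r = ?L then z ?L else 0)"
    unfolding md_act_sum_deg[OF y z(1)]
  proof (rule sum.cong[OF refl])
    fix r assume r: "r \<in> {1..?L}"
    show "md_act P sV (hom_deg r (z r)) y ?L = (if r = ?L then z ?L else 0)"
    proof (cases "r = ?L")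
      case True
      then show ?thesis using top[OF Fbar_deg[OF z(1), of ?L]] by simp
    next
      case False
      then have "z r = 0" using r z(2) by (simp add: vanishes_def)
      moreover have "vanishes ?L (md_act P sV 0 y)" by (intro md_act_vanishes y Fbar_zero) (simp add: vanishes_def)
      ultimately show ?thesis using False by (simp only: hom_deg_0 vanishes_def if_False)
    qed
  qed
  then have "f z ?L = z ?L" unfolding fz by simp
  moreover have "vanishes N (f z)" unfolding fz by (rule md_act_vanishes[OF y z])
  ultimately show ?thesis using z(2) by (auto simp: vanishes_def le_Suc_eq)
qed

lemma E_diff: "f \<in> E \<Longrightarrow> x \<in> F \<Longrightarrow> y \<in> F \<Longrightarrow> f (x - y) = f x - f y"
proof -
  assume f: "f \<in> E" and xy: "x \<in> F" "y \<in> F"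
  have "f (x - y + y) = f (x - y) + f y"
    using f Fbar_diff[OF xy] xy(2) unfolding E_iff hom_F_def contin_def by blast
  then show ?thesis by simp
qed

lemma E_in_Fbar: "f \<in> E \<Longrightarrow> x \<in> F \<Longrightarrow> f x \<in> F"
  by (auto simp: E_iff PiE_iff)

text \<open>If z vanishes up to k, then f(z) - z vanishes one degree further. As f(z) vanishes there
  by assumption, so does z, and the argument climbs to \<open>N\<close>.\<close>

lemma tangent_preserves_val:
  assumes f: "f \<in> E" "tangent_to_id P sV f" and z: "z \<in> F" and v: "vanishes N (f z)"
  shows "vanishes N z"
proof -
  have "vanishes k z" if "k \<le> N" for k
    using that
  proof (induction k)
    case 0
    then show ?case using Fbar_at_0[OF z] by (simp add: vanishes_def)
  next
    case (Suc k)
    then have "vanishes (Suc k) (f z - z)" by (intro tangent_raises[OF f z]) simp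
    then show ?case using v Suc.prems by (simp add: vanishes_def)
  qed
  then show ?thesis by simp
qed

lemma tangent_inj_on:
  assumes f: "f \<in> E" "tangent_to_id P sV f"
  shows "inj_on f F"
proof (rule inj_onI)
  fix x y assume xy: "x \<in> F" "y \<in> F" "f x = f y"
  have "f (x - y) = f x - f y" by (rule E_diff[OF f(1) xy(1,2)])
  then have "vanishes N (f (x - y))" for N using xy(3) by (simp add: vanishes_def)
  then have "vanishes N (x - y)" for N by (rule tangent_preserves_val[OF f Fbar_diff[OF xy(1,2)]])
  then have "(x - y) n = 0" for n unfolding vanishes_def by blast
  then show "x = y" by (simp add: fun_eq_iff)
qed

text \<open>Preimages are fixed points of \<open>s \<mapsto> z - (f s - s)\<close>, which is contracting for the valuation
  distance.\<close>

lemma tangent_surj_on: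
  assumes f: "f \<in> E" "tangent_to_id P sV f" and z: "z \<in> F"
  shows "\<exists>x\<in>F. f x = z"
proof -
  define s where "s k = ((\<lambda>s. z - (f s - s)) ^^ k) 0" for k
  have s_Suc: "s (Suc k) = z - (f (s k) - s k)" for k by (simp add: s_def)
  have sF: "s k \<in> F" for k
  proof (induction k)
    case 0
    have "s 0 = 0" unfolding s_def by (rule funpow_0)
    then show ?case using Fbar_zero by (simp only:)
  next
    case (Suc k)
    then show ?case unfolding s_Suc using E_in_Fbar[OF f(1)] z by (intro Fbar_diff)
  qed
  have step: "vanishes k (s (Suc k) - s k)" for k
  proof (induction k)
    case 0
    show ?case using Fbar_at_0[OF sF] by (simp add: vanishes_def)
  next
    case (Suc k)
    let ?d = "s (Suc k) - s k"
    have "f ?d = f (s (Suc k)) - f (s k)" by (rule E_diff[OF f(1) sF sF])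
    \<comment> \<open>Subtracting two consecutive iterations cancels \<open>z\<close>; what remains
      is f - id applied to the previous difference, which gains one degree.\<close>
    then have "s (Suc (Suc k)) - s (Suc k) = - (f ?d - ?d)"
      unfolding s_Suc[of "Suc k"] by (subst (2) s_Suc) (simp add: algebra_simps)
    moreover have "vanishes (Suc k) (f ?d - ?d)"
      by (rule tangent_raises[OF f Fbar_diff[OF sF sF] Suc.IH])
    ultimately show ?case by (simp add: vanishes_def)
  qed
  have stable: "s (m + j) m = s m m" for m j
  proof (induction j)
    case (Suc j)
    have "(s (Suc (m + j)) - s (m + j)) m = 0" using step[of "m + j"] unfolding vanishes_def by simp
    then show ?case using Suc by simp
  qed simp
  \<comment> \<open>Component \<open>m\<close> no longer changes from iterate \<open>m\<close> on,
    so the diagonal is the limit of the iterates.\<close>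
  define x where "x m = s m m" for m
  have xF: "x \<in> F" by (rule FbarI) (simp_all add: x_def Fbar_at_0[OF sF] Fbar_deg[OF sF])
  have "f x N = z N" for N
  proof -
    have "s N m = x m" if "m \<le> N" for m using stable[of m "N - m"] that by (simp add: x_def)
    then have v: "vanishes N (x - s N)" by (simp add: vanishes_def)
    have "vanishes N (f (x - s N) - (x - s N))"
      using tangent_raises[OF f Fbar_diff[OF xF sF] v] by (simp add: vanishes_def)
    then have "f x N = f (s N) N"
      using v unfolding E_diff[OF f(1) xF sF] by (simp add: vanishes_def)
    moreover have "(s (Suc N) - s N) N = 0" using step[of N] by (simp only: vanishes_def order_refl)
    ultimately show ?thesis unfolding s_Suc by simp
  qed
  then show ?thesis using xF by blast
qed

lemma T_iff: "f \<in> T \<longleftrightarrow> f \<in> E \<and> tangent_to_id P sV f"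
proof -
  have "bij_betw f F F" if f: "f \<in> E" "tangent_to_id P sV f"
    unfolding bij_betw_def
  proof (intro conjI tangent_inj_on f equalityI subsetI)
    show "y \<in> F" if "y \<in> f ` F" for y using that E_in_Fbar[OF f(1)] by auto
    show "y \<in> f ` F" if "y \<in> F" for y using tangent_surj_on[OF f that] by blast
  qed
  then show ?thesis by (auto simp: tangent_autos_def)
qed

lemma T_bij: "f \<in> T \<Longrightarrow> bij_betw f F F"
  by (simp add: tangent_autos_def)

lemma tangentI:
  assumes "f \<in> E" "\<And>v. vanishes 1 (f (emb P sV v) - emb P sV v)"
  shows "tangent_to_id P sV f"
  unfolding tangent_to_id_def Fbar2_def
  using assms(2) Fbar_diff[OF E_in_Fbar[OF assms(1) emb_in_Fbar] emb_in_Fbar] by (auto simp: vanishes_def)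

lemma vanishes_add: "vanishes N x \<Longrightarrow> vanishes N y \<Longrightarrow> vanishes N (x + y)"
  for x y :: "nat \<Rightarrow> 'c::monoid_add"
  by (simp add: vanishes_def)

lemma vanishes_0: "x \<in> F \<Longrightarrow> vanishes 0 x"
  by (simp add: vanishes_def Fbar_at_0)

text \<open>Every element of F vanishes in degree 0, so the gain of one degree is available on all
  of F. Tangency, stated on generators, thereby applies to arbitrary elements such as images under
  another map.\<close>

lemma T_raises_1: "f \<in> T \<Longrightarrow> x \<in> F \<Longrightarrow> vanishes 1 (f x - x)"
  using tangent_raises[of f x 0] vanishes_0 by (simp add: T_iff)

lemma T_compose: "f \<in> T \<Longrightarrow> g \<in> T \<Longrightarrow> compose F f g \<in> T"
proof -
  assume f: "f \<in> T" and g: "g \<in> T"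
  have E: "compose F f g \<in> E" using f g by (intro E_compose) (simp_all add: T_iff)
  moreover have "tangent_to_id P sV (compose F f g)"
  proof (rule tangentI[OF E])
    fix v
    have gF: "g (emb P sV v) \<in> F" using g by (intro E_in_Fbar[OF _ emb_in_Fbar]) (simp add: T_iff)
    have "compose F f g (emb P sV v) - emb P sV v =
        (f (g (emb P sV v)) - g (emb P sV v)) + (g (emb P sV v) - emb P sV v)"
      by (simp add: compose_def emb_in_Fbar)
    then show "vanishes 1 (compose F f g (emb P sV v) - emb P sV v)"
      using vanishes_add[OF T_raises_1[OF f gF] T_raises_1[OF g emb_in_Fbar, of v]] by (simp only:)
  qed
  ultimately show ?thesis by (simp add: T_iff)
qed

lemma T_id: "(\<lambda>x\<in>F. x) \<in> T"
  unfolding T_iff using E_id by (intro conjI tangentI) (simp_all add: emb_in_Fbar vanishes_def)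

text \<open>The identities for the inverse are obtained by applying \<open>f\<close> and using
  injectivity. Its continuity is the statement that \<open>f\<close> reflects vanishing up to
  \<open>N\<close>, and its tangency is that of \<open>f\<close> read at the preimage of a
  generator.\<close>

lemma T_inverse:
  assumes f: "f \<in> T" shows "restrict (inv_into F f) F \<in> T"
proof -
  let ?g = "inv_into F f"
  have fE: "f \<in> E" "tangent_to_id P sV f" using f by (simp_all add: T_iff)
  have gF: "?g x \<in> F" and fg: "f (?g x) = x" if "x \<in> F" for x
    using T_bij[OF f] that by (auto simp: bij_betw_def inv_into_into f_inv_into_f)
  have eq: "?g x = y" if "y \<in> F" "f y = x" for x y
    using that T_bij[OF f] by (auto simp: bij_betw_def inv_into_f_f)
  have add: "f (x + y) = f x + f y" if "x \<in> F" "y \<in> F" for x y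
    using fE(1) that by (auto simp: E_iff hom_F_def contin_def)
  have scale: "f (\<lambda>n. fscale c (x n)) = (\<lambda>n. fscale c (f x n))" if "x \<in> F" for c x
    using fE(1) that by (auto simp: E_iff)
  have aop: "f (aop p as) = aop p (map f as)" if "p \<in> ar P (length as)" "set as \<subseteq> F" for p as
    using fE(1) that by (auto simp: E_iff hom_F_def)
  have "hom_F ?g"
    unfolding hom_F_def
  proof (intro conjI ballI allI impI gF)
    show "contin ?g"
    proof (rule continI)
      show "?g (x + y) = ?g x + ?g y" if "x \<in> F" "y \<in> F" for x y
        by (rule eq[OF Fbar_add[OF gF[OF that(1)] gF[OF that(2)]]])
          (simp only: add[OF gF[OF that(1)] gF[OF that(2)]] fg[OF that(1)] fg[OF that(2)])
      show "vanishes N (?g x)" if "x \<in> F" "vanishes N x" for N x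
        using that by (intro tangent_preserves_val[OF fE gF]) (simp_all add: fg)
    qed
    fix p as assume p: "p \<in> ar P (length as)" and as: "set as \<subseteq> F"
    have gas: "set (map ?g as) \<subseteq> F" using gF as by auto
    have "map f (map ?g as) = as" unfolding map_map by (rule map_idI) (use fg as in auto)
    then show "?g (aop p as) = aop p (map ?g as)"
      using p gas by (intro eq aop_in_Fbar) (simp_all only: aop length_map)
  qed
  moreover have "?g (\<lambda>n. fscale c (x n)) = (\<lambda>n. fscale c (?g x n))" if "x \<in> F" for c x
    by (rule eq[OF Fbar_scale[OF gF[OF that]]]) (simp only: scale[OF gF[OF that]] fg[OF that])
  ultimately have gE: "restrict ?g F \<in> E"
    unfolding E_iff using gF hom_F_restrict Fbar_scale by auto
  have "tangent_to_id P sV (restrict ?g F)"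
  proof (rule tangentI[OF gE])
    fix v
    have "vanishes 1 (f (?g (emb P sV v)) - ?g (emb P sV v))"
      by (intro T_raises_1 f gF emb_in_Fbar)
    then show "vanishes 1 (restrict ?g F (emb P sV v) - emb P sV v)"
      by (simp add: fg emb_in_Fbar vanishes_def)
  qed
  with gE show ?thesis by (simp add: T_iff)
qed

lemma group_tangent_autos: "group (tangent_autos P sV)"
proof (rule groupI)
  have mult: "x \<otimes>\<^bsub>tangent_autos P sV\<^esub> y = compose F x y" for x y by (simp add: tangent_autos_def)
  have one: "\<one>\<^bsub>tangent_autos P sV\<^esub> = (\<lambda>x\<in>F. x)" by (simp add: tangent_autos_def)
  show "x \<otimes>\<^bsub>tangent_autos P sV\<^esub> y \<in> T" if "x \<in> T" "y \<in> T" for x y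
    unfolding mult using that by (rule T_compose)
  show "\<one>\<^bsub>tangent_autos P sV\<^esub> \<in> T" unfolding one by (rule T_id)
  have F: "x \<in> F \<rightarrow> F" "x \<in> extensional F" if "x \<in> T" for x
    using that by (auto simp: T_iff E_iff PiE_iff)
  show "x \<otimes>\<^bsub>tangent_autos P sV\<^esub> y \<otimes>\<^bsub>tangent_autos P sV\<^esub> z =
      x \<otimes>\<^bsub>tangent_autos P sV\<^esub> (y \<otimes>\<^bsub>tangent_autos P sV\<^esub> z)" if "x \<in> T" "y \<in> T" "z \<in> T" for x y z
    unfolding mult using compose_assoc[OF F(1)[OF that(3)], of x y] by simp
  show "\<one>\<^bsub>tangent_autos P sV\<^esub> \<otimes>\<^bsub>tangent_autos P sV\<^esub> x = x" if "x \<in> T" for x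
    unfolding mult one by (rule Id_compose[OF F[OF that]])
  show "\<exists>y\<in>T. y \<otimes>\<^bsub>tangent_autos P sV\<^esub> x = \<one>\<^bsub>tangent_autos P sV\<^esub>" if x: "x \<in> T" for x
  proof
    show "restrict (inv_into F x) F \<in> T" by (rule T_inverse[OF x])
    show "restrict (inv_into F x) F \<otimes>\<^bsub>tangent_autos P sV\<^esub> x = \<one>\<^bsub>tangent_autos P sV\<^esub>"
      unfolding mult one using T_bij[OF x] by (rule compose_inv_into_id)
  qed
qed

text \<open>Tangency of \<phi> of y says that y(v) has degree one part v, that is, that the arity
  one component of y - I evaluates to zero everywhere. Injectivity of \<open>ev\<close> makes this
  component zero.\<close>

lemma bij_betw_GB:
  "bij_betw (\<lambda>x. phi P sV (coinv_unit Q + x)) (carrier (GB Q)) T"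
  unfolding bij_betw_def
proof (intro conjI inj_onI equalityI subsetI)
  fix x y assume "x \<in> carrier (GB Q)" "y \<in> carrier (GB Q)" "phi P sV (coinv_unit Q + x) = phi P sV (coinv_unit Q + y)"
  then have "coinv_unit Q + x = coinv_unit Q + y"
    by (intro phi_inj M_add coinv_unit_in_M) (simp_all add: GB_iff)
  then show "x = y" by (simp only: add_left_cancel)
next
  fix f assume "f \<in> (\<lambda>x. phi P sV (coinv_unit Q + x)) ` carrier (GB Q)"
  then obtain x where x: "x \<in> M" "x 1 = 0" and f: "f = phi P sV (coinv_unit Q + x)" by (auto simp: GB_iff)
  have ux: "coinv_unit Q + x \<in> M" by (intro M_add coinv_unit_in_M x)
  have "eval (coinv_unit Q + x) v 1 = emb P sV v 1" for v
  proof -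
    have "eval x v 1 = 0" unfolding eval_def x(2) by (rule lin_0[OF linear_ev])
    then show ?thesis unfolding eval_add eval_coinv_unit by simp
  qed
  then show "f \<in> T" unfolding T_iff f using phi_in_E[OF ux] tangent_phi_iff[OF ux] by blast
next
  fix f assume f: "f \<in> T"
  then obtain y where y: "y \<in> M" "phi P sV y = f" by (metis T_iff phi_surj)
  let ?x = "y - coinv_unit Q"
  have xM: "?x \<in> M" by (intro M_diff y coinv_unit_in_M)
  have e: "eval y v 1 = emb P sV v 1" for v
    using f y tangent_phi_iff[OF y(1)] by (simp add: T_iff)
  have "ev 1 (?x 1) v = 0" for v
  proof -
    have "eval ?x v 1 = 0" unfolding eval_diff eval_coinv_unit using e[of v] by simp
    then show ?thesis by (simp only: eval_def)
  qed
  moreover have "?x 1 \<in> coinv Q 1" by (rule M_deg[OF xM]) simp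
  ultimately have "?x 1 = 0" by (intro ev_inj)
  then have "?x \<in> carrier (GB Q)" using xM by (simp only: GB_iff)
  moreover have "f = phi P sV (coinv_unit Q + ?x)" using y by simp
  ultimately show "f \<in> (\<lambda>x. phi P sV (coinv_unit Q + x)) ` carrier (GB Q)" by blast
qed

lemma MD_anti_iso:
  "monoid (MD Q) \<and> monoid (cont_endos P sV) \<and> phi P sV \<in> anti_iso (MD Q) (cont_endos P sV)"
proof -
  have mult: "x \<otimes>\<^bsub>MD Q\<^esub> y = loz Q x y" "\<one>\<^bsub>MD Q\<^esub> = coinv_unit Q" for x y by (simp_all add: MD_def)
  have hom: "phi P sV (x \<otimes>\<^bsub>MD Q\<^esub> y) = phi P sV y \<otimes>\<^bsub>cont_endos P sV\<^esub> phi P sV x" if "x \<in> M" "y \<in> M" for x y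
    using phi_loz[OF that] by (simp add: mult cont_endos_def)
  have one: "phi P sV \<one>\<^bsub>MD Q\<^esub> = \<one>\<^bsub>cont_endos P sV\<^esub>"
    using phi_unit by (simp add: mult cont_endos_def)
  have "monoid (MD Q)"
  proof (rule monoid_if_anti_iso[OF monoid_cont_endos bij_betw_phi])
    show "x \<otimes>\<^bsub>MD Q\<^esub> y \<in> M" if "x \<in> M" "y \<in> M" for x y
      unfolding mult using that by (rule loz_in_M)
    show "\<one>\<^bsub>MD Q\<^esub> \<in> M" unfolding mult by (rule coinv_unit_in_M)
  qed (fact hom one)+
  then show ?thesis
    using monoid_cont_endos bij_betw_phi hom one by (simp add: anti_iso_def)
qed

lemma GB_anti_iso:
  "group (GB Q) \<and> group (tangent_autos P sV) \<and>
    (\<lambda>x. phi P sV (coinv_unit Q + x)) \<in> anti_iso (GB Q) (tangent_autos P sV)"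
proof -
  let ?h = "\<lambda>x. phi P sV (coinv_unit Q + x)"
  have mult: "x \<otimes>\<^bsub>GB Q\<^esub> y = y + loz Q x (coinv_unit Q + y)" "\<one>\<^bsub>GB Q\<^esub> = 0" for x y by (simp_all add: GB_def)
  have hom: "?h (x \<otimes>\<^bsub>GB Q\<^esub> y) = ?h y \<otimes>\<^bsub>tangent_autos P sV\<^esub> ?h x"
    if "x \<in> carrier (GB Q)" "y \<in> carrier (GB Q)" for x y
  proof -
    have M: "coinv_unit Q + x \<in> M" "coinv_unit Q + y \<in> M"
      using that by (auto intro!: M_add coinv_unit_in_M simp: GB_iff)
    \<comment> \<open>Left additivity of \<diamond> splits (I + x) \<diamond> (I + y) into I
      \<diamond> (I + y) = I + y and x \<diamond> (I + y): the group product is the monoid product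
      shifted by the unit.\<close>
    have "coinv_unit Q + (x \<otimes>\<^bsub>GB Q\<^esub> y) = loz Q (coinv_unit Q + x) (coinv_unit Q + y)"
      unfolding mult loz_add_left loz_unit_left[OF M(2)] by (rule add.assoc[symmetric])
    then show ?thesis using phi_loz[OF M] by (simp add: tangent_autos_def)
  qed
  have one: "?h \<one>\<^bsub>GB Q\<^esub> = \<one>\<^bsub>tangent_autos P sV\<^esub>"
    using phi_unit by (simp add: mult tangent_autos_def)
  have closed: "x \<otimes>\<^bsub>GB Q\<^esub> y \<in> carrier (GB Q)" if "x \<in> carrier (GB Q)" "y \<in> carrier (GB Q)" for x y
  proof -
    have x: "x \<in> M" "x 1 = 0" and y: "y \<in> M" "y 1 = 0" using that by (simp_all add: GB_iff)
    have "y + loz Q x (coinv_unit Q + y) \<in> M" by (intro M_add loz_in_M coinv_unit_in_M x y)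
    moreover have "(y + loz Q x (coinv_unit Q + y)) 1 = 0"
      unfolding plus_fun_apply y(2) loz_at_1[of x, OF x(2)] by simp
    ultimately show ?thesis unfolding mult GB_iff by blast
  qed
  have "0 \<in> carrier (GB Q)"
    by (simp add: GB_def free.subspace_0[OF subspace_coinv])
  then have "group (GB Q)"
  proof -
    assume 0: "0 \<in> carrier (GB Q)"
    show ?thesis
    proof (rule group_if_anti_iso[OF group_tangent_autos bij_betw_GB])
      show "\<one>\<^bsub>GB Q\<^esub> \<in> carrier (GB Q)" unfolding mult by (rule 0)
    qed (fact closed hom one)+
  qed
  then show ?thesis
    using group_tangent_autos bij_betw_GB hom one by (simp add: anti_iso_def)
qed

end

theorem proposition58:
  fixes P :: "('k::field_char_0, 'p::ab_group_add) operad_data"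
    and sV :: "'k \<Rightarrow> 'v::ab_group_add \<Rightarrow> 'v"
  assumes "operad P"
    and "ar P 0 = {0}"
    and "\<And>n. fin_dim (scl P) (ar P n)"
    and "vector_space sV"
    and "fin_dim sV UNIV"
  shows "(monoid (MD (Q_operad P sV)) \<and> monoid (cont_endos P sV) \<and>
          phi P sV \<in> anti_iso (MD (Q_operad P sV)) (cont_endos P sV)) \<and>
         (group (GB (Q_operad P sV)) \<and> group (tangent_autos P sV) \<and>
          (\<lambda>x. phi P sV (coinv_unit (Q_operad P sV) + x)) \<in> anti_iso (GB (Q_operad P sV)) (tangent_autos P sV))"
proof -
  interpret operad P by fact
  interpret V: vector_space sV by fact
  interpret char0_fd_free_algebra P sV
    by unfold_locales (fact assms)+
  show ?thesis using MD_anti_iso GB_anti_iso by blast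
qed

end
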